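(* The initial value problem for the geodesic equation $$c_{tt}=G_c(c,c_t)c_t-\tfrac12G_c(c_t,c_t)c+D_s^{-1}\pi_0\big(\langle D_sc,D_sc_t\rangle D_sc_t-\tfrac12|D_sc_t|^2D_sc\big)$$ has unique local solutions in the Banach manifold $\mathcal I^{1,\infty}_0$. The solutions depend smoothly on $t$ and on the initial conditions $c(0,\cdot)$ and $c_t(0,\cdot)$. Moreover, the Riemannian exponential mapping $\exp$ exists and is smooth on a neighborhood of the zero section in the tangent bundle $T\mathcal I^{1,\infty}_0=\mathcal I^{1,\infty}_0\times W^{1,\infty}_0$, and the map $(c,h)\mapsto(c,\exp_c(h))$ is a local diffeomorphism from a (possibly smaller) neighborhood of the zero section to a neighborhood of the diagonal in the product $\mathcal I^{1,\infty}_0\times\mathcal I^{1,\infty}_0$.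
   Context: Let $d\ge 2$ be an integer and $S^1=\mathbb R/(2\pi\mathbb Z)$. All function spaces consist of functions $S^1\to\mathbb R^d$. $W^{1,\infty}$ is the Banach space of Lipschitz functions with norm $\|c\|_{L^\infty}+\|c_\theta\|_{L^\infty}$ (subscript $\theta$ denotes derivative), and $W^{0,\infty}=L^\infty$. Put $W^{1,\infty}_0=\{h\in W^{1,\infty}:\int_{S^1}h\,d\theta=0\}$ and $\mathcal I^{1,\infty}_0=\{c\in W^{1,\infty}_0:\operatorname{ess\,inf}_\theta|c_\theta|>0\}$, an open subset of $W^{1,\infty}_0$. For $c\in\mathcal I^{1,\infty}_0$ write $ds=|c_\theta|\,d\theta$, $D_s=|c_\theta|^{-1}\partial_\theta$, $\ell_c=\int_{S^1}ds$, and $G_c(h,k)=\frac1{\ell_c}\int_{S^1}\langle D_sh,D_sk\rangle\,ds$. Here $\pi_0$ is the $L^2(ds)$-orthogonal projection of $L^\infty$ onto $W^{0,\infty}_0=\{k\in L^\infty:\int_{S^1}k\,ds=0\}$ (a space depending on $c$), and $D_s^{-1}:W^{0,\infty}_0\to W^{1,\infty}_0$ is the inverse of the bijection $D_s:W^{1,\infty}_0\to W^{0,\infty}_0$. For $(c,h)$ near the zero section, $\exp_c(h)$ is the value at time $1$ of the solution with $c(0)=c$, $c_t(0)=h$. *)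

theory Defs
  imports "HOL-Analysis.Analysis" "HOL-Probability.Essential_Supremum"
begin

subsection \<open>Lipschitz functions of one variable are differentiable almost everywhere\<close>

lemma vitali_intervals:
  fixes T U :: "real set" and P :: "real \<Rightarrow> real \<Rightarrow> bool"
  assumes "open U" "T \<subseteq> U"
    and fine: "\<And>x d. x \<in> T \<Longrightarrow> d > 0 \<Longrightarrow> \<exists>u v. u < x \<and> x < v \<and> v - u < d \<and> P u v"
  obtains C where "countable C" "disjoint_family_on (\<lambda>(u,v). {u<..<v}) C"
    "\<And>u v. (u,v) \<in> C \<Longrightarrow> u < v \<and> P u v \<and> {u<..<v} \<subseteq> U"
    "negligible (T - (\<Union>(u,v)\<in>C. {u<..<v}))"
proof -
  define K where "K = {(u,v). u < v \<and> P u v \<and> {u<..<v} \<subseteq> U}"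
  have bl: "ball ((fst i + snd i)/2) ((snd i - fst i)/2) = {fst i<..<snd i}" for i :: "real \<times> real"
    by (auto simp: ball_eq_greaterThanLessThan field_simps)
  have "\<exists>i. i \<in> K \<and> x \<in> ball ((fst i + snd i)/2) ((snd i - fst i)/2) \<and> (snd i - fst i)/2 < d"
    if x: "x \<in> T" and "d > 0" for x d
  proof -
    obtain e where e: "e > 0" "ball x e \<subseteq> U" using assms(1,2) x open_contains_ball by blast
    obtain u v where uv: "u < x" "x < v" "v - u < min d e" "P u v"
      using fine[OF x, of "min d e"] e \<open>d > 0\<close> by auto
    have "{u<..<v} \<subseteq> ball x e" using uv by (auto simp: dist_real_def)
    then have "(u,v) \<in> K" using uv e by (auto simp: K_def)
    then show ?thesis using uv by (intro exI[of _ "(u,v)"], unfold bl) auto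
  qed
  then obtain C where C: "countable C" "C \<subseteq> K"
    "pairwise (\<lambda>i j. disjnt (ball ((fst i + snd i)/2) ((snd i - fst i)/2)) (ball ((fst j + snd j)/2) ((snd j - fst j)/2))) C"
    "negligible (T - (\<Union>i \<in> C. ball ((fst i + snd i)/2) ((snd i - fst i)/2)))"
    by (rule Vitali_covering_theorem_balls)
  show thesis
  proof
    show "countable C" by fact
    show "disjoint_family_on (\<lambda>(u,v). {u<..<v}) C"
      using C(3) unfolding bl by (auto simp: disjoint_family_on_def pairwise_def disjnt_def split_beta)
    show "u < v \<and> P u v \<and> {u<..<v} \<subseteq> U" if "(u,v) \<in> C" for u v
      using C(2) that by (auto simp: K_def)
    show "negligible (T - (\<Union>(u,v)\<in>C. {u<..<v}))"
      using C(4) unfolding bl by (simp add: split_beta)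
  qed
qed

lemma slope_gap_null:
  fixes g :: "real \<Rightarrow> real"
  assumes mono: "mono g" and cont: "continuous_on UNIV g" and pq: "p < q"
    and S: "S \<in> sets lebesgue" "bounded S"
    and lo: "\<And>x d. x \<in> S \<Longrightarrow> d > 0 \<Longrightarrow> \<exists>u v. u < x \<and> x < v \<and> v - u < d \<and> g v - g u < p * (v - u)"
    and hi: "\<And>x d. x \<in> S \<Longrightarrow> d > 0 \<Longrightarrow> \<exists>u v. u < x \<and> x < v \<and> v - u < d \<and> g v - g u > q * (v - u)"
  shows "negligible S"
proof (rule ccontr)
  assume neg: "\<not> negligible S"
  then obtain x where "x \<in> S" by fastforce
  then obtain u v where "u < x" "x < v" "g v - g u < p * (v - u)" using lo[of x 1] by auto
  moreover have "g u \<le> g v" using monoD[OF mono, of u v] calculation by auto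
  ultimately have "0 < p * (v - u)" "0 < v - u" by auto
  then have p: "p > 0" by (simp add: zero_less_mult_iff)
  define \<nu> where "\<nu> = interval_measure g"
  have contr: "continuous (at_right a) g" for a
    using cont by (auto simp: continuous_on_eq_continuous_within intro: continuous_within_subset)
  have \<nu>: "emeasure \<nu> {u<..<v} = ennreal (g v - g u)" if "u < v" for u v
  proof -
    have e: "{u<..<v} \<union> {v} = {u<..v}" using that by auto
    have "emeasure \<nu> {v..v} = ennreal (g v - g v)"
      unfolding \<nu>_def by (rule emeasure_interval_measure_Icc) (auto simp: cont monoD[OF mono])
    then have "emeasure \<nu> {v} = 0" by simp
    then have "emeasure \<nu> ({u<..<v} \<union> {v}) = emeasure \<nu> {u<..<v}"
      by (intro emeasure_Un_null_set) (auto simp: null_sets_def \<nu>_def)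
    then show ?thesis unfolding e \<nu>_def
      using emeasure_interval_measure_Ioc[of u v g] that contr mono by (auto simp: monoD)
  qed
  have Un\<nu>: "emeasure \<nu> (\<Union>(u,v)\<in>C. {u<..<v}) = (\<integral>\<^sup>+(u,v). emeasure \<nu> {u<..<v} \<partial>count_space C)"
    if "countable C" "disjoint_family_on (\<lambda>(u,v). {u<..<v}) C" for C
    by (subst emeasure_UN_countable[OF _ that]) (auto simp: \<nu>_def split_beta intro!: nn_integral_cong)
  have Unl: "emeasure lborel (\<Union>(u,v)\<in>C. {u<..<v::real}) = (\<integral>\<^sup>+(u,v). emeasure lborel {u<..<v} \<partial>count_space C)"
    if "countable C" "disjoint_family_on (\<lambda>(u,v). {u<..<v}) C" for C
    by (subst emeasure_UN_countable[OF _ that]) (auto simp: split_beta intro!: nn_integral_cong)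
  define m where "m = measure lebesgue S"
  have Sl: "S \<in> lmeasurable" using S by (simp add: bounded_set_imp_lmeasurable)
  have m: "m > 0" using neg negligible_iff_measure[of S] Sl by (auto simp: m_def zero_less_measure_iff)
  have em: "emeasure lebesgue S = ennreal m" using Sl by (simp add: m_def emeasure_eq_measure2)
  define e where "e = (q - p) * m / (2 * p)"
  have e: "e > 0" using pq m p by (simp add: e_def)
  obtain U where U: "open U" "S \<subseteq> U" "U - S \<in> lmeasurable" "emeasure lebesgue (U - S) < ennreal e"
    using sets_lebesgue_outer_open[OF S(1) e] by blast
  have "emeasure lebesgue U \<le> emeasure lebesgue S + emeasure lebesgue (U - S)"
    using emeasure_subadditive[of S lebesgue "U - S"] U S by (simp add: Un_absorb1 fmeasurableD)
  also have "\<dots> \<le> ennreal (m + e)"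
    using U(4) m e by (simp add: em add_left_mono less_imp_le)
  finally have Ule: "emeasure lborel U \<le> ennreal (m + e)"
    using U(1) by simp
  obtain C where C: "countable C" "disjoint_family_on (\<lambda>(u,v). {u<..<v}) C"
    "\<And>u v. (u,v) \<in> C \<Longrightarrow> u < v \<and> g v - g u < p * (v - u) \<and> {u<..<v} \<subseteq> U"
    "negligible (S - (\<Union>(u,v)\<in>C. {u<..<v}))"
    using vitali_intervals[OF U(1,2), of "\<lambda>u v. g v - g u < p * (v - u)"] lo by metis
  define W where "W = (\<Union>(u,v)\<in>C. {u<..<v})"
  have W: "open W" unfolding W_def by (auto intro!: open_UN)
  have "emeasure \<nu> W = (\<integral>\<^sup>+(u,v). emeasure \<nu> {u<..<v} \<partial>count_space C)"
    unfolding W_def by (rule Un\<nu>[OF C(1,2)])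
  also have "\<dots> \<le> (\<integral>\<^sup>+z. ennreal p * (case z of (u,v) \<Rightarrow> emeasure lborel {u<..<v}) \<partial>count_space C)"
  proof (rule nn_integral_mono, clarsimp)
    fix u v assume "(u,v) \<in> C"
    with C(3) have h: "u < v" "g v - g u < p * (v - u)" by auto
    then show "emeasure \<nu> {u<..<v} \<le> ennreal p * emeasure lborel {u<..<v}"
      using p by (simp add: \<nu> ennreal_mult[symmetric] ennreal_leI)
  qed
  also have "\<dots> = ennreal p * emeasure lborel W"
    unfolding W_def Unl[OF C(1,2)] by (simp add: nn_integral_cmult)
  also have "\<dots> \<le> ennreal p * emeasure lborel U"
    using C(3) U(1) by (intro mult_left_mono emeasure_mono) (auto simp: W_def)
  also have "\<dots> \<le> ennreal p * ennreal (m + e)" using Ule by (rule mult_left_mono) simp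
  also have "\<dots> = ennreal (p * (m + e))" using p m e by (simp add: ennreal_mult)
  finally have up: "emeasure \<nu> W \<le> ennreal (p * (m + e))" .
  obtain C' where C': "countable C'" "disjoint_family_on (\<lambda>(u,v). {u<..<v}) C'"
    "\<And>u v. (u,v) \<in> C' \<Longrightarrow> u < v \<and> g v - g u > q * (v - u) \<and> {u<..<v} \<subseteq> W"
    "negligible (S \<inter> W - (\<Union>(u,v)\<in>C'. {u<..<v}))"
    using vitali_intervals[OF W, of "S \<inter> W" "\<lambda>u v. g v - g u > q * (v - u)"] hi by (metis Int_iff inf_le2)
  define W' where "W' = (\<Union>(u,v)\<in>C'. {u<..<v})"
  have W': "open W'" unfolding W'_def by (auto intro!: open_UN)
  have nS: "negligible (S - W')"
    by (rule negligible_subset[OF negligible_Un[OF C(4) C'(4)]]) (auto simp: W_def W'_def)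
  have "ennreal m \<le> emeasure lebesgue (W' \<union> (S - W'))"
    unfolding em[symmetric] using W' S by (intro emeasure_mono) (auto simp: borel_open)
  also have "\<dots> = emeasure lebesgue W'"
    using nS W' by (intro emeasure_Un_null_set) (auto simp: negligible_iff_null_sets)
  finally have mW': "ennreal m \<le> emeasure lborel W'" using W' by simp
  have "ennreal (q * m) = ennreal q * ennreal m" using p pq m by (simp add: ennreal_mult)
  also have "\<dots> \<le> ennreal q * emeasure lborel W'" using mW' by (rule mult_left_mono) simp
  also have "\<dots> = (\<integral>\<^sup>+z. ennreal q * (case z of (u,v) \<Rightarrow> emeasure lborel {u<..<v}) \<partial>count_space C')"
    unfolding W'_def Unl[OF C'(1,2)] by (simp add: nn_integral_cmult)
  also have "\<dots> \<le> (\<integral>\<^sup>+(u,v). emeasure \<nu> {u<..<v} \<partial>count_space C')"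
  proof (rule nn_integral_mono, clarsimp)
    fix u v assume "(u,v) \<in> C'"
    with C'(3) have h: "u < v" "g v - g u > q * (v - u)" by auto
    then show "ennreal q * emeasure lborel {u<..<v} \<le> emeasure \<nu> {u<..<v}"
      using p pq by (simp add: \<nu> ennreal_mult[symmetric] ennreal_leI)
  qed
  also have "\<dots> = emeasure \<nu> W'" unfolding W'_def by (rule Un\<nu>[OF C'(1,2), symmetric])
  also have "\<dots> \<le> emeasure \<nu> W" 
    using C'(3) W by (intro emeasure_mono) (auto simp: W'_def \<nu>_def)
  also note up
  finally have "q * m \<le> p * (m + e)" using p m e by (simp add: ennreal_le_iff)
  moreover have "p * e = (q - p) * m / 2" using p by (simp add: e_def)
  ultimately have "(q - p) * m \<le> 0" by (simp add: algebra_simps)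
  then show False using pq m by (smt (verit) mult_pos_pos)
qed

lemma lipschitz_differentiable_real:
  fixes f :: "real \<Rightarrow> real"
  assumes lip: "L-lipschitz_on UNIV f"
  shows "negligible {x. \<not> f differentiable (at x)}"
proof -
  have L: "L \<ge> 0" "\<And>x y. \<bar>f x - f y\<bar> \<le> L * \<bar>x - y\<bar>"
    using lip by (auto simp: lipschitz_on_def dist_real_def)
  define g where "g x = f x + L * x" for x
  have gb: "0 \<le> g v - g u \<and> g v - g u \<le> 2 * L * (v - u)" if "u \<le> v" for u v
    using L(2)[of v u] that unfolding g_def by (simp add: algebra_simps) linarith
  have mono: "mono g" using gb by (auto intro!: monoI)
  have cont: "continuous_on UNIV g"
    unfolding g_def by (intro continuous_intros lipschitz_on_continuous_on[OF lip])
  define E where "E P = (\<Inter>n::nat. \<Union>{{u<..<v} | u v. v - u < 1 / Suc n \<and> P u v})"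
    for P :: "real \<Rightarrow> real \<Rightarrow> bool"
  have Emeas: "E P \<in> sets borel" for P
    unfolding E_def by (intro sets.countable_INT'' borel_open open_Union) auto
  have E: "x \<in> E P \<longleftrightarrow> (\<forall>d>0. \<exists>u v. u < x \<and> x < v \<and> v - u < d \<and> P u v)" for P x
  proof
    assume x: "x \<in> E P"
    show "\<forall>d>0. \<exists>u v. u < x \<and> x < v \<and> v - u < d \<and> P u v"
    proof (intro allI impI)
      fix d :: real assume "d > 0"
      then obtain n where n: "inverse (real (Suc n)) < d" using reals_Archimedean by blast
      from x have "x \<in> \<Union>{{u<..<v} | u v. v - u < 1 / Suc n \<and> P u v}"
        unfolding E_def by blast
      then obtain u v where "u < x" "x < v" "v - u < 1 / Suc n" "P u v" by auto
      with n show "\<exists>u v. u < x \<and> x < v \<and> v - u < d \<and> P u v"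
        by (intro exI[of _ u] exI[of _ v]) (auto simp: inverse_eq_divide)
    qed
  next
    assume h: "\<forall>d>0. \<exists>u v. u < x \<and> x < v \<and> v - u < d \<and> P u v"
    show "x \<in> E P" unfolding E_def
    proof
      fix n :: nat
      obtain u v where "u < x" "x < v" "v - u < 1 / Suc n" "P u v"
        using h[rule_format, of "1 / Suc n"] by auto
      then show "x \<in> \<Union>{{u<..<v} | u v. v - u < 1 / Suc n \<and> P u v}"
        by (intro UnionI[of "{u<..<v}"]) auto
    qed
  qed
  define B where "B p = E (\<lambda>u v. g v - g u < p * (v - u))" for p
  define A where "A q = E (\<lambda>u v. g v - g u > q * (v - u))" for q
  define N where "N = (\<Union>(p, q, k)\<in>{(p, q, k). p \<in> \<rat> \<and> q \<in> \<rat> \<and> p < q \<and> k \<in> \<nat>}. A q \<inter> B p \<inter> ball 0 k)"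
  have "countable ((\<rat> :: real set) \<times> (\<rat> :: real set) \<times> (\<nat> :: real set))"
    by (intro countable_SIGMA countable_rat) (simp add: Nats_def)
  then have ct: "countable {(p::real, q::real, k::real). p \<in> \<rat> \<and> q \<in> \<rat> \<and> p < q \<and> k \<in> \<nat>}"
    by (rule countable_subset[rotated]) auto
  have "negligible N"
    unfolding N_def
  proof (rule negligible_countable_Union)
    fix S assume "S \<in> (\<lambda>(p, q, k). A q \<inter> B p \<inter> ball 0 k) ` {(p, q, k). p \<in> \<rat> \<and> q \<in> \<rat> \<and> p < q \<and> k \<in> \<nat>}"
    then obtain p q k where pq: "p < q" and S: "S = A q \<inter> B p \<inter> ball 0 k" by auto
    show "negligible S"
    proof (rule slope_gap_null[OF mono cont pq])
      have "S \<in> sets borel" unfolding S A_def B_def by (intro sets.Int Emeas) auto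
      then show "S \<in> sets lebesgue" by simp
      show "bounded S" unfolding S by (intro bounded_Int) auto
    qed (auto simp: S A_def B_def E)
  qed (use ct in auto)
  moreover have "f differentiable (at x)" if xN: "x \<notin> N" for x
  proof -
    obtain n :: nat where n: "\<bar>x\<bar> < real n" using reals_Archimedean2 by blast
    have AB: "x \<notin> B p" if "p \<in> \<rat>" "q \<in> \<rat>" "p < q" "x \<in> A q" for p q
      using xN that n unfolding N_def by (auto simp: dist_real_def)
    define Q where "Q = {q \<in> \<rat>. x \<in> A q}"
    have "\<exists>u v. u < x \<and> x < v \<and> v - u < d \<and> - 1 * (v - u) < g v - g u" if "d > 0" for d
      using gb[of "x - d/3" "x + d/3"] that by (intro exI[of _ "x - d/3"] exI[of _ "x + d/3"]) auto
    then have "-1 \<in> Q" by (auto simp: Q_def A_def E)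
    then have Qne: "Q \<noteq> {}" by auto
    have "q \<le> 2 * L" if qQ: "q \<in> Q" for q
    proof -
      obtain u v where "u < x" "x < v" "q * (v - u) < g v - g u"
        using qQ zero_less_one[where 'a=real] unfolding Q_def A_def E by blast
      then have "q * (v - u) \<le> (2 * L) * (v - u)" "v - u > 0" using gb[of u v] by linarith+
      then show ?thesis by (rule mult_right_le_imp_le)
    qed
    then have Qb: "bdd_above Q" by (auto simp: bdd_above_def)
    define s where "s = Sup Q"
    have str: "\<exists>d>0. \<forall>u v. u < x \<and> x < v \<and> v - u < d \<longrightarrow> \<bar>g v - g u - s * (v - u)\<bar> \<le> e * (v - u)" if epos: "e > 0" for e
    proof -
      obtain q where q: "q \<in> \<rat>" "s < q" "q < s + e" using Rats_dense_in_real[of s "s + e"] epos by auto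
      then have "q \<notin> Q" using cSup_upper[OF _ Qb] by (force simp: s_def)
      then have "x \<notin> A q" using q by (simp add: Q_def)
      then obtain d1 where d1: "d1 > 0" "\<And>u v. u < x \<Longrightarrow> x < v \<Longrightarrow> v - u < d1 \<Longrightarrow> g v - g u \<le> q * (v - u)"
        unfolding A_def E by force
      obtain q' where q': "q' \<in> Q" "s - e < q'" using less_cSupD[OF Qne, of "s - e"] epos by (auto simp: s_def)
      obtain p where p: "p \<in> \<rat>" "s - e < p" "p < q'" using Rats_dense_in_real[OF q'(2)] by auto
      have "x \<notin> B p" using AB[OF p(1) _ p(3)] q' by (auto simp: Q_def)
      then obtain d2 where d2: "d2 > 0" "\<And>u v. u < x \<Longrightarrow> x < v \<Longrightarrow> v - u < d2 \<Longrightarrow> g v - g u \<ge> p * (v - u)"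
        unfolding B_def E by force
      show ?thesis
      proof (intro exI[of _ "min d1 d2"] conjI allI impI)
        fix u v assume uv: "u < x \<and> x < v \<and> v - u < min d1 d2"
        have "q * (v - u) \<le> (s + e) * (v - u)" "(s - e) * (v - u) \<le> p * (v - u)"
          using q p uv by (auto intro!: mult_right_mono)
        with d1(2)[of u v] d2(2)[of u v] uv
        show "\<bar>g v - g u - s * (v - u)\<bar> \<le> e * (v - u)" by (auto simp: abs_le_iff algebra_simps)
      qed (use d1 d2 in auto)
    qed
    have "(g has_derivative (\<lambda>h. s * h)) (at x)"
      unfolding has_derivative_at_alt
    proof (intro conjI allI impI)
      show "bounded_linear (\<lambda>h. s * h)" by (rule bounded_linear_mult_right)
      fix e :: real assume "e > 0"
      then obtain d where d: "d > 0" "\<And>u v. u < x \<Longrightarrow> x < v \<Longrightarrow> v - u < d \<Longrightarrow> \<bar>g v - g u - s * (v - u)\<bar> \<le> e * (v - u)"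
        using str by blast
      have cg: "(g \<longlongrightarrow> g x) (at x within T)" for T
        using cont by (auto simp: continuous_on_eq_continuous_within continuous_within intro: tendsto_within_subset)
      show "\<exists>d>0. \<forall>y. norm (y - x) < d \<longrightarrow> norm (g y - g x - s * (y - x)) \<le> e * norm (y - x)"
      proof (intro exI[of _ d] conjI allI impI)
        fix y assume y: "norm (y - x) < d"
        consider "y = x" | "x < y" | "y < x" by linarith
        then show "norm (g y - g x - s * (y - x)) \<le> e * norm (y - x)"
        proof cases
          case 2
          have "((\<lambda>u. e * (y - u) - \<bar>g y - g u - s * (y - u)\<bar>) \<longlongrightarrow> e * (y - x) - \<bar>g y - g x - s * (y - x)\<bar>) (at_left x)"
            by (intro tendsto_intros cg)
          moreover have "\<forall>\<^sub>F u in at_left x. 0 \<le> e * (y - u) - \<bar>g y - g u - s * (y - u)\<bar>"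
            using d(2)[OF _ 2] y 2 unfolding eventually_at_left_field
            by (intro exI[of _ "y - d"]) auto
          ultimately have "0 \<le> e * (y - x) - \<bar>g y - g x - s * (y - x)\<bar>"
            by (rule tendsto_lowerbound) simp
          then show ?thesis using 2 by simp
        next
          case 3
          have "((\<lambda>v. e * (v - y) - \<bar>g v - g y - s * (v - y)\<bar>) \<longlongrightarrow> e * (x - y) - \<bar>g x - g y - s * (x - y)\<bar>) (at_right x)"
            by (intro tendsto_intros cg)
          moreover have "\<forall>\<^sub>F v in at_right x. 0 \<le> e * (v - y) - \<bar>g v - g y - s * (v - y)\<bar>"
            using d(2)[OF 3] y 3 unfolding eventually_at_right_field
            by (intro exI[of _ "y + d"]) auto
          ultimately have "0 \<le> e * (x - y) - \<bar>g x - g y - s * (x - y)\<bar>"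
            by (rule tendsto_lowerbound) simp
          then show ?thesis using 3 by (simp add: algebra_simps abs_le_iff)
        qed auto
      qed (use d in auto)
    qed
    then have "g differentiable (at x)" by (auto simp: differentiable_def)
    then have "(\<lambda>y. g y - L * y) differentiable (at x)" by (intro derivative_intros) auto
    then show ?thesis by (simp add: g_def)
  qed
  then have "{x. \<not> f differentiable (at x)} \<subseteq> N" by blast
  ultimately show ?thesis by (rule negligible_subset)
qed

lemma lipschitz_differentiable:
  fixes f :: "real \<Rightarrow> 'b::euclidean_space"
  assumes lip: "L-lipschitz_on UNIV f"
  shows "negligible {x. \<not> f differentiable (at x)}"
proof -
  have "L-lipschitz_on UNIV (\<lambda>x. f x \<bullet> i)" if "i \<in> Basis" for i
  proof (rule lipschitz_onI)
    fix x y
    have "\<bar>(f x - f y) \<bullet> i\<bar> \<le> norm (f x - f y)" using that by (rule Basis_le_norm)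
    also have "\<dots> \<le> L * dist x y" using lipschitz_onD[OF lip] by (simp add: dist_norm)
    finally show "dist (f x \<bullet> i) (f y \<bullet> i) \<le> L * dist x y"
      by (simp add: dist_real_def inner_diff_left)
  qed (rule lipschitz_on_nonneg[OF lip])
  then have "negligible (\<Union>i\<in>Basis. {x. \<not> (\<lambda>x. f x \<bullet> i) differentiable (at x)})"
    by (intro negligible_Union) (auto intro: lipschitz_differentiable_real)
  then show ?thesis
    by (rule negligible_subset) (auto simp: differentiable_componentwise_within[of f])
qed

lemma vector_derivative_quotient_lim:
  fixes f :: "real \<Rightarrow> 'b::real_normed_vector"
  assumes "f differentiable (at x)"
  shows "(\<lambda>n. real (Suc n) *\<^sub>R (f (x + 1 / real (Suc n)) - f x)) \<longlonglongrightarrow> vector_derivative f (at x)"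
proof -
  have "(f has_vector_derivative vector_derivative f (at x)) (at x)"
    using assms by (simp add: vector_derivative_works)
  then have "((\<lambda>h. norm (f (x + h) - f x - h *\<^sub>R vector_derivative f (at x)) / norm h) \<longlongrightarrow> 0) (at 0)"
    by (simp add: has_vector_derivative_def has_derivative_at)
  moreover have "norm (f (x + h) - f x - h *\<^sub>R v) / norm h = norm ((f (x + h) - f x) /\<^sub>R h - v)" if "h \<noteq> 0" for h v
  proof -
    have "(f (x + h) - f x) /\<^sub>R h - v = (f (x + h) - f x - h *\<^sub>R v) /\<^sub>R h"
      using that by (simp add: scaleR_diff_right)
    then show ?thesis by (simp add: divide_inverse_commute)
  qed
  ultimately have "((\<lambda>h. norm ((f (x + h) - f x) /\<^sub>R h - vector_derivative f (at x))) \<longlongrightarrow> 0) (at 0)"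
    by (rule Lim_transform_eventually[OF _ eventually_mono[OF eventually_neq_at_within]])
  then have "((\<lambda>h. (f (x + h) - f x) /\<^sub>R h - vector_derivative f (at x)) \<longlongrightarrow> 0) (at 0)"
    by (rule tendsto_norm_zero_cancel)
  then have "((\<lambda>h. (f (x + h) - f x) /\<^sub>R h) \<longlongrightarrow> vector_derivative f (at x)) (at 0)"
    by (rule LIM_zero_cancel)
  moreover have "filterlim (\<lambda>n. 1 / real (Suc n)) (at 0) sequentially"
    using LIMSEQ_inverse_real_of_nat by (auto simp: filterlim_at inverse_eq_divide)
  ultimately have "(\<lambda>n. (f (x + 1 / real (Suc n)) - f x) /\<^sub>R (1 / real (Suc n))) \<longlonglongrightarrow> vector_derivative f (at x)"
    by (rule filterlim_compose)
  then show ?thesis by simp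
qed

lemma lipschitz_vector_derivative_measurable:
  fixes f :: "real \<Rightarrow> 'b::euclidean_space"
  assumes lip: "L-lipschitz_on UNIV f"
  shows "(\<lambda>x. vector_derivative f (at x)) \<in> borel_measurable lebesgue"
proof -
  define N where "N = {x. \<not> f differentiable (at x)}"
  have N: "N \<in> sets lebesgue"
    using lipschitz_differentiable[OF lip] unfolding N_def by (rule negligible_imp_sets)
  define D where "D n x = (if x \<in> N then 0 else real (Suc n) *\<^sub>R (f (x + 1 / Suc n) - f x))" for n x
  have f: "f \<in> borel_measurable borel"
    by (rule borel_measurable_continuous_onI[OF lipschitz_on_continuous_on[OF lip]])
  have "(\<lambda>x. real (Suc n) *\<^sub>R (f (x + 1 / Suc n) - f x)) \<in> borel_measurable borel" for n
    using f by measurable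
  then have "D n \<in> borel_measurable lebesgue" for n
    unfolding D_def using N by (intro measurable_If_set) (auto intro: measurable_completion)
  moreover have "(\<lambda>n. D n x) \<longlonglongrightarrow> (if x \<in> N then 0 else vector_derivative f (at x))" for x
  proof (cases "x \<in> N")
    case False
    then show ?thesis
      using vector_derivative_quotient_lim[of f x] by (simp add: D_def N_def)
  qed (simp add: D_def)
  ultimately have m: "(\<lambda>x. if x \<in> N then 0 else vector_derivative f (at x)) \<in> borel_measurable lebesgue"
    by (rule borel_measurable_LIMSEQ_metric)
  have "(\<lambda>x. if x \<in> N then (SOME d. False) else (if x \<in> N then 0 else vector_derivative f (at x))) \<in> borel_measurable lebesgue"
    by (rule measurable_If_set[OF _ m]) (use N in auto)
  also have "(\<lambda>x. if x \<in> N then (SOME d. False) else (if x \<in> N then 0 else vector_derivative f (at x)))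
      = (\<lambda>x. vector_derivative f (at x))"
    by (auto simp: N_def vector_derivative_def differentiable_def has_vector_derivative_def fun_eq_iff)
  finally show ?thesis .
qed

subsection \<open>The essential supremum norm on the circle\<close>

text \<open>A function on the circle is a $2\pi$-periodic function on the real line; up to null sets,
  the circle with the measure $d\theta$ is the interval $[0,2\pi]$ with Lebesgue measure.\<close>

abbreviation circle :: "real measure" where
  "circle \<equiv> lebesgue_on {0..2 * pi}"

definition Linf_norm :: "(real \<Rightarrow> 'b::real_normed_vector) \<Rightarrow> real" where
  "Linf_norm f = real_of_ereal (esssup circle (\<lambda>\<theta>. ereal (norm (f \<theta>))))"

definition essinf :: "'a measure \<Rightarrow> ('a \<Rightarrow> ereal) \<Rightarrow> ereal" where
  "essinf M f = - esssup M (\<lambda>x. - f x)"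

lemma emeasure_circle: "emeasure circle (space circle) \<noteq> 0"
  by (simp add: emeasure_restrict_space)

context
  fixes f :: "real \<Rightarrow> 'b::euclidean_space" and B :: real
  assumes f: "f \<in> borel_measurable circle" and B: "AE \<theta> in circle. norm (f \<theta>) \<le> B"
begin

lemma esssup_eq_Linf_norm: "esssup circle (\<lambda>\<theta>. ereal (norm (f \<theta>))) = ereal (Linf_norm f)"
  and Linf_norm_nonneg: "0 \<le> Linf_norm f"
  and Linf_norm_least: "Linf_norm f \<le> B"
proof -
  let ?s = "esssup circle (\<lambda>\<theta>. ereal (norm (f \<theta>)))"
  have m: "(\<lambda>\<theta>. ereal (norm (f \<theta>))) \<in> borel_measurable circle" using f by measurable
  have u: "?s \<le> ereal B" using B by (intro esssup_I m) auto
  have "esssup circle (\<lambda>\<theta>. 0::ereal) \<le> ?s" by (rule esssup_mono) auto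
  then have l: "0 \<le> ?s" by (simp add: esssup_const[OF emeasure_circle])
  show eq: "?s = ereal (Linf_norm f)" unfolding Linf_norm_def using u l by (cases ?s) auto
  show "0 \<le> Linf_norm f" "Linf_norm f \<le> B" using u l unfolding eq by auto
qed

lemma Linf_norm_AE: "AE \<theta> in circle. norm (f \<theta>) \<le> Linf_norm f"
  using esssup_AE[of "\<lambda>\<theta>. ereal (norm (f \<theta>))" circle] unfolding esssup_eq_Linf_norm by simp

end

lemma Linf_norm_add:
  fixes f g :: "real \<Rightarrow> 'b::euclidean_space"
  assumes "f \<in> borel_measurable circle" "AE \<theta> in circle. norm (f \<theta>) \<le> A"
    and "g \<in> borel_measurable circle" "AE \<theta> in circle. norm (g \<theta>) \<le> B"
    and "h \<in> borel_measurable circle" "AE \<theta> in circle. h \<theta> = f \<theta> + g \<theta>"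
  shows "Linf_norm h \<le> Linf_norm f + Linf_norm g"
proof (rule Linf_norm_least)
  show "AE \<theta> in circle. norm (h \<theta>) \<le> Linf_norm f + Linf_norm g"
    using Linf_norm_AE[OF assms(1,2)] Linf_norm_AE[OF assms(3,4)] assms(6)
  proof eventually_elim
    case (elim \<theta>)
    then show ?case using norm_triangle_ineq[of "f \<theta>" "g \<theta>"] by simp
  qed
qed fact

lemma Linf_norm_scaleR:
  fixes f h :: "real \<Rightarrow> 'b::euclidean_space"
  assumes "h \<in> borel_measurable circle" "f \<in> borel_measurable circle"
    and eq: "AE \<theta> in circle. h \<theta> = r *\<^sub>R f \<theta>"
  shows "Linf_norm h = \<bar>r\<bar> * Linf_norm f"
proof -
  have m: "(\<lambda>\<theta>. ereal (norm (h \<theta>))) \<in> borel_measurable circle"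
    "(\<lambda>\<theta>. ereal (\<bar>r\<bar> * norm (f \<theta>))) \<in> borel_measurable circle" using assms by measurable
  have "esssup circle (\<lambda>\<theta>. ereal (norm (h \<theta>))) = esssup circle (\<lambda>\<theta>. ereal (\<bar>r\<bar> * norm (f \<theta>)))"
    using eq by (intro esssup_AE_cong m) auto
  also have "\<dots> = ereal \<bar>r\<bar> * esssup circle (\<lambda>\<theta>. ereal (norm (f \<theta>)))"
  proof (cases "r = 0")
    case True
    then show ?thesis by (simp add: esssup_const[OF emeasure_circle] zero_ereal_def[symmetric])
  next
    case False
    then show ?thesis using esssup_cmult[of "\<bar>r\<bar>" circle "\<lambda>\<theta>. ereal (norm (f \<theta>))"] by simp
  qed
  finally show ?thesis unfolding Linf_norm_def by simp
qed

subsection \<open>The normed space of mean-zero Lipschitz functions\<close>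

typedef ('n::finite) W1inf0 =
  "{c :: real \<Rightarrow> real ^ 'n. (\<forall>\<theta>. c (\<theta> + 2 * pi) = c \<theta>) \<and> (\<exists>L. L-lipschitz_on UNIV c) \<and>
     integral {0..2 * pi} c = 0}"
  morphisms curve W1inf0_of
  by (rule exI[of _ "\<lambda>_. 0"]) (auto intro: lipschitz_intros)

definition tderiv :: "'n::finite W1inf0 \<Rightarrow> real \<Rightarrow> real ^ 'n" where
  "tderiv c \<theta> = vector_derivative (curve c) (at \<theta>)"

lemma curve_periodic: "curve c (\<theta> + 2 * pi) = curve c \<theta>"
  and curve_lipschitz: "\<exists>L. L-lipschitz_on UNIV (curve c)"
  and curve_mean: "integral {0..2 * pi} (curve c) = 0"
  using curve[of c] by auto

lemma curve_continuous: "continuous_on S (curve c)"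
  using curve_lipschitz[of c] lipschitz_on_continuous_on continuous_on_subset by blast

lemma curve_measurable: "curve c \<in> borel_measurable circle"
proof -
  have "curve c \<in> borel_measurable borel"
    by (rule borel_measurable_continuous_onI) (rule curve_continuous)
  then show ?thesis by (intro measurable_restrict_space1 measurable_completion) simp
qed

lemma curve_bounded: "\<exists>B. AE \<theta> in circle. norm (curve c \<theta>) \<le> B"
proof -
  have "compact (curve c ` {0..2 * pi})"
    by (intro compact_continuous_image curve_continuous) simp
  then obtain B where "\<forall>x\<in>curve c ` {0..2 * pi}. norm x \<le> B"
    using compact_imp_bounded bounded_iff by metis
  then show ?thesis by (intro exI[of _ B] AE_I2) (simp add: space_restrict_space)
qed

lemma tderiv_measurable: "tderiv c \<in> borel_measurable circle"
  using curve_lipschitz[of c] lipschitz_vector_derivative_measurable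
  unfolding tderiv_def by (auto intro: measurable_restrict_space1)

lemma curve_differentiable: "AE \<theta> in circle. curve c differentiable (at \<theta>)"
proof -
  obtain L where "L-lipschitz_on UNIV (curve c)" using curve_lipschitz by blast
  then have "{\<theta>. \<not> curve c differentiable (at \<theta>)} \<in> null_sets lebesgue"
    using lipschitz_differentiable negligible_iff_null_sets by blast
  then have "AE \<theta> in lebesgue. curve c differentiable (at \<theta>)"
    by (rule AE_I') auto
  then show ?thesis by (auto simp: AE_restrict_space_iff elim: eventually_mono)
qed

lemma tderiv_bounded: "\<exists>B. AE \<theta> in circle. norm (tderiv c \<theta>) \<le> B"
proof -
  obtain L where L: "L-lipschitz_on UNIV (curve c)" using curve_lipschitz by blast
  show ?thesis
  proof (intro exI[of _ L] eventually_mono[OF curve_differentiable])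
    fix \<theta> assume d: "curve c differentiable (at \<theta>)"
    have "norm (real (Suc n) *\<^sub>R (curve c (\<theta> + 1 / real (Suc n)) - curve c \<theta>)) \<le> L" for n
    proof -
      have "norm (curve c (\<theta> + 1 / real (Suc n)) - curve c \<theta>) \<le> L * (1 / real (Suc n))"
        using lipschitz_onD[OF L, of "\<theta> + 1 / real (Suc n)" \<theta>] by (simp add: dist_norm)
      then have "real (Suc n) * norm (curve c (\<theta> + 1 / real (Suc n)) - curve c \<theta>) \<le> L"
        by (simp add: field_simps del: of_nat_Suc)
      then show ?thesis by (simp only: norm_scaleR abs_of_nat)
    qed
    then show "norm (tderiv c \<theta>) \<le> L"
      unfolding tderiv_def
      by (intro Lim_bounded[OF tendsto_norm[OF vector_derivative_quotient_lim[OF d]]]) auto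
  qed
qed

instantiation W1inf0 :: (finite) real_normed_vector
begin

definition zero_W1inf0 :: "'a W1inf0" where "0 = W1inf0_of (\<lambda>_. 0)"
definition plus_W1inf0 :: "'a W1inf0 \<Rightarrow> 'a W1inf0 \<Rightarrow> 'a W1inf0" where
  "c + h = W1inf0_of (\<lambda>\<theta>. curve c \<theta> + curve h \<theta>)"
definition minus_W1inf0 :: "'a W1inf0 \<Rightarrow> 'a W1inf0 \<Rightarrow> 'a W1inf0" where
  "c - h = W1inf0_of (\<lambda>\<theta>. curve c \<theta> - curve h \<theta>)"
definition uminus_W1inf0 :: "'a W1inf0 \<Rightarrow> 'a W1inf0" where
  "- c = W1inf0_of (\<lambda>\<theta>. - curve c \<theta>)"
definition scaleR_W1inf0 :: "real \<Rightarrow> 'a W1inf0 \<Rightarrow> 'a W1inf0" where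
  "r *\<^sub>R c = W1inf0_of (\<lambda>\<theta>. r *\<^sub>R curve c \<theta>)"
definition norm_W1inf0 :: "'a W1inf0 \<Rightarrow> real" where
  "norm_W1inf0 c = Linf_norm (curve c) + Linf_norm (tderiv c)"
definition dist_W1inf0 :: "'a W1inf0 \<Rightarrow> 'a W1inf0 \<Rightarrow> real" where
  "dist_W1inf0 c h = norm (c - h)"
definition sgn_W1inf0 :: "'a W1inf0 \<Rightarrow> 'a W1inf0" where
  "sgn_W1inf0 c = scaleR (inverse (norm c)) c"
definition uniformity_W1inf0 :: "('a W1inf0 \<times> 'a W1inf0) filter" where
  "uniformity_W1inf0 = (INF e\<in>{0 <..}. principal {(x, y). dist x y < e})"
definition open_W1inf0 :: "'a W1inf0 set \<Rightarrow> bool" where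
  "open_W1inf0 U \<longleftrightarrow> (\<forall>x\<in>U. \<forall>\<^sub>F (x', y) in uniformity. x' = x \<longrightarrow> y \<in> U)"

lemma curve_zero: "curve (0::'a W1inf0) = (\<lambda>_. 0)"
  unfolding zero_W1inf0_def by (rule W1inf0_of_inverse) (auto intro: lipschitz_intros)

lemma curve_scaleR: "curve (r *\<^sub>R c :: 'a W1inf0) = (\<lambda>\<theta>. r *\<^sub>R curve c \<theta>)"
proof -
  obtain L where "L-lipschitz_on UNIV (curve c)" using curve_lipschitz by blast
  from lipschitz_on_cmult[OF this, of r] show ?thesis
    unfolding scaleR_W1inf0_def
    by (intro W1inf0_of_inverse) (auto simp: curve_periodic curve_mean)
qed

lemma curve_add: "curve (c + h :: 'a W1inf0) = (\<lambda>\<theta>. curve c \<theta> + curve h \<theta>)"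
proof -
  obtain L M where "L-lipschitz_on UNIV (curve c)" "M-lipschitz_on UNIV (curve h)"
    using curve_lipschitz by blast
  from lipschitz_on_add[OF this] show ?thesis
    unfolding plus_W1inf0_def
    by (intro W1inf0_of_inverse)
      (auto simp: curve_periodic curve_mean integral_add integrable_continuous_real curve_continuous)
qed

lemma curve_uminus: "curve (- c :: 'a W1inf0) = (\<lambda>\<theta>. - curve c \<theta>)"
  using curve_scaleR[of "-1" c] by (simp add: uminus_W1inf0_def scaleR_W1inf0_def)

lemma curve_diff: "curve (c - h :: 'a W1inf0) = (\<lambda>\<theta>. curve c \<theta> - curve h \<theta>)"
  using curve_add[of c "- h"] by (simp add: minus_W1inf0_def plus_W1inf0_def curve_uminus)

lemmas curve_simps = curve_zero curve_add curve_scaleR curve_uminus curve_diff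

lemma tderiv_add: "AE \<theta> in circle. tderiv (c + h :: 'a W1inf0) \<theta> = tderiv c \<theta> + tderiv h \<theta>"
  using curve_differentiable[of c] curve_differentiable[of h]
  by eventually_elim (simp add: tderiv_def curve_add vector_derivative_add_at)

lemma tderiv_scaleR: "AE \<theta> in circle. tderiv (r *\<^sub>R c :: 'a W1inf0) \<theta> = r *\<^sub>R tderiv c \<theta>"
  using curve_differentiable[of c]
proof eventually_elim
  case (elim \<theta>)
  then have "(curve c has_vector_derivative tderiv c \<theta>) (at \<theta>)"
    by (simp add: tderiv_def vector_derivative_works)
  then have "((\<lambda>\<theta>. r *\<^sub>R curve c \<theta>) has_vector_derivative r *\<^sub>R tderiv c \<theta>) (at \<theta>)"
    by (auto intro!: derivative_eq_intros)
  then show ?case by (simp add: tderiv_def curve_scaleR vector_derivative_at)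
qed

lemma norm_parts_nonneg:
  "0 \<le> Linf_norm (curve c)" "0 \<le> Linf_norm (tderiv (c::'a W1inf0))"
  using Linf_norm_nonneg[OF curve_measurable] Linf_norm_nonneg[OF tderiv_measurable]
    curve_bounded tderiv_bounded by blast+

lemma curve_eq_0:
  assumes "Linf_norm (curve c) = 0"
  shows "curve (c::'a W1inf0) \<theta> = 0"
proof -
  let ?Z = "{\<theta>. curve c \<theta> = 0}"
  have "AE \<theta> in circle. norm (curve c \<theta>) \<le> 0"
    using Linf_norm_AE[OF curve_measurable] curve_bounded[of c] assms by metis
  then have "AE \<theta> in lebesgue. \<theta> \<in> {0..2 * pi} \<longrightarrow> curve c \<theta> = 0"
    by (simp add: AE_restrict_space_iff)
  then have "AE \<theta> in lebesgue. \<theta> \<notin> {0<..<2 * pi} - ?Z"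
    by (auto elim: eventually_mono)
  moreover have op: "open ({0<..<2 * pi} - ?Z)"
    by (intro open_Diff open_greaterThanLessThan closed_Collect_eq curve_continuous continuous_on_const)
  ultimately have "{0<..<2 * pi} - ?Z \<in> null_sets lebesgue"
    by (subst AE_iff_null_sets) auto
  with op have "{0<..<2 * pi} - ?Z = {}"
    using open_not_negligible negligible_iff_null_sets by blast
  then have "{0<..<2 * pi} \<subseteq> ?Z" by blast
  then have "closure {0<..<2 * pi} \<subseteq> ?Z"
    by (rule closure_minimal) (intro closed_Collect_eq curve_continuous continuous_on_const)
  then have Z: "\<theta> \<in> ?Z" if "\<theta> \<in> {0..2 * pi}" for \<theta> using that by auto
  have per: "curve c (\<theta> + of_int k * (2 * pi)) = curve c \<theta>" for k :: int and \<theta>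
  proof (induction k arbitrary: \<theta> rule: int_induct[where k = 0])
    case (step1 i)
    then show ?case using curve_periodic[of c "\<theta> + of_int i * (2 * pi)"] by (simp add: algebra_simps)
  next
    case (step2 i)
    then show ?case using curve_periodic[of c "\<theta> + of_int (i - 1) * (2 * pi)"] by (simp add: algebra_simps)
  qed simp
  define k where "k = \<lfloor>\<theta> / (2 * pi)\<rfloor>"
  have "of_int k \<le> \<theta> / (2 * pi)" "\<theta> / (2 * pi) \<le> of_int k + 1" unfolding k_def by linarith+
  then have "\<theta> + of_int (- k) * (2 * pi) \<in> {0..2 * pi}" by (simp add: field_simps)
  from Z[OF this] show ?thesis using per[of \<theta> "- k"] by simp
qed

instance
proof
  fix a b c :: "'a W1inf0" and r s :: real
  show "a + b + c = a + (b + c)" "a + b = b + a" "0 + a = a" "- a + a = 0" "a - b = a + - b"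
    "r *\<^sub>R (a + b) = r *\<^sub>R a + r *\<^sub>R b" "(r + s) *\<^sub>R a = r *\<^sub>R a + s *\<^sub>R a"
    "r *\<^sub>R s *\<^sub>R a = (r * s) *\<^sub>R a" "1 *\<^sub>R a = a"
    by (auto simp: curve_inject[symmetric] curve_simps algebra_simps)
  show "dist a b = norm (a - b)" by (rule dist_W1inf0_def)
  show "sgn a = scaleR (inverse (norm a)) a" by (rule sgn_W1inf0_def)
  show "(uniformity :: ('a W1inf0 \<times> 'a W1inf0) filter) = (INF e\<in>{0 <..}. principal {(x, y). dist x y < e})"
    by (rule uniformity_W1inf0_def)
  show "open U \<longleftrightarrow> (\<forall>x\<in>U. \<forall>\<^sub>F (x', y) in uniformity. x' = x \<longrightarrow> y \<in> U)" for U :: "'a W1inf0 set"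
    by (rule open_W1inf0_def)
  have nsc: "norm (r *\<^sub>R a) = \<bar>r\<bar> * norm a" for r
  proof -
    have "Linf_norm (curve (r *\<^sub>R a)) = \<bar>r\<bar> * Linf_norm (curve a)"
      by (rule Linf_norm_scaleR[OF curve_measurable curve_measurable]) (simp add: curve_scaleR)
    moreover have "Linf_norm (tderiv (r *\<^sub>R a)) = \<bar>r\<bar> * Linf_norm (tderiv a)"
      by (rule Linf_norm_scaleR[OF tderiv_measurable tderiv_measurable tderiv_scaleR])
    ultimately show ?thesis by (simp add: norm_W1inf0_def algebra_simps)
  qed
  show "norm (r *\<^sub>R a) = \<bar>r\<bar> * norm a" by (rule nsc)
  obtain A B where A: "AE \<theta> in circle. norm (curve a \<theta>) \<le> A" and B: "AE \<theta> in circle. norm (curve b \<theta>) \<le> B"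
    using curve_bounded by metis
  obtain A' B' where A': "AE \<theta> in circle. norm (tderiv a \<theta>) \<le> A'" and B': "AE \<theta> in circle. norm (tderiv b \<theta>) \<le> B'"
    using tderiv_bounded by metis
  have "Linf_norm (curve (a + b)) \<le> Linf_norm (curve a) + Linf_norm (curve b)"
    by (rule Linf_norm_add[OF curve_measurable A curve_measurable B curve_measurable])
      (simp add: curve_add)
  moreover have "Linf_norm (tderiv (a + b)) \<le> Linf_norm (tderiv a) + Linf_norm (tderiv b)"
    by (rule Linf_norm_add[OF tderiv_measurable A' tderiv_measurable B' tderiv_measurable tderiv_add])
  ultimately show "norm (a + b) \<le> norm a + norm b" by (simp add: norm_W1inf0_def)
  show "norm a = 0 \<longleftrightarrow> a = 0"
  proof
    assume "norm a = 0"
    then have "Linf_norm (curve a) = 0"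
      using norm_parts_nonneg[of a] by (simp add: norm_W1inf0_def)
    then show "a = 0" using curve_eq_0 by (auto simp: curve_inject[symmetric] curve_zero)
  next
    assume "a = 0"
    then have "0 *\<^sub>R a = a" by (simp add: curve_inject[symmetric] curve_simps)
    then show "norm a = 0" using nsc[of 0] by simp
  qed
qed

end

subsection \<open>Smooth maps between normed spaces\<close>

text \<open>An \<open>n\<close>-linear map is represented as a function on lists, of which only the lists of
  length \<open>n\<close> matter.\<close>

definition bounded_multilinear ::
    "nat \<Rightarrow> ('a::real_normed_vector list \<Rightarrow> 'b::real_normed_vector) \<Rightarrow> bool" where
  "bounded_multilinear n m \<longleftrightarrow>
    (\<forall>us ws. length us + 1 + length ws = n \<longrightarrow> linear (\<lambda>v. m (us @ v # ws))) \<and>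
    (\<exists>K. \<forall>vs. length vs = n \<longrightarrow> norm (m vs) \<le> K * prod_list (map norm vs))"

text \<open>\<open>C\<^sup>\<infinity>\<close> in the sense of Frechet: \<open>D n\<close> is the \<open>n\<close>-th derivative, a map into the bounded
  \<open>n\<close>-linear maps, and \<open>D (Suc n)\<close> is its Frechet derivative with respect to the operator norm
  of \<open>n\<close>-linear maps.  (The derivatives live in the growing sequence of spaces
  \<open>L\<^sup>n(E; F)\<close>, so a recursion on the type of bounded linear maps is not typable.)\<close>

definition smooth_on :: "'a::real_normed_vector set \<Rightarrow> ('a \<Rightarrow> 'b::real_normed_vector) \<Rightarrow> bool" where
  "smooth_on S f \<longleftrightarrow> open S \<and>
    (\<exists>D :: nat \<Rightarrow> 'a \<Rightarrow> 'a list \<Rightarrow> 'b.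
      (\<forall>x\<in>S. D 0 x [] = f x) \<and>
      (\<forall>n. \<forall>x\<in>S. bounded_multilinear n (D n x)) \<and>
      (\<forall>n. \<forall>x\<in>S. \<forall>e>0. \<exists>d>0. \<forall>y\<in>S. norm (y - x) < d \<longrightarrow>
        (\<forall>vs. length vs = n \<longrightarrow>
          norm (D n y vs - D n x vs - D (Suc n) x ((y - x) # vs))
            \<le> e * norm (y - x) * prod_list (map norm vs))))"

definition diffeomorphism ::
    "'a::real_normed_vector set \<Rightarrow> 'b::real_normed_vector set \<Rightarrow> ('a \<Rightarrow> 'b) \<Rightarrow> bool" where
  "diffeomorphism V W f \<longleftrightarrow>
    open V \<and> open W \<and> bij_betw f V W \<and> smooth_on V f \<and> smooth_on W (inv_into V f)"

subsection \<open>The geodesic equation\<close>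

definition immersions :: "'n::finite W1inf0 set" where
  "immersions = {c. 0 < essinf circle (\<lambda>\<theta>. ereal (norm (tderiv c \<theta>)))}"

definition ds :: "'n::finite W1inf0 \<Rightarrow> real measure" where
  "ds c = density circle (\<lambda>\<theta>. ennreal (norm (tderiv c \<theta>)))"

definition len :: "'n::finite W1inf0 \<Rightarrow> real" where
  "len c = (\<integral>\<theta>. 1 \<partial>ds c)"

definition Ds :: "'n::finite W1inf0 \<Rightarrow> 'n W1inf0 \<Rightarrow> real \<Rightarrow> real ^ 'n" where
  "Ds c h \<theta> = inverse (norm (tderiv c \<theta>)) *\<^sub>R tderiv h \<theta>"

definition metric_G :: "'n::finite W1inf0 \<Rightarrow> 'n W1inf0 \<Rightarrow> 'n W1inf0 \<Rightarrow> real" where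
  "metric_G c h k = 1 / len c * (\<integral>\<theta>. Ds c h \<theta> \<bullet> Ds c k \<theta> \<partial>ds c)"

text \<open>Elements of \<open>L\<^sup>\<infinity>\<close> are represented by functions, with equality almost everywhere.\<close>

definition Linf :: "(real \<Rightarrow> real ^ 'n::finite) set" where
  "Linf = {k \<in> borel_measurable circle. esssup circle (\<lambda>\<theta>. ereal (norm (k \<theta>))) < \<infinity>}"

definition Linf0 :: "'n::finite W1inf0 \<Rightarrow> (real \<Rightarrow> real ^ 'n) set" where
  "Linf0 c = {k \<in> Linf. (\<integral>\<theta>. k \<theta> \<partial>ds c) = 0}"

text \<open>The orthogonal projection is determined up to null sets only; \<open>SOME\<close> picks a representative,
  and \<open>Ds_inv\<close> does not depend on this choice.\<close>

definition proj0 :: "'n::finite W1inf0 \<Rightarrow> (real \<Rightarrow> real ^ 'n) \<Rightarrow> real \<Rightarrow> real ^ 'n" where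
  "proj0 c k = (SOME p. p \<in> Linf0 c \<and> (\<forall>q\<in>Linf0 c. (\<integral>\<theta>. (k \<theta> - p \<theta>) \<bullet> q \<theta> \<partial>ds c) = 0))"

definition Ds_inv :: "'n::finite W1inf0 \<Rightarrow> (real \<Rightarrow> real ^ 'n) \<Rightarrow> 'n W1inf0" where
  "Ds_inv c k = (THE h. AE \<theta> in circle. Ds c h \<theta> = k \<theta>)"

definition geodesic_rhs :: "'n::finite W1inf0 \<Rightarrow> 'n W1inf0 \<Rightarrow> 'n W1inf0" where
  "geodesic_rhs c h = metric_G c c h *\<^sub>R h - (1/2 * metric_G c h h) *\<^sub>R c
     + Ds_inv c (proj0 c (\<lambda>\<theta>. (Ds c c \<theta> \<bullet> Ds c h \<theta>) *\<^sub>R Ds c h \<theta>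
         - (1/2 * (norm (Ds c h \<theta>))\<^sup>2) *\<^sub>R Ds c c \<theta>))"

text \<open>Solutions are curves on an open interval \<open>J\<close> around \<open>0\<close> that are twice differentiable with
  respect to the norm of \<open>W1inf0\<close>.\<close>

definition geodesic_ivp ::
    "real set \<Rightarrow> (real \<Rightarrow> 'n::finite W1inf0) \<Rightarrow> 'n W1inf0 \<Rightarrow> 'n W1inf0 \<Rightarrow> bool" where
  "geodesic_ivp J \<gamma> c h \<longleftrightarrow> open J \<and> is_interval J \<and> 0 \<in> J \<and>
    (\<exists>\<gamma>'. \<gamma> 0 = c \<and> \<gamma>' 0 = h \<and>
      (\<forall>t\<in>J. \<gamma> t \<in> immersions \<and>
        (\<gamma> has_vector_derivative \<gamma>' t) (at t) \<and>
        (\<gamma>' has_vector_derivative geodesic_rhs (\<gamma> t) (\<gamma>' t)) (at t)))"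

definition geodesic_exp :: "'n::finite W1inf0 \<Rightarrow> 'n W1inf0 \<Rightarrow> 'n W1inf0" where
  "geodesic_exp c h = (THE p. \<exists>J \<gamma>. 1 \<in> J \<and> geodesic_ivp J \<gamma> c h \<and> \<gamma> 1 = p)"

end

theory Submission
  imports Defs
begin

text \<open>Written in terms of \<open>\<theta>\<close>, the right-hand side of the geodesic equation is built by bounded
  bilinear maps on \<open>L\<^sup>\<infinity>\<close> from the \<open>\<theta>\<close>-derivatives of \<open>c\<close> and \<open>c\<^sub>t\<close>, from \<open>1/|c\<^sub>\<theta>|\<close> and from the
  reciprocal of the length; the integration in \<open>D\<^sub>s\<^sup>-\<^sup>1\<close> compensates the derivatives.  Hence the
  equation is an ordinary differential equation for a smooth vector field on an open subset of a
  Banach space, and its flow is smooth by the inverse function theorem on a space of paths.  The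
  equation is quadratic in the velocity, so the exponential map is the flow at a fixed small time
  with rescaled velocity.  The derivative of \<open>(c, h) \<mapsto> (c, exp\<^sub>c h)\<close> at \<open>(c, 0)\<close> is
  \<open>(k, l) \<mapsto> (k, k + l)\<close>, and the inverse function theorem applies again.

  Smoothness is expressed through tangent maps: the tangent map of a composition, of an inverse or
  of a superposition operator \<open>u \<mapsto> f \<circ> u\<close> is a map of the same kind, which makes the smoothness of
  all of these an induction over the order of differentiability.\<close>

subsection \<open>Smooth maps through iterated tangent maps\<close>

text \<open>Two notions of smoothness meet. Tangent maps ask only for pointwise Frechet
  differentiability, whereas \<open>smooth_on\<close> wants derivatives in the operator norm. The
  gap closes because iterated derivatives are jointly continuous in point and directions: near zero
  directions they are bounded, multilinearity turns this into a local operator bound, and the bound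
  of order n + 2 gives a quadratic Taylor remainder at order n, uniformly in the directions. In the
  equation the obstacle is 1/|c_\<theta>|: it is smooth as a map into L^infinity because the
  essential infimum makes the pointwise Taylor remainder uniform in \<theta>. The other ingredients
  are bounded linear or bilinear maps and the reciprocal of a positive real. As means vanish on
  \<open>W1inf0\<close>, the derivative alone controls the norm. This yields the completeness
  required by the fixed point arguments, and a model of L^infinity on which pointwise products are
  bounded bilinear. The last difficulty is global: local inverses near each (c, 0) have to be glued
  to one injective map near the whole zero section.\<close>

type_synonym 'a seqs = "nat \<Rightarrow>\<^sub>C 'a"

text \<open>The inverse function theorem rests on the contraction principle and is applied to spaces
  of paths, which therefore have to be Banach spaces.\<close>

instance bcontfun :: (metric_space, banach) banach ..

text \<open>Every function on the discrete space \<open>nat\<close> is continuous, so boundedness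
  alone makes it an element of the type.\<close>

lemma apply_Bcontfun_nat:
  fixes f :: "nat \<Rightarrow> 'a::real_normed_vector"
  assumes "\<And>n. norm (f n) \<le> b"
  shows "apply_bcontfun (Bcontfun f) = f"
proof (rule Bcontfun_inverse, rule bcontfun_normI[OF _ assms])
  show "continuous_on UNIV f"
    by (simp add: continuous_on_open_vimage open_discrete)
qed

definition ev :: "'a::real_normed_vector seqs \<Rightarrow> 'a seqs" where
  "ev z = Bcontfun (\<lambda>n. z (2 * n))"

definition od :: "'a::real_normed_vector seqs \<Rightarrow> 'a seqs" where
  "od z = Bcontfun (\<lambda>n. z (2 * n + 1))"

definition join :: "'a::real_normed_vector seqs \<Rightarrow> 'a seqs \<Rightarrow> 'a seqs" where
  "join x y = Bcontfun (\<lambda>n. if even n then x (n div 2) else y (n div 2))"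

definition emb :: "'a::real_normed_vector \<Rightarrow> 'a seqs" where
  "emb x = Bcontfun (\<lambda>n. if n = 0 then x else 0)"

lemma ev_apply [simp]: "ev z n = z (2 * n)"
  unfolding ev_def by (subst apply_Bcontfun_nat[of _ "norm z"]) (auto intro: norm_bounded)

lemma od_apply [simp]: "od z n = z (2 * n + 1)"
  unfolding od_def by (subst apply_Bcontfun_nat[of _ "norm z"]) (auto intro: norm_bounded)

lemma join_apply [simp]: "join x y n = (if even n then x (n div 2) else y (n div 2))"
  unfolding join_def
  by (subst apply_Bcontfun_nat[of _ "norm x + norm y"])
    (auto intro: norm_bounded add_increasing add_increasing2)

lemma emb_apply [simp]: "emb x n = (if n = 0 then x else 0)"
  unfolding emb_def by (subst apply_Bcontfun_nat[of _ "norm x"]) auto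

lemma ev_join [simp]: "ev (join x y) = x"
  and od_join [simp]: "od (join x y) = y"
  and join_ev_od [simp]: "join (ev z) (od z) = z"
  by (auto intro!: bcontfun_eqI elim!: evenE oddE)

lemma bounded_linear_coord: "bounded_linear (\<lambda>z::'i::topological_space \<Rightarrow>\<^sub>C 'a::real_normed_vector. z i)"
  by (rule bounded_linear_intro[of _ 1]) (auto intro: norm_bounded)

lemma bounded_linear_ev: "bounded_linear ev"
  by (rule bounded_linear_intro[of _ 1]) (auto intro!: bcontfun_eqI norm_bound norm_bounded)

lemma bounded_linear_od: "bounded_linear od"
  by (rule bounded_linear_intro[of _ 1]) (auto intro!: bcontfun_eqI norm_bound norm_bounded)

lemma bounded_linear_emb: "bounded_linear emb"
  by (rule bounded_linear_intro[of _ 1]) (auto intro!: bcontfun_eqI norm_bound)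

lemma bounded_linear_join_pair: "bounded_linear (\<lambda>p. join (fst p) (snd p))"
proof (rule bounded_linear_intro[of _ 1])
  fix p :: "'a seqs \<times> 'a seqs"
  show "norm (join (fst p) (snd p)) \<le> norm p * 1"
    using norm_fst_le[of "fst p" "snd p"] norm_snd_le[of "snd p" "fst p"]
    by (intro norm_bound) (auto intro: order_trans[OF norm_bounded])
qed (auto intro!: bcontfun_eqI)

lemma bounded_linear_join:
  assumes "bounded_linear A" "bounded_linear B"
  shows "bounded_linear (\<lambda>z. join (A z) (B z))"
  using bounded_linear_compose[OF bounded_linear_join_pair bounded_linear_Pair[OF assms]] by simp

text \<open>The tangent map of a map on \<open>E\<close> lives on \<open>E \<times> E\<close>, so iterating it changes the type.  The space
  of bounded sequences is isomorphic to its own square (even and odd entries), hence a map of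
  finitely many entries of a sequence has all its iterated tangent maps over one type.  A map on
  \<open>E\<close> is regarded as a map of the entry with index \<open>0\<close>.\<close>

abbreviation fder :: "('a::real_normed_vector \<Rightarrow> 'b::real_normed_vector) \<Rightarrow> 'a \<Rightarrow> 'a \<Rightarrow> 'b" where
  "fder f x \<equiv> frechet_derivative f (at x)"

text \<open>In a tangent vector \<open>z\<close>, \<open>ev z\<close> is the base point and
  \<open>od z\<close> the direction. Each order asks for differentiability only; continuity of the
  derivative, jointly in point and direction, comes out of the next order.\<close>

fun ndiff :: "nat \<Rightarrow> 'a::real_normed_vector seqs set \<Rightarrow> ('a seqs \<Rightarrow> 'b::real_normed_vector) \<Rightarrow> bool" where
  "ndiff 0 S f = True"
| "ndiff (Suc k) S f = ((\<forall>x\<in>S. f differentiable (at x)) \<and>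
     ndiff k {z. ev z \<in> S} (\<lambda>z. frechet_derivative f (at (ev z)) (od z)))"

abbreviation tdom :: "'a::real_normed_vector seqs set \<Rightarrow> 'a seqs set" where
  "tdom S \<equiv> {z. ev z \<in> S}"

lemma open_linear_vimage:
  assumes "open S" "bounded_linear A"
  shows "open {z. A z \<in> S}"
  using open_vimage[OF assms(1) linear_continuous_on[OF assms(2)]] by (simp add: vimage_def)

lemma open_tdom: "open S \<Longrightarrow> open (tdom S)"
  by (rule open_linear_vimage[OF _ bounded_linear_ev])

lemma frechet_derivative_cong_open:
  assumes "open S" "x \<in> S" "\<And>y. y \<in> S \<Longrightarrow> f y = g y"
  shows "frechet_derivative f (at x) = frechet_derivative g (at x)"
proof -
  have "(f has_derivative D) (at x) \<longleftrightarrow> (g has_derivative D) (at x)" for D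
    using has_derivative_transform_within_open[OF _ assms(1,2)] assms(3) by metis
  then show ?thesis by (simp add: frechet_derivative_def)
qed

lemma ndiff_cong:
  assumes "open S" "\<And>x. x \<in> S \<Longrightarrow> f x = g x"
  shows "ndiff k S f \<longleftrightarrow> ndiff k S g"
  using assms
proof (induction k arbitrary: S f g)
  case (Suc k)
  have d: "f differentiable (at x) \<longleftrightarrow> g differentiable (at x)" if "x \<in> S" for x
    using has_derivative_transform_within_open[OF _ Suc.prems(1) that] Suc.prems(2)
    unfolding differentiable_def by metis
  have "ndiff k (tdom S) (\<lambda>z. frechet_derivative f (at (ev z)) (od z)) \<longleftrightarrow>
      ndiff k (tdom S) (\<lambda>z. frechet_derivative g (at (ev z)) (od z))"
    by (rule Suc.IH[OF open_tdom[OF Suc.prems(1)]])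
      (simp add: frechet_derivative_cong_open[OF Suc.prems(1) _ Suc.prems(2)])
  then show ?case using d by simp
qed simp

lemma ndiff_subset: "ndiff k S f \<Longrightarrow> T \<subseteq> S \<Longrightarrow> ndiff k T f"
proof (induction k arbitrary: S T f)
  case (Suc k)
  show ?case
    using Suc.prems Suc.IH[of "tdom S" _ "tdom T"] by auto
qed simp

text \<open>Derivatives are taken at a point of the whole space rather than within a set, so
  \<open>ndiff\<close> is a condition on single points and arbitrary pieces can be glued.\<close>

lemma ndiff_local:
  assumes "\<And>x. x \<in> S \<Longrightarrow> \<exists>T. x \<in> T \<and> T \<subseteq> S \<and> ndiff k T f"
  shows "ndiff k S f"
  using assms
proof (induction k arbitrary: S f)
  case (Suc k)
  have "ndiff k (tdom S) (\<lambda>z. frechet_derivative f (at (ev z)) (od z))"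
  proof (rule Suc.IH)
    fix z assume "z \<in> tdom S"
    then obtain T where "ev z \<in> T" "T \<subseteq> S" "ndiff (Suc k) T f" using Suc.prems by blast
    then show "\<exists>T'. z \<in> T' \<and> T' \<subseteq> tdom S \<and> ndiff k T' (\<lambda>z. frechet_derivative f (at (ev z)) (od z))"
      by (intro exI[of _ "tdom T"]) auto
  qed
  then show ?case using Suc.prems by fastforce
qed simp

lemma ndiff_SucI:
  assumes "open S" "\<And>x. x \<in> S \<Longrightarrow> (f has_derivative f' x) (at x)"
    and "ndiff k (tdom S) (\<lambda>z. f' (ev z) (od z))"
  shows "ndiff (Suc k) S f"
proof -
  have "ndiff k (tdom S) (\<lambda>z. frechet_derivative f (at (ev z)) (od z))
      \<longleftrightarrow> ndiff k (tdom S) (\<lambda>z. f' (ev z) (od z))"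
    using assms(1,2) by (intro ndiff_cong open_tdom) (auto simp: frechet_derivative_at[symmetric, OF assms(2)])
  then show ?thesis using assms by (auto simp: differentiable_def)
qed

lemma ndiff_SucD:
  assumes "ndiff (Suc k) S f"
  shows "x \<in> S \<Longrightarrow> (f has_derivative fder f x) (at x)"
    and "ndiff k (tdom S) (\<lambda>z. fder f (ev z) (od z))"
  using assms by (auto simp: frechet_derivative_works)

lemma ndiff_lower: "ndiff (Suc k) S f \<Longrightarrow> ndiff k S f"
  by (induction k arbitrary: S f) auto

lemma ndiff_const: "open S \<Longrightarrow> ndiff k S (\<lambda>_. c)"
proof (induction k arbitrary: S c)
  case (Suc k)
  then show ?case
    by (intro ndiff_SucI[where f' = "\<lambda>_ _. 0"] Suc.IH open_tdom) auto
qed simp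

lemma ndiff_linear: "open S \<Longrightarrow> bounded_linear L \<Longrightarrow> ndiff k S L"
proof (induction k arbitrary: S L)
  case (Suc k)
  then show ?case
    by (intro ndiff_SucI[where f' = "\<lambda>_. L"] Suc.IH open_tdom bounded_linear_compose[OF _ bounded_linear_od])
      (auto intro: bounded_linear_imp_has_derivative)
qed simp

lemma ndiff_linear_comp: "open S \<Longrightarrow> bounded_linear L \<Longrightarrow> ndiff k S f \<Longrightarrow> ndiff k S (\<lambda>x. L (f x))"
proof (induction k arbitrary: S f)
  case (Suc k)
  note f' = ndiff_SucD[OF Suc.prems(3)]
  show ?case
    by (rule ndiff_SucI[where f' = "\<lambda>x h. L (fder f x h)", OF Suc.prems(1)])
      (auto intro!: bounded_linear.has_derivative[OF Suc.prems(2)] f' Suc.IH open_tdom Suc.prems)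
qed simp

text \<open>The tangent map of a composition with a linear \<open>A\<close> is the tangent map of
  \<open>f\<close> composed with the linear map \<open>join (A (ev z)) (A (od z))\<close>. Hence
  \<open>A\<close> varies in the induction.\<close>

lemma ndiff_comp_linear:
  "open S \<Longrightarrow> bounded_linear A \<Longrightarrow> ndiff k S f \<Longrightarrow> ndiff k {z. A z \<in> S} (\<lambda>z. f (A z))"
proof (induction k arbitrary: S f A)
  case (Suc k)
  note f' = ndiff_SucD[OF Suc.prems(3)]
  have A': "bounded_linear (\<lambda>z. join (A (ev z)) (A (od z)))"
    by (intro bounded_linear_join bounded_linear_compose[OF Suc.prems(2)] bounded_linear_ev bounded_linear_od)
  show ?case
  proof (rule ndiff_SucI[where f' = "\<lambda>x h. fder f (A x) (A h)"])
    show "open {z. A z \<in> S}" by (rule open_linear_vimage[OF Suc.prems(1,2)])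
    show "((\<lambda>z. f (A z)) has_derivative (\<lambda>h. fder f (A x) (A h))) (at x)" if "x \<in> {z. A z \<in> S}" for x
      using diff_chain_at[OF bounded_linear_imp_has_derivative[OF Suc.prems(2)] f'(1)] that
      by (auto simp: o_def)
    show "ndiff k (tdom {z. A z \<in> S}) (\<lambda>z. fder f (A (ev z)) (A (od z)))"
      using Suc.IH[OF open_tdom[OF Suc.prems(1)] A' f'(2)] by simp
  qed
qed simp

lemma ndiff_add:
  "open S \<Longrightarrow> ndiff k S f \<Longrightarrow> ndiff k S g \<Longrightarrow> ndiff k S (\<lambda>x. f x + g x)"
proof (induction k arbitrary: S f g)
  case (Suc k)
  note f' = ndiff_SucD[OF Suc.prems(2)]
  note g' = ndiff_SucD[OF Suc.prems(3)]
  show ?case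
    by (rule ndiff_SucI[where f' = "\<lambda>x h. fder f x h + fder g x h", OF Suc.prems(1)])
      (auto intro!: has_derivative_add f' g' Suc.IH open_tdom Suc.prems)
qed simp

text \<open>The product rule writes the tangent map as a sum of two terms of the same bilinear
  shape; the undifferentiated factors are pulled back along \<open>ev\<close> at the lower
  order.\<close>

lemma ndiff_bilinear:
  assumes B: "bounded_bilinear B"
  shows "open S \<Longrightarrow> ndiff k S f \<Longrightarrow> ndiff k S g \<Longrightarrow> ndiff k S (\<lambda>x. B (f x) (g x))"
proof (induction k arbitrary: S f g)
  case (Suc k)
  note f' = ndiff_SucD[OF Suc.prems(2)]
  note g' = ndiff_SucD[OF Suc.prems(3)]
  have ev: "ndiff k (tdom S) (\<lambda>z. f (ev z))" "ndiff k (tdom S) (\<lambda>z. g (ev z))"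
    using ndiff_comp_linear[OF Suc.prems(1) bounded_linear_ev] ndiff_lower Suc.prems(2,3) by blast+
  show ?case
    by (rule ndiff_SucI[where f' = "\<lambda>x h. B (f x) (fder g x h) + B (fder f x h) (g x)", OF Suc.prems(1)])
      (auto intro!: bounded_bilinear.FDERIV[OF B] f' g' Suc.IH ndiff_add ev open_tdom Suc.prems)
qed simp

lemma ndiff_join:
  fixes f g :: "'a::real_normed_vector seqs \<Rightarrow> 'b::real_normed_vector seqs"
  assumes "open S" "ndiff k S f" "ndiff k S g"
  shows "ndiff k S (\<lambda>x. join (f x) (g x))"
proof -
  have l: "bounded_linear (\<lambda>x. join x 0)" "bounded_linear (\<lambda>y. join 0 y)"
    by (intro bounded_linear_join bounded_linear_ident bounded_linear_zero)+
  have "ndiff k S (\<lambda>x. join (f x) 0 + join 0 (g x))"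
    by (intro ndiff_add ndiff_linear_comp[OF _ l(1)] ndiff_linear_comp[OF _ l(2)] assms)
  moreover have "join x 0 + join 0 y = join x y" for x y :: "'b seqs"
    by (auto intro!: bcontfun_eqI)
  ultimately show ?thesis by simp
qed

text \<open>Tangent maps are functorial: T(g o f) = Tg o Tf. The values of \<open>f\<close> are
  sequences so that Tf can again be coded by \<open>join\<close>, which keeps the induction within
  one type.\<close>

lemma ndiff_comp:
  "open S \<Longrightarrow> open T \<Longrightarrow> ndiff k S f \<Longrightarrow> ndiff k T g \<Longrightarrow> (\<And>x. x \<in> S \<Longrightarrow> f x \<in> T) \<Longrightarrow> ndiff k S (\<lambda>x. g (f x))"
  for f :: "'a::real_normed_vector seqs \<Rightarrow> 'b::real_normed_vector seqs"
proof (induction k arbitrary: S T f g)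
  case (Suc k)
  note f' = ndiff_SucD[OF Suc.prems(3)]
  note g' = ndiff_SucD[OF Suc.prems(4)]
  have j: "ndiff k (tdom S) (\<lambda>z. join (f (ev z)) (fder f (ev z) (od z)))"
    using ndiff_comp_linear[OF Suc.prems(1) bounded_linear_ev ndiff_lower[OF Suc.prems(3)]]
    by (intro ndiff_join f' open_tdom Suc.prems)
  show ?case
  proof (rule ndiff_SucI[where f' = "\<lambda>x h. fder g (f x) (fder f x h)", OF Suc.prems(1)])
    show "((\<lambda>x. g (f x)) has_derivative (\<lambda>h. fder g (f x) (fder f x h))) (at x)" if "x \<in> S" for x
      using diff_chain_at[OF f'(1) g'(1)] Suc.prems(5) that by (auto simp: o_def)
    show "ndiff k (tdom S) (\<lambda>z. fder g (f (ev z)) (fder f (ev z) (od z)))"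
      using Suc.IH[OF open_tdom open_tdom j g'(2)] Suc.prems by simp
  qed
qed simp

section \<open>Maps on an arbitrary normed space\<close>

abbreviation zdom :: "'a::real_normed_vector set \<Rightarrow> 'a seqs set" where
  "zdom S \<equiv> {z. apply_bcontfun z 0 \<in> S}"

definition kdiff :: "nat \<Rightarrow> 'a::real_normed_vector set \<Rightarrow> ('a \<Rightarrow> 'b::real_normed_vector) \<Rightarrow> bool" where
  "kdiff k S f \<longleftrightarrow> ndiff k (zdom S) (\<lambda>z. f (apply_bcontfun z 0))"

definition csmooth :: "'a::real_normed_vector set \<Rightarrow> ('a \<Rightarrow> 'b::real_normed_vector) \<Rightarrow> bool" where
  "csmooth S f \<longleftrightarrow> open S \<and> (\<forall>k. kdiff k S f)"

lemma kdiff_0 [simp]: "kdiff 0 S f"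
  by (simp add: kdiff_def)

lemma open_coord: "open S \<Longrightarrow> open {z. apply_bcontfun z i \<in> S}"
  for S :: "'a::real_normed_vector set"
  by (rule open_linear_vimage[OF _ bounded_linear_coord])

lemma kdiff_cong:
  assumes "open S" "\<And>x. x \<in> S \<Longrightarrow> f x = g x"
  shows "kdiff k S f \<longleftrightarrow> kdiff k S g"
  unfolding kdiff_def by (intro ndiff_cong open_coord) (auto simp: assms)

lemma kdiff_subset: "kdiff k S f \<Longrightarrow> T \<subseteq> S \<Longrightarrow> kdiff k T f"
  unfolding kdiff_def by (erule ndiff_subset) auto

lemma kdiff_local:
  assumes "\<And>x. x \<in> S \<Longrightarrow> \<exists>T. x \<in> T \<and> T \<subseteq> S \<and> kdiff k T f"
  shows "kdiff k S f"
  unfolding kdiff_def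
proof (rule ndiff_local)
  fix z :: "'a seqs" assume "z \<in> (zdom S)"
  then obtain T where "z 0 \<in> T" "T \<subseteq> S" "kdiff k T f" using assms by blast
  then show "\<exists>T'. z \<in> T' \<and> T' \<subseteq> (zdom S) \<and> ndiff k T' (\<lambda>z. f (apply_bcontfun z 0))"
    by (intro exI[of _ "zdom T"]) (auto simp: kdiff_def)
qed

lemma kdiff_const: "open S \<Longrightarrow> kdiff k S (\<lambda>_. c)"
  unfolding kdiff_def by (intro ndiff_const open_coord)

lemma kdiff_linear: "open S \<Longrightarrow> bounded_linear L \<Longrightarrow> kdiff k S L"
  unfolding kdiff_def
  by (rule ndiff_linear[OF open_coord bounded_linear_compose[OF _ bounded_linear_coord]])

lemma kdiff_linear_comp: "open S \<Longrightarrow> bounded_linear L \<Longrightarrow> kdiff k S f \<Longrightarrow> kdiff k S (\<lambda>x. L (f x))"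
  unfolding kdiff_def by (rule ndiff_linear_comp[OF open_coord])

lemma kdiff_add: "open S \<Longrightarrow> kdiff k S f \<Longrightarrow> kdiff k S g \<Longrightarrow> kdiff k S (\<lambda>x. f x + g x)"
  unfolding kdiff_def by (intro ndiff_add open_coord)

lemma kdiff_bilinear:
  "bounded_bilinear B \<Longrightarrow> open S \<Longrightarrow> kdiff k S f \<Longrightarrow> kdiff k S g \<Longrightarrow> kdiff k S (\<lambda>x. B (f x) (g x))"
  unfolding kdiff_def by (rule ndiff_bilinear[OF _ open_coord])

lemma kdiff_uminus: "open S \<Longrightarrow> kdiff k S f \<Longrightarrow> kdiff k S (\<lambda>x. - f x)"
  by (rule kdiff_linear_comp[OF _ bounded_linear_minus[OF bounded_linear_ident]])

lemma kdiff_diff: "open S \<Longrightarrow> kdiff k S f \<Longrightarrow> kdiff k S g \<Longrightarrow> kdiff k S (\<lambda>x. f x - g x)"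
  using kdiff_add[of S k f "\<lambda>x. - g x"] kdiff_uminus[of S k g] by simp

lemma kdiff_Pair:
  assumes "open S" "kdiff k S f" "kdiff k S g"
  shows "kdiff k S (\<lambda>x. (f x, g x))"
proof -
  have l: "bounded_linear (\<lambda>x. (x, 0))" "bounded_linear (\<lambda>y. (0, y))"
    by (intro bounded_linear_Pair bounded_linear_ident bounded_linear_zero)+
  have "kdiff k S (\<lambda>x. (f x, 0) + (0, g x))"
    by (intro kdiff_add kdiff_linear_comp[OF _ l(1)] kdiff_linear_comp[OF _ l(2)] assms)
  then show ?thesis by simp
qed

text \<open>\<open>emb\<close> turns the values of the inner map into sequences, as
  \<open>ndiff_comp\<close> demands; the outer map reads entry 0.\<close>

lemma kdiff_comp:
  assumes "open S" "open T" "kdiff k S f" "kdiff k T g" "\<And>x. x \<in> S \<Longrightarrow> f x \<in> T"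
  shows "kdiff k S (\<lambda>x. g (f x))"
proof -
  have "ndiff k (zdom S) (\<lambda>z. emb (f (z 0)))"
    by (rule ndiff_linear_comp[OF open_coord[OF assms(1)] bounded_linear_emb assms(3)[unfolded kdiff_def]])
  from ndiff_comp[OF open_coord[OF assms(1)] open_coord[OF assms(2)] this assms(4)[unfolded kdiff_def]]
  show ?thesis using assms(5) by (simp add: kdiff_def)
qed

text \<open>With its converse \<open>kdiff_SucI\<close> this gives \<open>kdiff\<close> the expected
  recursion through tangent maps on \<open>S \<times> UNIV\<close>, so that later inductions can
  avoid the coding by sequences.\<close>

lemma kdiff_SucD:
  assumes "open S" "kdiff (Suc k) S f"
  shows kdiff_has_derivative: "x \<in> S \<Longrightarrow> (f has_derivative fder f x) (at x)"
    and kdiff_tangent: "kdiff k (S \<times> UNIV) (\<lambda>p. fder f (fst p) (snd p))"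
proof -
  let ?F = "\<lambda>z::'a seqs. f (z 0)"
  note F = ndiff_SucD[OF assms(2)[unfolded kdiff_def]]
  show f: "(f has_derivative fder f x) (at x)" if "x \<in> S" for x
  proof -
    have "((\<lambda>x. ?F (emb x)) has_derivative (\<lambda>h. fder ?F (emb x) (emb h))) (at x)"
      using diff_chain_at[OF bounded_linear_imp_has_derivative[OF bounded_linear_emb] F(1)[of "emb x"]] that
      by (simp add: o_def)
    then have "f differentiable (at x)" by (auto simp: differentiable_def)
    then show ?thesis by (simp add: frechet_derivative_works)
  qed
  have FF: "fder ?F z h = fder f (z 0) (h 0)" if "z 0 \<in> S" for z h :: "'a seqs"
  proof -
    have "(?F has_derivative (\<lambda>h. fder f (z 0) (h 0))) (at z)"
      using diff_chain_at[OF bounded_linear_imp_has_derivative[OF bounded_linear_coord] f[OF that]]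
      by (simp add: o_def)
    from fun_cong[OF frechet_derivative_at[OF this], of h] show ?thesis by simp
  qed
  have "ndiff k (tdom (zdom S)) (\<lambda>z. fder f (ev z 0) (od z 0))
      \<longleftrightarrow> ndiff k (tdom (zdom S)) (\<lambda>z. fder ?F (ev z) (od z))"
    by (intro ndiff_cong open_tdom open_coord assms) (simp add: FF)
  with F(2) have N: "ndiff k (tdom (zdom S)) (\<lambda>z. fder f (ev z 0) (od z 0))" by simp
  \<comment> \<open>\<open>A\<close> codes a pair of point and direction as a tangent vector in
    sequence space, with both parts at entry 0.\<close>
  have A: "bounded_linear (\<lambda>w::('a \<times> 'a) seqs. join (emb (fst (w 0))) (emb (snd (w 0))))"
    by (intro bounded_linear_join bounded_linear_compose[OF bounded_linear_emb]
      bounded_linear_compose[OF bounded_linear_fst] bounded_linear_compose[OF bounded_linear_snd] bounded_linear_coord)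
  show "kdiff k (S \<times> UNIV) (\<lambda>p. fder f (fst p) (snd p))"
    using ndiff_comp_linear[OF open_tdom[OF open_coord[OF assms(1)]] A N]
    by (simp add: kdiff_def mem_Times_iff)
qed

lemma kdiff_SucI:
  assumes "open S" "\<And>x. x \<in> S \<Longrightarrow> (f has_derivative f' x) (at x)"
    and "kdiff k (S \<times> UNIV) (\<lambda>p. f' (fst p) (snd p))"
  shows "kdiff (Suc k) S f"
  unfolding kdiff_def
proof (rule ndiff_SucI[OF open_coord[OF assms(1)], where f' = "\<lambda>z h. f' (z 0) (h 0)"])
  fix z :: "'a seqs" assume "z \<in> (zdom S)"
  then show "((\<lambda>z::'a seqs. f (z 0)) has_derivative (\<lambda>h. f' (z 0) (h 0))) (at z)"
    using diff_chain_at[OF bounded_linear_imp_has_derivative[OF bounded_linear_coord] assms(2)]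
    by (simp add: o_def)
next
  have A: "bounded_linear (\<lambda>z::'a seqs. emb (ev z 0, od z 0))"
    by (intro bounded_linear_compose[OF bounded_linear_emb] bounded_linear_Pair
      bounded_linear_compose[OF bounded_linear_coord] bounded_linear_ev bounded_linear_od)
  show "ndiff k (tdom (zdom S)) (\<lambda>z. f' (ev z 0) (od z 0))"
    using ndiff_comp_linear[OF open_coord[OF open_Times[OF assms(1) open_UNIV]] A assms(3)[unfolded kdiff_def]]
    by (simp add: mem_Times_iff)
qed

section \<open>Calculus of smooth maps\<close>

lemma csmooth_open: "csmooth S f \<Longrightarrow> open S"
  and csmooth_kdiff: "csmooth S f \<Longrightarrow> kdiff k S f"
  by (auto simp: csmooth_def)

lemma csmooth_cong: "(\<And>x. x \<in> S \<Longrightarrow> f x = g x) \<Longrightarrow> csmooth S f \<longleftrightarrow> csmooth S g"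
  using kdiff_cong[of S f g] by (auto simp: csmooth_def)

lemma csmooth_subset: "csmooth S f \<Longrightarrow> T \<subseteq> S \<Longrightarrow> open T \<Longrightarrow> csmooth T f"
  by (auto simp: csmooth_def intro: kdiff_subset)

lemma csmooth_local:
  assumes "\<And>x. x \<in> S \<Longrightarrow> \<exists>T. x \<in> T \<and> T \<subseteq> S \<and> csmooth T f"
  shows "csmooth S f"
proof -
  have "open S"
  proof (rule Topological_Spaces.openI)
    fix x assume "x \<in> S"
    with assms show "\<exists>T. open T \<and> x \<in> T \<and> T \<subseteq> S" by (meson csmooth_open)
  qed
  moreover have "kdiff k S f" for k
  proof (rule kdiff_local)
    fix x assume "x \<in> S"
    with assms show "\<exists>T. x \<in> T \<and> T \<subseteq> S \<and> kdiff k T f" by (meson csmooth_kdiff)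
  qed
  ultimately show ?thesis by (simp add: csmooth_def)
qed

lemma csmooth_const: "open S \<Longrightarrow> csmooth S (\<lambda>_. c)"
  by (simp add: csmooth_def kdiff_const)

lemma csmooth_linear: "open S \<Longrightarrow> bounded_linear L \<Longrightarrow> csmooth S L"
  by (simp add: csmooth_def kdiff_linear)

lemma csmooth_linear_comp: "bounded_linear L \<Longrightarrow> csmooth S f \<Longrightarrow> csmooth S (\<lambda>x. L (f x))"
  by (simp add: csmooth_def kdiff_linear_comp)

lemma csmooth_add: "csmooth S f \<Longrightarrow> csmooth S g \<Longrightarrow> csmooth S (\<lambda>x. f x + g x)"
  by (simp add: csmooth_def kdiff_add)

lemma csmooth_diff: "csmooth S f \<Longrightarrow> csmooth S g \<Longrightarrow> csmooth S (\<lambda>x. f x - g x)"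
  by (simp add: csmooth_def kdiff_diff)

lemma csmooth_bilinear:
  "bounded_bilinear B \<Longrightarrow> csmooth S f \<Longrightarrow> csmooth S g \<Longrightarrow> csmooth S (\<lambda>x. B (f x) (g x))"
  by (simp add: csmooth_def kdiff_bilinear)

lemmas csmooth_scaleR = csmooth_bilinear[OF bounded_bilinear_scaleR]

lemma csmooth_Pair: "csmooth S f \<Longrightarrow> csmooth S g \<Longrightarrow> csmooth S (\<lambda>x. (f x, g x))"
  by (simp add: csmooth_def kdiff_Pair)

lemma csmooth_comp:
  assumes "csmooth S f" "csmooth T g" "\<And>x. x \<in> S \<Longrightarrow> f x \<in> T"
  shows "csmooth S (\<lambda>x. g (f x))"
  using assms kdiff_comp[of S T _ f g] by (simp add: csmooth_def)

lemma csmooth_has_derivative: "csmooth S f \<Longrightarrow> x \<in> S \<Longrightarrow> (f has_derivative fder f x) (at x)"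
  by (rule kdiff_has_derivative[OF csmooth_open csmooth_kdiff])

lemma csmooth_tangent: "csmooth S f \<Longrightarrow> csmooth (S \<times> UNIV) (\<lambda>p. fder f (fst p) (snd p))"
  by (simp add: csmooth_def open_Times kdiff_tangent)

lemma csmooth_continuous_on: "csmooth S f \<Longrightarrow> continuous_on S f"
  by (intro continuous_at_imp_continuous_on ballI has_derivative_continuous[OF csmooth_has_derivative])

lemma csmooth_derivative_direction: "csmooth S f \<Longrightarrow> csmooth S (\<lambda>x. fder f x v)"
proof -
  assume f: "csmooth S f"
  have "csmooth S (\<lambda>x. (x, v))"
    by (intro csmooth_Pair csmooth_const csmooth_linear bounded_linear_ident csmooth_open[OF f])
  from csmooth_comp[OF this csmooth_tangent[OF f]] show ?thesis by simp
qed

subsection \<open>Comparison with iterated Frechet derivatives\<close>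

text \<open>The head of the list is the direction differentiated last, which matches
  \<open>(y - x) # vs\<close> in \<open>smooth_on\<close>.\<close>

primrec dirder :: "('a::real_normed_vector \<Rightarrow> 'b::real_normed_vector) \<Rightarrow> 'a list \<Rightarrow> 'a \<Rightarrow> 'b" where
  "dirder f [] = f"
| "dirder f (v # vs) = (\<lambda>x. fder (dirder f vs) x v)"

lemma csmooth_dirder: "csmooth S f \<Longrightarrow> csmooth S (dirder f vs)"
  by (induction vs) (auto intro: csmooth_derivative_direction)

text \<open>Linearity in the last direction is linearity of the derivative. For an earlier direction
  it is an identity between functions on the open set \<open>S\<close>, which survives further
  differentiation; hence the induction over \<open>us\<close> with \<open>x\<close>
  arbitrary.\<close>

lemma dirder_linear:
  assumes f: "csmooth S f" and x: "x \<in> S"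
  shows "linear (\<lambda>v. dirder f (us @ v # ws) x)"
proof -
  have fd: "linear (fder g x)" if "csmooth S g" "x \<in> S" for g :: "'a \<Rightarrow> 'b" and x
    using csmooth_has_derivative[OF that] has_derivative_linear by blast
  have "dirder f (us @ (a + b) # ws) x = dirder f (us @ a # ws) x + dirder f (us @ b # ws) x \<and>
        dirder f (us @ (r *\<^sub>R a) # ws) x = r *\<^sub>R dirder f (us @ a # ws) x" for a b r
    using x
  proof (induction us arbitrary: x)
    case Nil
    then show ?case
      using fd[OF csmooth_dirder[OF f]] by (simp add: linear_add linear_scale)
  next
    case (Cons u us)
    have d: "(dirder f vs has_derivative fder (dirder f vs) x) (at x)" for vs
      by (rule csmooth_has_derivative[OF csmooth_dirder[OF f] Cons.prems])
    have "(dirder f (us @ (a + b) # ws) has_derivative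
        (\<lambda>h. fder (dirder f (us @ a # ws)) x h + fder (dirder f (us @ b # ws)) x h)) (at x)"
      using has_derivative_transform_within_open[OF has_derivative_add[OF d d] csmooth_open[OF f] Cons.prems]
        Cons.IH by auto
    moreover have "(dirder f (us @ (r *\<^sub>R a) # ws) has_derivative
        (\<lambda>h. r *\<^sub>R fder (dirder f (us @ a # ws)) x h)) (at x)"
      using has_derivative_transform_within_open[OF has_derivative_scaleR_right[OF d] csmooth_open[OF f] Cons.prems]
        Cons.IH by auto
    ultimately show ?case
      by (auto dest!: frechet_derivative_at[symmetric])
  qed
  then show ?thesis by (intro linearI) auto
qed

text \<open>Scaling each argument to length \<open>\<delta>\<close> turns a bound near the origin into a multilinear bound.\<close>

lemma multilinear_bound:
  fixes m :: "'a::real_normed_vector list \<Rightarrow> 'b::real_normed_vector"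
  assumes lin: "\<And>us ws. length us + 1 + length ws = n \<Longrightarrow> linear (\<lambda>v. m (us @ v # ws))"
    and \<delta>: "\<delta> > 0" and b: "\<And>vs. length vs = n \<Longrightarrow> (\<forall>v\<in>set vs. norm v \<le> \<delta>) \<Longrightarrow> norm (m vs) \<le> K"
    and n: "length vs = n"
  shows "norm (m vs) \<le> K * (1 / \<delta>) ^ n * prod_list (map norm vs)"
proof -
  have "norm (m (us @ ws)) \<le> K * (1 / \<delta>) ^ length ws * prod_list (map norm ws)"
    if "length us + length ws = n" "\<forall>v\<in>set us. norm v \<le> \<delta>" for us ws
    using that
  proof (induction ws arbitrary: us)
    case Nil
    then show ?case using b[of us] by simp
  next
    case (Cons w ws)
    have l: "linear (\<lambda>v. m (us @ v # ws))" using lin[of us ws] Cons.prems by simp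
    show ?case
    proof (cases "w = 0")
      case True
      then show ?thesis using linear_0[OF l] by simp
    next
      case False
      let ?w = "(\<delta> / norm w) *\<^sub>R w"
      have "norm ?w \<le> \<delta>" using False \<delta> by simp
      then have "norm (m ((us @ [?w]) @ ws)) \<le> K * (1 / \<delta>) ^ length ws * prod_list (map norm ws)"
        using Cons.prems by (intro Cons.IH) auto
      then have "norm (m (us @ ?w # ws)) \<le> K * (1 / \<delta>) ^ length ws * prod_list (map norm ws)" by simp
      then have "(\<delta> / norm w) * norm (m (us @ w # ws)) \<le> K * (1 / \<delta>) ^ length ws * prod_list (map norm ws)"
        using linear_scale[OF l, of "\<delta> / norm w" w] \<delta> by simp
      then show ?thesis using False \<delta> by (simp add: field_simps)
    qed
  qed
  from this[of "[]" vs] n show ?thesis by simp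
qed

text \<open>The n-th derivative is smooth jointly in the point (entry 0) and the directions (entries
  1 to n, in reverse order), being obtained from \<open>f\<close> by tangent maps. Joint continuity
  is the source of all operator bounds.\<close>

lemma dirder_joint:
  assumes f: "csmooth S f"
  shows "\<exists>G. (\<forall>k. ndiff k (zdom S) G) \<and>
    (\<forall>z\<in>zdom S. G z = dirder f (map (\<lambda>i. apply_bcontfun z (Suc i)) (rev [0..<n])) (z 0))"
proof (induction n)
  case 0
  then show ?case using csmooth_kdiff[OF f] by (auto simp: kdiff_def intro!: exI[of _ "\<lambda>z. f (apply_bcontfun z 0)"])
next
  case (Suc n)
  let ?vs = "\<lambda>n z. map (\<lambda>i. apply_bcontfun z (Suc i)) (rev [0..<n])"
  obtain G where G: "\<And>k. ndiff k (zdom S) G" "\<And>z. z \<in> zdom S \<Longrightarrow> G z = dirder f (?vs n z) (z 0)"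
    using Suc by blast
  have oS: "open (zdom S)" by (rule open_coord[OF csmooth_open[OF f]])
  \<comment> \<open>The tangent vector at \<open>z\<close> that moves entry 0 in the direction
    stored at entry \<open>Suc n\<close>.\<close>
  have A: "bounded_linear (\<lambda>z. join z (emb (apply_bcontfun z (Suc n))))"
    by (intro bounded_linear_join bounded_linear_ident bounded_linear_compose[OF bounded_linear_emb] bounded_linear_coord)
  have "ndiff k (zdom S) (\<lambda>z. fder G z (emb (apply_bcontfun z (Suc n))))" for k
    using ndiff_comp_linear[OF open_tdom[OF oS] A ndiff_SucD(2)[OF G(1)]] by simp
  moreover have "fder G z (emb (z (Suc n))) = dirder f (?vs (Suc n) z) (z 0)" if z: "z \<in> zdom S" for z
  proof -
    \<comment> \<open>Entry 0 of \<open>z\<close> varies while the stored directions stay fixed, so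
      the partial derivative of \<open>G\<close> is the next directional derivative.\<close>
    have d1: "((\<lambda>x. G (z + emb (x - z 0))) has_derivative (\<lambda>h. fder G z (emb h))) (at (z 0))"
    proof -
      have "((\<lambda>x. z + emb (x - z 0)) has_derivative (\<lambda>h. 0 + emb (h - 0))) (at (z 0))"
        by (intro has_derivative_add has_derivative_const has_derivative_diff has_derivative_ident
            bounded_linear.has_derivative[OF bounded_linear_emb])
      moreover have "z + emb (z 0 - z 0) = z" by (auto intro!: bcontfun_eqI)
      ultimately show ?thesis
        using diff_chain_at[of "\<lambda>x. z + emb (x - z 0)" emb "z 0" G] ndiff_SucD(1)[OF G(1) z] by (simp add: o_def)
    qed
    have d2: "G (z + emb (x - z 0)) = dirder f (?vs n z) x" if "x \<in> S" for x
    proof -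
      have "z + emb (x - z 0) \<in> zdom S" using that by simp
      from G(2)[OF this] show ?thesis by (simp del: map_map)
    qed
    have "(dirder f (?vs n z) has_derivative (\<lambda>h. fder G z (emb h))) (at (z 0))"
      by (rule has_derivative_transform_within_open[OF d1 csmooth_open[OF f] _ d2]) (use z in auto)
    from fun_cong[OF frechet_derivative_at[OF this], of "z (Suc n)"] show ?thesis by simp
  qed
  ultimately show ?case by blast
qed

text \<open>\<open>G\<close> from \<open>dirder_joint\<close> is continuous at \<open>emb x\<close>,
  the point x with zero directions. So it is bounded for nearby points with short directions, and
  \<open>multilinear_bound\<close> extends this to all directions.\<close>

lemma dirder_locally_bounded:
  assumes f: "csmooth S f" and x: "x \<in> S"
  obtains r K where "r > 0" "K \<ge> 0" "ball x r \<subseteq> S"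
    "\<And>y vs. y \<in> ball x r \<Longrightarrow> length vs = n \<Longrightarrow> norm (dirder f vs y) \<le> K * prod_list (map norm vs)"
proof -
  obtain G where G: "\<And>k. ndiff k (zdom S) G"
    "\<And>z. z \<in> zdom S \<Longrightarrow> G z = dirder f (map (\<lambda>i. apply_bcontfun z (Suc i)) (rev [0..<n])) (z 0)"
    using dirder_joint[OF f] by blast
  have "emb x \<in> zdom S" using x by simp
  from has_derivative_continuous[OF ndiff_SucD(1)[OF G(1) this]]
  obtain d where d: "d > 0" "\<And>z. dist z (emb x) < d \<Longrightarrow> dist (G z) (G (emb x)) < 1"
    unfolding continuous_at_eps_delta by (metis zero_less_one)
  obtain e where e: "e > 0" "ball x e \<subseteq> S" using csmooth_open[OF f] x open_contains_ball by blast
  define r where "r = min e (d / 2)"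
  define K0 where "K0 = norm (G (emb x)) + 1"
  have small: "norm (dirder f vs y) \<le> K0" if y: "y \<in> ball x r" and n: "length vs = n" and vs: "\<forall>v\<in>set vs. norm v \<le> d / 2" for y vs
  proof -
    \<comment> \<open>The displacement from \<open>emb x\<close> whose entry 0 leads to
      \<open>y\<close> and whose entries 1 to n hold \<open>vs\<close> backwards, the order produced
      by \<open>rev [0..<n]\<close>.\<close>
    define g where "g i = (if i = 0 then y - x else if i \<le> n then vs ! (n - i) else 0)" for i
    have gb: "norm (g i) \<le> d / 2" for i
      using y vs n d(1) by (auto simp: g_def r_def dist_norm norm_minus_commute)
    have g: "apply_bcontfun (Bcontfun g) = g" by (rule apply_Bcontfun_nat[OF gb])
    define z where "z = emb x + Bcontfun g"
    have "norm (Bcontfun g) \<le> d / 2" by (rule norm_bound) (subst g, rule gb)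
    then have "dist z (emb x) < d" using d(1) by (simp add: z_def dist_norm)
    from d(2)[OF this] have "norm (G z) \<le> K0"
      using norm_triangle_sub[of "G z" "G (emb x)"] unfolding K0_def dist_norm by linarith
    moreover have z0: "z 0 = y" by (simp add: z_def g g_def)
    moreover have "z \<in> zdom S" using y e by (auto simp: z0 r_def)
    moreover have "map (\<lambda>i. z (Suc i)) (rev [0..<n]) = vs"
      using n by (intro nth_equalityI) (auto simp: z_def g g_def rev_nth)
    ultimately show ?thesis using G(2)[of z] by simp
  qed
  show thesis
  proof (rule that[of r "K0 * (1 / (d / 2)) ^ n"])
    show "norm (dirder f vs y) \<le> K0 * (1 / (d / 2)) ^ n * prod_list (map norm vs)"
      if "y \<in> ball x r" "length vs = n" for y vs
    proof (rule multilinear_bound)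
      have "y \<in> S" using that(1) e by (auto simp: r_def)
      then show "linear (\<lambda>v. dirder f (us @ v # ws) y)" for us ws by (rule dirder_linear[OF f])
    qed (use d that small in auto)
  qed (use d e in \<open>auto simp: r_def K0_def\<close>)
qed

text \<open>Two applications of the mean value theorem to a local bound of order n + 2. The
  directions \<open>vs\<close> enter only through the product of their norms, so the remainder is
  uniform in them.\<close>

lemma dirder_expansion:
  assumes f: "csmooth S f" and x: "x \<in> S"
  obtains r K where "r > 0" "K \<ge> 0" "ball x r \<subseteq> S"
    "\<And>y vs. y \<in> ball x r \<Longrightarrow> length vs = n \<Longrightarrow>
      norm (dirder f vs y - dirder f vs x - dirder f ((y - x) # vs) x)
        \<le> K * norm (y - x) * norm (y - x) * prod_list (map norm vs)"
proof -
  obtain r K where r: "r > 0" "K \<ge> 0" "ball x r \<subseteq> S"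
    "\<And>y vs. y \<in> ball x r \<Longrightarrow> length vs = Suc (Suc n) \<Longrightarrow> norm (dirder f vs y) \<le> K * prod_list (map norm vs)"
    using dirder_locally_bounded[OF f x] by metis
  have d: "(dirder f vs has_derivative (\<lambda>h. dirder f (h # vs) y)) (at y)" if "y \<in> ball x r" for y vs
    using csmooth_has_derivative[OF csmooth_dirder[OF f]] that r(3) by auto
  show thesis
  proof (rule that[of r K])
    fix y and vs :: "'a list" assume y: "y \<in> ball x r" and n: "length vs = n"
    let ?B = "cball x (norm (y - x))"
    have B: "?B \<subseteq> ball x r" using y by (auto simp: dist_norm norm_minus_commute)
    define P where "P = prod_list (map norm vs)"
    have P: "P \<ge> 0" unfolding P_def by (induction vs) auto
    \<comment> \<open>Over the closed ball through \<open>y\<close> the derivative of order n + 1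
      varies by at most a multiple of \<open>norm (y - x)\<close>.\<close>
    have b1: "norm (dirder f (h # vs) z - dirder f (h # vs) x) \<le> (K * norm h * P) * norm (y - x)"
      if "z \<in> ?B" for h z
    proof -
      have "norm (dirder f (h # vs) z - dirder f (h # vs) x) \<le> (K * norm h * P) * norm (z - x)"
      proof (rule differentiable_bound[where S = "?B" and f' = "\<lambda>z k. dirder f (k # h # vs) z"])
        show "(dirder f (h # vs) has_derivative (\<lambda>k. dirder f (k # h # vs) w)) (at w within ?B)" if "w \<in> ?B" for w
          using d[of w] that B has_derivative_at_withinI by blast
        show "onorm (\<lambda>k. dirder f (k # h # vs) w) \<le> K * norm h * P" if "w \<in> ?B" for w
        proof (rule onorm_bound)
          fix k show "norm (dirder f (k # h # vs) w) \<le> K * norm h * P * norm k"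
            using r(4)[of w "k # h # vs"] that B n by (auto simp: P_def algebra_simps)
        qed (use r(2) P in auto)
      qed (use that in auto)
      also have "\<dots> \<le> (K * norm h * P) * norm (y - x)"
        using that r(2) P by (intro mult_left_mono) (auto simp: dist_norm norm_minus_commute)
      finally show ?thesis .
    qed
    \<comment> \<open>The second mean value step compares \<open>dirder f vs\<close> with its
      linearization at \<open>x\<close> and supplies the other factor
      \<open>norm (y - x)\<close>.\<close>
    have "norm (dirder f vs y - dirder f vs x - dirder f ((y - x) # vs) x) \<le> norm (y - x) * (K * P * norm (y - x))"
    proof (rule differentiable_bound_linearization[where S = "?B" and f' = "\<lambda>z h. dirder f (h # vs) z"])
      show "x + t *\<^sub>R (y - x) \<in> ?B" if "t \<in> {0..1}" for t
        using that by (auto simp: dist_norm mult_left_le_one_le)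
      show "(dirder f vs has_derivative (\<lambda>h. dirder f (h # vs) w)) (at w within ?B)" if "w \<in> ?B" for w
        using d[of w] that B has_derivative_at_withinI by blast
      show "onorm ((\<lambda>h. dirder f (h # vs) w) - (\<lambda>h. dirder f (h # vs) x)) \<le> K * P * norm (y - x)" if "w \<in> ?B" for w
      proof (rule onorm_bound)
        fix h show "norm (((\<lambda>h. dirder f (h # vs) w) - (\<lambda>h. dirder f (h # vs) x)) h) \<le> K * P * norm (y - x) * norm h"
          using b1[OF that, of h] by (simp only: fun_diff_def) (simp add: algebra_simps)
      qed (use r(2) P in auto)
    qed auto
    then show "norm (dirder f vs y - dirder f vs x - dirder f ((y - x) # vs) x)
        \<le> K * norm (y - x) * norm (y - x) * prod_list (map norm vs)"
      by (simp add: P_def algebra_simps)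
  qed (use r in auto)
qed

lemma csmooth_imp_smooth_on:
  assumes f: "csmooth S f"
  shows "smooth_on S f"
  unfolding smooth_on_def
proof (intro conjI exI[of _ "\<lambda>n x vs. dirder f vs x"] ballI allI impI)
  show "open S" by (rule csmooth_open[OF f])
  fix x assume x: "x \<in> S"
  show "dirder f [] x = f x" by simp
  show "bounded_multilinear n (\<lambda>vs. dirder f vs x)" for n
    unfolding bounded_multilinear_def
  proof (intro conjI allI impI)
    show "linear (\<lambda>v. dirder f (us @ v # ws) x)" for us ws by (rule dirder_linear[OF f x])
    obtain r K where "r > 0" "\<And>y vs. y \<in> ball x r \<Longrightarrow> length vs = n \<Longrightarrow> norm (dirder f vs y) \<le> K * prod_list (map norm vs)"
      using dirder_locally_bounded[OF f x] by metis
    then show "\<exists>K. \<forall>vs. length vs = n \<longrightarrow> norm (dirder f vs x) \<le> K * prod_list (map norm vs)"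
      by (metis centre_in_ball)
  qed
  fix n and e :: real assume e: "e > 0"
  obtain r K where r: "r > 0" "K \<ge> 0" "ball x r \<subseteq> S"
    "\<And>y vs. y \<in> ball x r \<Longrightarrow> length vs = n \<Longrightarrow>
      norm (dirder f vs y - dirder f vs x - dirder f ((y - x) # vs) x)
        \<le> K * norm (y - x) * norm (y - x) * prod_list (map norm vs)"
    using dirder_expansion[OF f x] by metis
  show "\<exists>d>0. \<forall>y\<in>S. norm (y - x) < d \<longrightarrow> (\<forall>vs. length vs = n \<longrightarrow>
      norm (dirder f vs y - dirder f vs x - dirder f ((y - x) # vs) x) \<le> e * norm (y - x) * prod_list (map norm vs))"
  \<comment> \<open>Inside radius e / (K + 1) the quadratic remainder is at most e times the norm;
    the summand 1 covers K = 0.\<close>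
  proof (intro exI[of _ "min r (e / (K + 1))"] conjI ballI impI allI)
    fix y and vs :: "'a list" assume y: "norm (y - x) < min r (e / (K + 1))" and n: "length vs = n"
    have P: "prod_list (map norm vs) \<ge> 0" by (induction vs) auto
    have "norm (y - x) \<le> e / (K + 1)" using y by simp
    then have "(K + 1) * norm (y - x) \<le> e" using r(2) by (simp add: pos_le_divide_eq mult.commute)
    then have "K * norm (y - x) \<le> e" by (simp add: algebra_simps) (smt (verit) norm_ge_zero)
    have "norm (dirder f vs y - dirder f vs x - dirder f ((y - x) # vs) x)
        \<le> K * norm (y - x) * norm (y - x) * prod_list (map norm vs)"
      using y n by (intro r(4)) (auto simp: dist_norm norm_minus_commute)
    also have "\<dots> \<le> e * norm (y - x) * prod_list (map norm vs)"
      using \<open>K * norm (y - x) \<le> e\<close> P by (intro mult_right_mono) auto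
    finally show "norm (dirder f vs y - dirder f vs x - dirder f ((y - x) # vs) x) \<le> e * norm (y - x) * prod_list (map norm vs)" .
  qed (use r e in auto)
qed

subsection \<open>The inverse function theorem\<close>

text \<open>The Taylor remainder on a ball of radius r contributes \<open>K * r\<close> to the
  constant, and the derivative of order n + 1 at \<open>x\<close> contributes
  \<open>L\<close>.\<close>

lemma dirder_lipschitz:
  assumes f: "csmooth S f" and x: "x \<in> S"
  obtains r K where "r > 0" "K \<ge> 0" "ball x r \<subseteq> S"
    "\<And>y vs. y \<in> ball x r \<Longrightarrow> length vs = n \<Longrightarrow>
      norm (dirder f vs y - dirder f vs x) \<le> K * norm (y - x) * prod_list (map norm vs)"
proof -
  obtain r K where r: "r > 0" "K \<ge> 0" "ball x r \<subseteq> S"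
    "\<And>y vs. y \<in> ball x r \<Longrightarrow> length vs = n \<Longrightarrow>
      norm (dirder f vs y - dirder f vs x - dirder f ((y - x) # vs) x)
        \<le> K * norm (y - x) * norm (y - x) * prod_list (map norm vs)"
    using dirder_expansion[OF f x] by metis
  obtain r' L where "r' > 0" "L \<ge> 0"
    "\<And>y vs. y \<in> ball x r' \<Longrightarrow> length vs = Suc n \<Longrightarrow> norm (dirder f vs y) \<le> L * prod_list (map norm vs)"
    using dirder_locally_bounded[OF f x] by metis
  then have L: "norm (dirder f vs x) \<le> L * prod_list (map norm vs)" "L \<ge> 0" if "length vs = Suc n" for vs
    using that by auto
  show thesis
  proof (rule that[of r "K * r + L"])
    fix y and vs :: "'a list" assume y: "y \<in> ball x r" and n: "length vs = n"
    define P where "P = prod_list (map norm vs)"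
    have P: "P \<ge> 0" unfolding P_def by (induction vs) auto
    have "norm (dirder f vs y - dirder f vs x) \<le>
        norm (dirder f vs y - dirder f vs x - dirder f ((y - x) # vs) x) + norm (dirder f ((y - x) # vs) x)"
      using norm_triangle_ineq[of "dirder f vs y - dirder f vs x - dirder f ((y - x) # vs) x" "dirder f ((y - x) # vs) x"]
      by simp
    also have "\<dots> \<le> K * norm (y - x) * norm (y - x) * P + L * (norm (y - x) * P)"
      using r(4)[OF y n] L(1)[of "(y - x) # vs"] n by (simp add: P_def)
    also have "K * norm (y - x) * norm (y - x) * P \<le> K * r * norm (y - x) * P"
      using y r P by (intro mult_right_mono mult_left_mono) (auto simp: dist_norm norm_minus_commute)
    finally show "norm (dirder f vs y - dirder f vs x) \<le> (K * r + L) * norm (y - x) * prod_list (map norm vs)"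
      by (simp add: P_def algebra_simps)
  qed (use r L(2)[of "replicate (Suc n) undefined"] in auto)
qed

lemma csmooth_derivative_near:
  assumes f: "csmooth S f" and x: "x \<in> S" and e: "e > 0"
  obtains d where "d > 0" "ball x d \<subseteq> S"
    "\<And>y v. y \<in> ball x d \<Longrightarrow> norm (fder f y v - fder f x v) \<le> e * norm v"
proof -
  obtain r K where r: "r > 0" "K \<ge> 0" "ball x r \<subseteq> S"
    "\<And>y vs. y \<in> ball x r \<Longrightarrow> length vs = Suc 0 \<Longrightarrow>
      norm (dirder f vs y - dirder f vs x) \<le> K * norm (y - x) * prod_list (map norm vs)"
    using dirder_lipschitz[OF f x] by metis
  show thesis
  proof (rule that[of "min r (e / (K + 1))"])
    fix y v assume y: "y \<in> ball x (min r (e / (K + 1)))"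
    then have "norm (y - x) \<le> e / (K + 1)" by (simp add: dist_norm norm_minus_commute)
    then have "(K + 1) * norm (y - x) \<le> e" using r(2) by (simp add: pos_le_divide_eq mult.commute)
    then have *: "K * norm (y - x) \<le> e" by (simp add: algebra_simps) (smt (verit) norm_ge_zero)
    have "norm (fder f y v - fder f x v) \<le> K * norm (y - x) * norm v"
      using r(4)[of y "[v]"] y by simp
    also have "\<dots> \<le> e * norm v" by (rule mult_right_mono[OF *]) simp
    finally show "norm (fder f y v - fder f x v) \<le> e * norm v" .
  qed (use r e in auto)
qed

text \<open>The mean value theorem on a convex ball where the derivative stays within
  \<open>e\<close> of its value at \<open>x\<close>. Both points may vary, which is what the inverse
  function theorem requires.\<close>

lemma csmooth_strict_derivative:
  assumes f: "csmooth S f" and x: "x \<in> S" and e: "e > 0"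
  obtains d where "d > 0" "ball x d \<subseteq> S"
    "\<And>y z. y \<in> ball x d \<Longrightarrow> z \<in> ball x d \<Longrightarrow> norm (f y - f z - fder f x (y - z)) \<le> e * norm (y - z)"
proof -
  obtain d where d: "d > 0" "ball x d \<subseteq> S"
    "\<And>y v. y \<in> ball x d \<Longrightarrow> norm (fder f y v - fder f x v) \<le> e * norm v"
    using csmooth_derivative_near[OF f x e] by metis
  show thesis
  proof (rule that[OF d(1,2)])
    fix y z assume yz: "y \<in> ball x d" "z \<in> ball x d"
    have "norm (f y - f z - fder f x (y - z)) \<le> norm (y - z) * e"
    proof (rule differentiable_bound_linearization[where S = "ball x d" and f' = "fder f"])
      show "z + t *\<^sub>R (y - z) \<in> ball x d" if "t \<in> {0..1}" for t
        using convexD_alt[OF convex_ball yz(2,1), of t] that by (simp add: algebra_simps)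
      show "(f has_derivative fder f w) (at w within ball x d)" if "w \<in> ball x d" for w
        using csmooth_has_derivative[OF f] that d(2) has_derivative_at_withinI by blast
      show "onorm (fder f w - fder f x) \<le> e" if "w \<in> ball x d" for w
        using d(3)[OF that] e by (intro onorm_bound) (auto simp: fun_diff_def)
    qed (use d in auto)
    then show "norm (f y - f z - fder f x (y - z)) \<le> e * norm (y - z)" by (simp add: mult.commute)
  qed
qed

text \<open>\<open>A\<close> is bounded below by 1 / M, and the perturbation uses up at most half of
  that, so it can be absorbed on the left.\<close>

lemma perturbed_injective:
  fixes A f :: "'a::real_normed_vector \<Rightarrow> 'b::real_normed_vector"
  assumes "\<And>v. B (A v) = v" "\<And>v. norm (B v) \<le> M * norm v" "M > 0" "c * M \<le> 1/2"
    and "norm (f x - f y - A (x - y)) \<le> c * norm (x - y)"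
  shows "norm (x - y) \<le> 2 * M * norm (f x - f y)"
proof -
  have "norm (x - y) \<le> M * norm (A (x - y))" using assms(1)[of "x - y"] assms(2)[of "A (x - y)"] by simp
  also have "\<dots> \<le> M * (norm (f x - f y) + c * norm (x - y))"
    using assms(3,5) norm_triangle_sub[of "A (x - y)" "f x - f y"]
    by (intro mult_left_mono) (auto simp: norm_minus_commute)
  also have "\<dots> = M * norm (f x - f y) + (c * M) * norm (x - y)" by (simp add: algebra_simps)
  also have "\<dots> \<le> M * norm (f x - f y) + 1/2 * norm (x - y)"
    using assms(4) by (intro add_left_mono mult_right_mono) auto
  finally show ?thesis by simp
qed

lemma perturbed_surjective:
  fixes f :: "'a::banach \<Rightarrow> 'b::real_normed_vector"
  assumes B: "bounded_linear B" "\<And>v. B (A v) = v" "\<And>v. A (B v) = v" "\<And>v. norm (B v) \<le> M * norm v"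
    and M: "M > 0" "c * M \<le> 1/2" "c \<ge> 0" and A: "linear A"
    and f: "\<And>x y. x \<in> cball x0 r \<Longrightarrow> y \<in> cball x0 r \<Longrightarrow> norm (f x - f y - A (x - y)) \<le> c * norm (x - y)"
    and r: "r > 0" and y: "norm (y - f x0) \<le> r / (2 * M)"
  shows "\<exists>x\<in>cball x0 r. f x = y"
proof -
  interpret B: bounded_linear B by fact
  interpret A: linear A by fact
  define \<phi> where "\<phi> x = x - B (f x - y)" for x
  have lip: "norm (\<phi> x - \<phi> z) \<le> 1/2 * norm (x - z)" if "x \<in> cball x0 r" "z \<in> cball x0 r" for x z
  proof -
    have "\<phi> x - \<phi> z = - B (f x - f z - A (x - z))"
      by (simp add: \<phi>_def B.diff B(2) A.diff)
    then have "norm (\<phi> x - \<phi> z) \<le> M * norm (f x - f z - A (x - z))" using B(4) by simp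
    also have "\<dots> \<le> M * (c * norm (x - z))" using f[OF that] M by (intro mult_left_mono) auto
    also have "\<dots> = (c * M) * norm (x - z)" by simp
    also have "\<dots> \<le> 1/2 * norm (x - z)" using M by (intro mult_right_mono) auto
    finally show ?thesis .
  qed
  have "\<exists>!x\<in>cball x0 r. \<phi> x = x"
  proof (rule Banach_fix[where c = "1/2"])
    show "complete (cball x0 r)" by (simp add: complete_eq_closed)
    show "\<phi> ` cball x0 r \<subseteq> cball x0 r"
    proof (rule image_subsetI)
      fix x assume x: "x \<in> cball x0 r"
      have "norm (\<phi> x0 - x0) \<le> M * norm (y - f x0)"
        using B(4)[of "f x0 - y"] by (simp add: \<phi>_def norm_minus_commute)
      also have "\<dots> \<le> M * (r / (2 * M))" using M y by (intro mult_left_mono) auto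
      finally have "norm (\<phi> x0 - x0) \<le> r / 2" using M by simp
      moreover have "norm (\<phi> x - \<phi> x0) \<le> 1/2 * r"
        using lip[OF x, of x0] x r by (auto simp: dist_norm norm_minus_commute)
      ultimately have "norm (\<phi> x - x0) \<le> r"
        using norm_triangle_ineq[of "\<phi> x - \<phi> x0" "\<phi> x0 - x0"] by simp
      then show "\<phi> x \<in> cball x0 r" by (simp add: dist_norm norm_minus_commute)
    qed
  qed (use r lip in \<open>auto simp: dist_norm\<close>)
  then obtain x where x: "x \<in> cball x0 r" "\<phi> x = x" by blast
  then have "B (f x - y) = 0" by (simp add: \<phi>_def)
  then have "f x - y = 0" using B(3)[of "f x - y"] by (simp add: A.zero)
  with x show ?thesis by auto
qed

text \<open>The two preceding estimates, applied to \<open>L\<close> itself as a perturbation of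
  \<open>A\<close>, give existence, uniqueness and boundedness of the inverse.\<close>

lemma perturbed_invertible:
  fixes L :: "'a::banach \<Rightarrow> 'b::real_normed_vector"
  assumes L: "bounded_linear L"
    and B: "bounded_linear B" "\<And>v. B (A v) = v" "\<And>v. A (B v) = v" "\<And>v. norm (B v) \<le> M * norm v"
    and M: "M > 0" "c * M \<le> 1/2" "c \<ge> 0" and A: "linear A"
    and c: "\<And>v. norm (L v - A v) \<le> c * norm v"
  shows "\<exists>B'. bounded_linear B' \<and> (\<forall>v. B' (L v) = v) \<and> (\<forall>v. L (B' v) = v)"
proof -
  interpret L: bounded_linear L by fact
  interpret A: linear A by fact
  have low: "norm (x - y) \<le> 2 * M * norm (L x - L y)" for x y
    using perturbed_injective[OF B(2,4) M(1,2), of L x y] c[of "x - y"] by (simp add: L.diff)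
  have inj: "x = y" if "L x = L y" for x y using low[of x y] that by simp
  have sur: "\<exists>x. L x = y" for y
  proof -
    \<comment> \<open>For linear maps the estimates hold on every ball, so the radius can follow
      \<open>y\<close>; the summand 1 keeps it positive.\<close>
    have "\<exists>x\<in>cball 0 (2 * M * norm y + 1). L x = y"
    proof (rule perturbed_surjective[OF B M A])
      show "norm (L x - L y - A (x - y)) \<le> c * norm (x - y)" for x y
        using c[of "x - y"] by (simp add: L.diff)
      show "norm (y - L 0) \<le> (2 * M * norm y + 1) / (2 * M)"
        using M by (simp add: L.zero field_simps)
    qed (use M in \<open>auto simp: add_nonneg_pos\<close>)
    then show ?thesis by blast
  qed
  then obtain B' where B': "\<And>y. L (B' y) = y" by metis
  have B'L: "B' (L x) = x" for x by (rule inj) (simp add: B')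
  have "bounded_linear B'"
  proof (rule bounded_linear_intro[of _ "2 * M"])
    show "B' (x + y) = B' x + B' y" for x y by (rule inj) (simp add: B' L.add)
    show "B' (r *\<^sub>R x) = r *\<^sub>R B' x" for r x by (rule inj) (simp add: B' L.scaleR)
    show "norm (B' x) \<le> norm x * (2 * M)" for x
      using low[of "B' x" 0] by (simp add: B' L.zero mult.commute)
  qed
  with B' B'L show ?thesis by blast
qed

text \<open>If \<open>g\<close> inverts \<open>f\<close>, then the tangent map of \<open>g\<close> inverts the tangent map of \<open>f\<close>, so
  every hypothesis is inherited by the pair of tangent maps.\<close>

lemma ndiff_inverse:
  fixes f g :: "'a::real_normed_vector seqs \<Rightarrow> 'a seqs"
  assumes "open S" "open T" "\<And>k. ndiff k S f"
    and "\<And>x. x \<in> S \<Longrightarrow> f x \<in> T \<and> g (f x) = x" "\<And>y. y \<in> T \<Longrightarrow> g y \<in> S \<and> f (g y) = y"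
    and "\<And>x. x \<in> S \<Longrightarrow> \<exists>B. bounded_linear B \<and> (\<forall>v. B (fder f x v) = v) \<and> (\<forall>v. fder f x (B v) = v)"
    and "continuous_on T g"
  shows "ndiff k T g"
  using assms
proof (induction k arbitrary: S T f g)
  case (Suc k)
  note S = Suc.prems(1) and T = Suc.prems(2) and f = Suc.prems(3)
    and fS = Suc.prems(4) and gT = Suc.prems(5) and inv = Suc.prems(6) and cg = Suc.prems(7)
  obtain Bi where Bi: "\<And>x. x \<in> S \<Longrightarrow> bounded_linear (Bi x)"
    "\<And>x v. x \<in> S \<Longrightarrow> Bi x (fder f x v) = v" "\<And>x v. x \<in> S \<Longrightarrow> fder f x (Bi x v) = v"
    using inv by metis
  have lf: "bounded_linear (fder f x)" if "x \<in> S" for x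
    using ndiff_SucD(1)[OF f that] by (rule has_derivative_bounded_linear)
  \<comment> \<open>Reading \<open>f\<close> off entry 0 regards it as a map on a plain normed
    space, which makes the quantitative lemmas available.\<close>
  have cf: "csmooth S f"
    using S ndiff_comp_linear[OF S bounded_linear_coord f] by (auto simp: csmooth_def kdiff_def)
  have dg: "(g has_derivative Bi (g y)) (at y)" if y: "y \<in> T" for y
  proof (rule has_derivative_inverse_basic[OF ndiff_SucD(1)[OF f] Bi(1) _ _ T y])
    show "Bi (g y) \<circ> fder f (g y) = id" using Bi(2) gT[OF y] by auto
    show "continuous (at y) g" using cg T y by (simp add: continuous_on_eq_continuous_at)
  qed (use gT y in auto)
  define Tf where "Tf z = fder f (ev z) (od z)" for z
  define Tg where "Tg z = Bi (g (ev z)) (od z)" for z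
  define F where "F z = join (f (ev z)) (Tf z)" for z
  define G where "G z = join (g (ev z)) (Tg z)" for z
  have ndTf: "ndiff k (tdom S) Tf" for k unfolding Tf_def by (rule ndiff_SucD(2)[OF f])
  have ndF: "ndiff k (tdom S) F" for k unfolding F_def
    by (intro ndiff_join ndTf open_tdom S ndiff_comp_linear[OF S bounded_linear_ev f])
  have "ndiff k (tdom T) G"
  proof (rule Suc.IH[OF open_tdom[OF S] open_tdom[OF T] ndF])
    show "F z \<in> tdom T \<and> G (F z) = z" if "z \<in> tdom S" for z
      using that fS Bi by (simp add: F_def G_def Tf_def Tg_def)
    show "G z \<in> tdom S \<and> F (G z) = z" if "z \<in> tdom T" for z
      using that gT Bi by (simp add: F_def G_def Tf_def Tg_def)
    show "\<exists>B. bounded_linear B \<and> (\<forall>v. B (fder F z v) = v) \<and> (\<forall>v. fder F z (B v) = v)" if z: "z \<in> tdom S" for z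
    proof -
      let ?x = "ev z"
      have x: "?x \<in> S" using z by simp
      let ?D = "fder Tf z"
      have D: "(Tf has_derivative ?D) (at z)" by (rule ndiff_SucD(1)[OF ndTf z])
      interpret D: bounded_linear ?D using D by (rule has_derivative_bounded_linear)
      interpret B: bounded_linear "Bi ?x" by (rule Bi(1)[OF x])
      interpret A: bounded_linear "fder f ?x" by (rule lf[OF x])
      have j0: "join a b = join a 0 + join 0 b" for a b :: "'a seqs" by (auto intro!: bcontfun_eqI)
      \<comment> \<open>\<open>Tf\<close> is linear in the direction, so its partial derivative in
        the direction is the derivative of \<open>f\<close> itself.\<close>
      have D0: "?D (join 0 b) = fder f ?x b" for b
      proof -
        have bj: "bounded_linear (\<lambda>b::'a seqs. join 0 b)"
          by (intro bounded_linear_join bounded_linear_zero bounded_linear_ident)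
        have "((\<lambda>b. join ?x 0 + join 0 b) has_derivative (\<lambda>h. 0 + join 0 h)) (at (od z))"
          by (intro has_derivative_add has_derivative_const bounded_linear_imp_has_derivative bj)
        then have "((\<lambda>b. join ?x b) has_derivative (\<lambda>h. join 0 h)) (at (od z))"
          by (simp add: j0[symmetric])
        from diff_chain_at[OF this, of Tf ?D] D
        have "((\<lambda>b. fder f ?x b) has_derivative (\<lambda>h. ?D (join 0 h))) (at (od z))"
          by (simp add: o_def Tf_def)
        moreover have "(fder f ?x has_derivative fder f ?x) (at (od z))"
          by (rule bounded_linear_imp_has_derivative[OF lf[OF x]])
        ultimately have "(\<lambda>h. ?D (join 0 h)) = fder f ?x" by (rule has_derivative_unique)
        then show ?thesis by (rule fun_cong)
      qed
      have "((\<lambda>z. f (ev z)) has_derivative (\<lambda>h. fder f ?x (ev h))) (at z)"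
        using diff_chain_at[OF bounded_linear_imp_has_derivative[OF bounded_linear_ev] ndiff_SucD(1)[OF f x]]
        by (simp add: o_def)
      from bounded_linear.has_derivative[OF bounded_linear_join_pair has_derivative_Pair[OF this D]]
      have "(F has_derivative (\<lambda>h. join (fder f ?x (ev h)) (?D h))) (at z)"
        by (simp add: F_def[abs_def])
      then have dF: "fder F z = (\<lambda>h. join (fder f ?x (ev h)) (?D h))"
        by (rule frechet_derivative_at[symmetric])
      \<comment> \<open>The derivative of \<open>F\<close> is block triangular with
        \<open>fder f ?x\<close> in both diagonal blocks; \<open>B\<close> solves it by back
        substitution.\<close>
      define B where "B q = join (Bi ?x (ev q)) (Bi ?x (od q - ?D (join (Bi ?x (ev q)) 0)))" for q
      have "bounded_linear B" unfolding B_def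
        by (intro bounded_linear_join bounded_linear_compose[OF Bi(1)[OF x]] bounded_linear_sub
            bounded_linear_compose[OF D.bounded_linear_axioms] bounded_linear_ev bounded_linear_od bounded_linear_zero)
      moreover have "B (fder F z h) = h" for h
      proof -
        have "?D h - ?D (join (ev h) 0) = ?D (join 0 (od h))"
          using D.add[of "join (ev h) 0" "join 0 (od h)"] by (simp add: j0[symmetric])
        then show ?thesis by (simp add: B_def dF Bi(2)[OF x] D0)
      qed
      moreover have "fder F z (B q) = q" for q
      proof -
        let ?a = "Bi ?x (ev q)"
        have "?D (B q) = ?D (join ?a 0) + ?D (join 0 (Bi ?x (od q - ?D (join ?a 0))))"
          unfolding B_def by (subst j0) (rule D.add)
        then show ?thesis by (simp add: dF D0 Bi(3)[OF x]) (simp add: B_def Bi(3)[OF x])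
      qed
      ultimately show ?thesis by blast
    qed
    show "continuous_on (tdom T) G"
    proof -
      have cge: "continuous_on (tdom T) (\<lambda>z. g (ev z))"
        by (rule continuous_on_compose2[OF cg linear_continuous_on[OF bounded_linear_ev]]) auto
      \<comment> \<open>Continuity of the inverse derivatives: the derivatives at nearby points
        share the lower bound 1 / (2 M), so the error of \<open>Tg\<close> is controlled by how far
        \<open>?w0\<close> is from solving the nearby linear equation.\<close>
      have "continuous_on (tdom T) Tg"
        unfolding continuous_on_def
      proof
        fix z0 assume z0: "z0 \<in> tdom T"
        let ?F = "at z0 within tdom T"
        define x0 where "x0 = g (ev z0)"
        have x0: "x0 \<in> S" using gT z0 by (auto simp: x0_def)
        let ?w0 = "Tg z0"
        obtain M where M: "M > 0" "\<And>v. norm (Bi x0 v) \<le> norm v * M"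
          using bounded_linear.pos_bounded[OF Bi(1)[OF x0]] by blast
        obtain d where d: "d > 0" "ball x0 d \<subseteq> S"
          "\<And>y v. y \<in> ball x0 d \<Longrightarrow> norm (fder f y v - fder f x0 v) \<le> (1 / (2 * M)) * norm v"
          using csmooth_derivative_near[OF cf x0, of "1 / (2 * M)"] M by auto
        have lim: "((\<lambda>z. g (ev z)) \<longlongrightarrow> x0) ?F" using cge z0 by (simp add: continuous_on_def x0_def)
        have lod: "(od \<longlongrightarrow> od z0) ?F"
          using linear_continuous_on[OF bounded_linear_od, of "tdom T"] z0 by (simp add: continuous_on_def)
        have "continuous_on S (\<lambda>x. fder f x ?w0)"
          by (rule csmooth_continuous_on[OF csmooth_derivative_direction[OF cf]])
        then have cw: "((\<lambda>x. fder f x ?w0) \<longlongrightarrow> fder f x0 ?w0) (at x0)"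
          using x0 S by (simp add: continuous_on_eq_continuous_at continuous_at)
        have "((\<lambda>z. fder f (g (ev z)) ?w0) \<longlongrightarrow> fder f x0 ?w0) ?F"
          by (rule isCont_tendsto_compose[OF _ lim]) (use cw in \<open>simp add: continuous_at\<close>)
        from tendsto_diff[OF lod this]
        have "((\<lambda>z. od z - fder f (g (ev z)) ?w0) \<longlongrightarrow> 0) ?F"
          by (simp add: Tg_def x0_def Bi(3)[OF x0[unfolded x0_def]])
        then have z: "((\<lambda>z. norm (od z - fder f (g (ev z)) ?w0) * (2 * M)) \<longlongrightarrow> 0) ?F"
          using tendsto_mult_left_zero tendsto_norm_zero by blast
        have "\<forall>\<^sub>F z in ?F. z \<in> tdom T" by (simp add: eventually_at_filter)
        moreover have "\<forall>\<^sub>F z in ?F. g (ev z) \<in> ball x0 d"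
          using lim d(1) tendstoD[OF lim] by (simp add: dist_commute)
        ultimately have "\<forall>\<^sub>F z in ?F. norm (Tg z - ?w0) \<le> norm (od z - fder f (g (ev z)) ?w0) * (2 * M)"
        proof eventually_elim
          case (elim z)
          let ?x = "g (ev z)"
          have x: "?x \<in> S" using gT elim by auto
          \<comment> \<open>The injectivity estimate applied to the linear map
            \<open>fder f ?x\<close>, a perturbation of \<open>fder f x0\<close>.\<close>
          have "norm (Tg z - ?w0) \<le> 2 * M * norm (fder f ?x (Tg z) - fder f ?x ?w0)"
          proof (rule perturbed_injective[where B = "Bi x0" and A = "fder f x0" and c = "1 / (2 * M)"])
            show "norm (fder f ?x (Tg z) - fder f ?x ?w0 - fder f x0 (Tg z - ?w0)) \<le> 1 / (2 * M) * norm (Tg z - ?w0)"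
              using d(3)[OF elim(2), of "Tg z - ?w0"] bounded_linear.linear[OF lf[OF x]]
              by (simp add: linear_diff less_imp_le[OF M(1)])
          qed (use M Bi(2)[OF x0] in \<open>auto simp: mult.commute\<close>)
          then show ?case using Bi(3)[OF x, of "od z"] by (simp add: Tg_def mult.commute)
        qed
        from Lim_null_comparison[OF this z] show "(Tg \<longlongrightarrow> ?w0) ?F"
          by (rule LIM_zero_cancel)
      qed
      with cge show ?thesis
        unfolding G_def
        using continuous_on_compose2[OF linear_continuous_on[OF bounded_linear_join_pair, of UNIV] continuous_on_Pair]
        by fastforce
    qed
  qed
  then have "ndiff k (tdom T) Tg"
    using ndiff_linear_comp[OF open_tdom[OF T] bounded_linear_od, of k G] by (simp add: G_def)
  then show ?case
    using ndiff_SucI[OF T dg] by (simp add: Tg_def[abs_def])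
qed simp

text \<open>Existence of a Lipschitz inverse comes from the perturbation lemmas, its smoothness from
  \<open>ndiff_inverse\<close>. The latter works on one space of sequences, hence the common type of
  source and target.\<close>

theorem csmooth_inverse:
  fixes f :: "'a::banach \<Rightarrow> 'a"
  assumes f: "csmooth S f" and x0: "x0 \<in> S"
    and B: "bounded_linear B" "\<And>v. B (fder f x0 v) = v" "\<And>v. fder f x0 (B v) = v"
  obtains V where "open V" "x0 \<in> V" "V \<subseteq> S" "open (f ` V)" "inj_on f V" "csmooth (f ` V) (inv_into V f)"
proof -
  let ?A = "fder f x0"
  have lf: "bounded_linear (fder f x)" if "x \<in> S" for x
    using csmooth_has_derivative[OF f that] by (rule has_derivative_bounded_linear)
  have A: "linear ?A" using lf[OF x0] by (rule bounded_linear.linear)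
  obtain M where M: "M > 0" "\<And>v. norm (B v) \<le> M * norm v"
    using bounded_linear.pos_bounded[OF B(1)] by (metis mult.commute)
  \<comment> \<open>The largest perturbation that the condition \<open>c * M \<le> 1/2\<close> of
    the perturbation lemmas admits.\<close>
  define c where "c = 1 / (2 * M)"
  have c: "c > 0" "c * M \<le> 1/2" "c \<ge> 0" using M by (auto simp: c_def)
  obtain d1 where d1: "d1 > 0" "ball x0 d1 \<subseteq> S"
    "\<And>y v. y \<in> ball x0 d1 \<Longrightarrow> norm (fder f y v - ?A v) \<le> c * norm v"
    using csmooth_derivative_near[OF f x0 c(1)] by metis
  obtain d2 where d2: "d2 > 0" "ball x0 d2 \<subseteq> S"
    "\<And>y z. y \<in> ball x0 d2 \<Longrightarrow> z \<in> ball x0 d2 \<Longrightarrow> norm (f y - f z - ?A (y - z)) \<le> c * norm (y - z)"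
    using csmooth_strict_derivative[OF f x0 c(1)] by metis
  define r where "r = min d1 d2 / 2"
  have r: "r > 0" "cball x0 r \<subseteq> ball x0 d1" "cball x0 r \<subseteq> ball x0 d2" using d1 d2 by (auto simp: r_def)
  have st: "norm (f y - f z - ?A (y - z)) \<le> c * norm (y - z)" if "y \<in> cball x0 r" "z \<in> cball x0 r" for y z
    using that r(3) by (intro d2(3)) blast+
  have low: "norm (y - z) \<le> 2 * M * norm (f y - f z)" if "y \<in> cball x0 r" "z \<in> cball x0 r" for y z
    by (rule perturbed_injective[OF B(2) M(2,1) c(2) st[OF that]])
  define T where "T = ball (f x0) (r / (2 * M))"
  \<comment> \<open>Cutting the open ball down to the preimage of \<open>T\<close> makes the image
    of \<open>V\<close> exactly \<open>T\<close>.\<close>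
  define V where "V = {x \<in> ball x0 r. f x \<in> T}"
  have Vb: "V \<subseteq> cball x0 r" by (auto simp: V_def)
  have VS: "V \<subseteq> S" using Vb r d1 by blast
  have cf: "continuous_on (ball x0 r) f"
    by (rule continuous_on_subset[OF csmooth_continuous_on[OF f]]) (use r(2) d1(2) ball_subset_cball in blast)
  have oV: "open V"
    unfolding V_def using continuous_open_preimage[OF cf open_ball, of T]
    by (simp add: T_def Int_def vimage_def)
  have x0V: "x0 \<in> V" using r M by (simp add: V_def T_def)
  have inj: "inj_on f V" using low Vb by (fastforce simp: inj_on_def)
  have fV: "f ` V = T"
  proof
    show "T \<subseteq> f ` V"
    proof
      fix y assume y: "y \<in> T"
      then have y': "norm (y - f x0) < r / (2 * M)" by (simp add: T_def dist_norm norm_minus_commute)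
      obtain x where x: "x \<in> cball x0 r" "f x = y"
        using perturbed_surjective[OF B M(2,1) c(2,3) A st r(1) less_imp_le[OF y']] by blast
      \<comment> \<open>The solution found in the closed ball lies in the open one, since the bound
        on \<open>y\<close> is strict.\<close>
      have "norm (x - x0) \<le> 2 * M * norm (y - f x0)" using low[OF x(1), of x0] x r by simp
      also have "\<dots> < r" using y' M by (simp add: field_simps)
      finally show "y \<in> f ` V" using x y by (auto simp: V_def dist_norm norm_minus_commute)
    qed
  qed (auto simp: V_def)
  define g where "g = inv_into V f"
  have g: "g y \<in> V" "f (g y) = y" if "y \<in> T" for y
    using that fV unfolding g_def by (auto intro: inv_into_into f_inv_into_f)
  have gf: "g (f x) = x" if "x \<in> V" for x unfolding g_def by (rule inv_into_f_f[OF inj that])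
  have cg: "continuous_on T g"
  proof -
    have "(2 * M)-lipschitz_on T g"
    proof (rule lipschitz_onI)
      fix y z assume yz: "y \<in> T" "z \<in> T"
      then have "g y \<in> cball x0 r" "g z \<in> cball x0 r" using g(1) Vb by blast+
      from low[OF this] show "dist (g y) (g z) \<le> 2 * M * dist y z" using yz by (simp add: g(2) dist_norm)
    qed (use M in simp)
    then show ?thesis by (rule lipschitz_on_continuous_on)
  qed
  \<comment> \<open>\<open>f\<close> acts on entry 0 and the identity on all others, so
    \<open>F\<close> is invertible on sequences although \<open>f\<close> concerns a single
    entry.\<close>
  define F where "F z = emb (f (apply_bcontfun z 0)) + (z - emb (apply_bcontfun z 0))" for z :: "'a seqs"
  define G where "G z = emb (g (apply_bcontfun z 0)) + (z - emb (apply_bcontfun z 0))" for z :: "'a seqs"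
  have kf: "kdiff k V f" for k by (rule kdiff_subset[OF csmooth_kdiff[OF f] VS])
  have lin: "bounded_linear (\<lambda>z::'a seqs. z - emb (apply_bcontfun z 0))"
    by (intro bounded_linear_sub bounded_linear_ident bounded_linear_compose[OF bounded_linear_emb] bounded_linear_coord)
  have ndF: "ndiff k (zdom V) F" for k
    unfolding F_def
    by (intro ndiff_add ndiff_linear_comp[OF _ bounded_linear_emb] ndiff_linear lin open_coord oV
        kf[unfolded kdiff_def])
  have oT: "open T" by (simp add: T_def)
  have ndG: "ndiff k (zdom T) G" for k
  proof (rule ndiff_inverse[OF open_coord[OF oV] open_coord[OF oT] ndF])
    show "F z \<in> zdom T \<and> G (F z) = z" if "z \<in> zdom V" for z
      using that by (auto simp: F_def G_def gf V_def intro!: bcontfun_eqI)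
    show "G z \<in> zdom V \<and> F (G z) = z" if "z \<in> zdom T" for z
      using that g by (auto simp: F_def G_def intro!: bcontfun_eqI)
    show "continuous_on (zdom T) G"
      unfolding G_def
      by (intro continuous_on_add linear_continuous_on lin
          continuous_on_compose2[OF linear_continuous_on[OF bounded_linear_emb, of UNIV]]
          continuous_on_compose2[OF cg linear_continuous_on[OF bounded_linear_coord]]) auto
    show "\<exists>B. bounded_linear B \<and> (\<forall>v. B (fder F z v) = v) \<and> (\<forall>v. fder F z (B v) = v)" if z: "z \<in> zdom V" for z
    proof -
      let ?x = "apply_bcontfun z 0"
      have x: "?x \<in> S" "?x \<in> cball x0 r" using z VS Vb by auto
      obtain B' where B': "bounded_linear B'" "\<And>v. B' (fder f ?x v) = v" "\<And>v. fder f ?x (B' v) = v"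
        using perturbed_invertible[OF lf[OF x(1)] B M(2,1) c(2,3) A] d1(3)[of ?x] r(2) x(2) by blast
      have "((\<lambda>z. f (apply_bcontfun z 0)) has_derivative (\<lambda>h. fder f ?x (apply_bcontfun h 0))) (at z)"
        using diff_chain_at[OF bounded_linear_imp_has_derivative[OF bounded_linear_coord] csmooth_has_derivative[OF f x(1)]]
        by (simp add: o_def)
      from has_derivative_add[OF bounded_linear.has_derivative[OF bounded_linear_emb this] bounded_linear_imp_has_derivative[OF lin]]
      have "(F has_derivative (\<lambda>h. emb (fder f ?x (apply_bcontfun h 0)) + (h - emb (apply_bcontfun h 0)))) (at z)"
        by (simp add: F_def[abs_def])
      then have dF: "fder F z = (\<lambda>h. emb (fder f ?x (apply_bcontfun h 0)) + (h - emb (apply_bcontfun h 0)))"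
        by (rule frechet_derivative_at[symmetric])
      show ?thesis
      proof (intro exI[of _ "\<lambda>h. emb (B' (apply_bcontfun h 0)) + (h - emb (apply_bcontfun h 0))"] conjI allI)
        show "bounded_linear (\<lambda>h. emb (B' (apply_bcontfun h 0)) + (h - emb (apply_bcontfun h 0)))"
          by (intro bounded_linear_add lin bounded_linear_compose[OF bounded_linear_emb]
              bounded_linear_compose[OF B'(1)] bounded_linear_coord)
      qed (auto simp: dF B' intro!: bcontfun_eqI)
    qed
  qed
  have "kdiff k T g" for k
    using ndiff_linear_comp[OF open_coord[OF oT] bounded_linear_coord[of 0] ndG] by (simp add: kdiff_def G_def)
  then have "csmooth T g" using oT by (simp add: csmooth_def)
  then show thesis
    using that[OF oV x0V VS] inj by (simp add: fV oT g_def)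
qed

subsection \<open>Superposition operators on path spaces\<close>

definition clip :: "real \<Rightarrow> real" where
  "clip t = max (-1) (min 1 t)"

lemma clip_in: "clip t \<in> {-1..1}"
  and clip_bounds [simp]: "-1 \<le> clip t" "clip t \<le> 1"
  and clip_id: "t \<in> {-1..1} \<Longrightarrow> clip t = t"
  by (auto simp: clip_def)

lemma continuous_on_clip: "continuous_on A clip"
  unfolding clip_def by (intro continuous_intros)

text \<open>Freezing a path outside [-1, 1] makes it a bounded continuous function on the line. This
  provides the sup norm and completeness while only the values on [-1, 1] matter.\<close>

definition path_of :: "(real \<Rightarrow> 'a::real_normed_vector) \<Rightarrow> real \<Rightarrow>\<^sub>C 'a" where
  "path_of g = Bcontfun (\<lambda>t. g (clip t))"

lemma path_of_apply:
  assumes "continuous_on {-1..1} g"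
  shows "apply_bcontfun (path_of g) t = g (clip t)"
proof -
  have "compact (g ` {-1..1})" using assms by (intro compact_continuous_image) auto
  then obtain b where "\<forall>x\<in>g ` {-1..1}. norm x \<le> b" using compact_imp_bounded bounded_iff by metis
  then have b: "norm (g (clip t)) \<le> b" for t using clip_in[of t] by blast
  have c: "continuous_on UNIV (\<lambda>t. g (clip t))"
    by (rule continuous_on_compose2[OF assms continuous_on_clip]) auto
  show ?thesis unfolding path_of_def using Bcontfun_inverse[OF bcontfun_normI[OF c b]] by simp
qed

definition superpos :: "('a::real_normed_vector \<Rightarrow> 'b::real_normed_vector) \<Rightarrow> (real \<Rightarrow>\<^sub>C 'a) \<Rightarrow> real \<Rightarrow>\<^sub>C 'b" where
  "superpos f u = path_of (\<lambda>t. f (u t))"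

definition paths_in :: "'a::real_normed_vector set \<Rightarrow> (real \<Rightarrow>\<^sub>C 'a) set" where
  "paths_in S = {u. \<forall>t\<in>{-1..1}. apply_bcontfun u t \<in> S}"

lemma paths_inD: "u \<in> paths_in S \<Longrightarrow> t \<in> {-1..1} \<Longrightarrow> u t \<in> S"
  by (simp add: paths_in_def)

lemma compact_path_image: "compact (apply_bcontfun u ` {-1..1::real})"
  by (intro compact_continuous_image) auto

text \<open>The image of [-1, 1] is compact and has a uniform neighborhood inside \<open>S\<close>;
  uniformly close paths stay in it.\<close>

lemma open_paths_in:
  assumes "open S"
  shows "open (paths_in S)"
proof (rule Topological_Spaces.openI)
  fix u assume u: "u \<in> paths_in S"
  then obtain e where e: "e > 0" "(\<Union>x\<in>apply_bcontfun u ` {-1..1}. ball x e) \<subseteq> S"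
    using compact_subset_open_imp_ball_epsilon_subset[OF compact_path_image assms, of u]
    by (metis image_subsetI paths_inD)
  have "ball u e \<subseteq> paths_in S"
  proof
    fix v assume v: "v \<in> ball u e"
    have "v t \<in> S" if t: "t \<in> {-1..1}" for t
    proof -
      have "v t \<in> ball (u t) e" using dist_bounded[of u t v] v by simp
      then show ?thesis using e(2) t by blast
    qed
    then show "v \<in> paths_in S" by (simp add: paths_in_def)
  qed
  then show "\<exists>T. open T \<and> u \<in> T \<and> T \<subseteq> paths_in S"
    using e by (intro exI[of _ "ball u e"]) auto
qed

lemma continuous_on_superpos:
  assumes "continuous_on S f" "u \<in> paths_in S"
  shows "continuous_on {-1..1} (\<lambda>t. f (apply_bcontfun u t))"
  by (rule continuous_on_compose2[OF assms(1)]) (use assms(2) in \<open>auto simp: paths_in_def\<close>)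

lemma superpos_apply:
  assumes "continuous_on S f" "u \<in> paths_in S"
  shows "apply_bcontfun (superpos f u) t = f (u (clip t))"
  unfolding superpos_def by (rule path_of_apply[OF continuous_on_superpos[OF assms]])

definition superpos_deriv ::
  "('a::real_normed_vector \<Rightarrow> 'b::real_normed_vector) \<Rightarrow> (real \<Rightarrow>\<^sub>C 'a) \<Rightarrow> (real \<Rightarrow>\<^sub>C 'a) \<Rightarrow> real \<Rightarrow>\<^sub>C 'b" where
  "superpos_deriv f u h = path_of (\<lambda>t. fder f (u t) (h t))"

lemma continuous_on_superpos_deriv:
  assumes f: "csmooth S f" and u: "u \<in> paths_in S"
  shows "continuous_on {-1..1} (\<lambda>t. fder f (apply_bcontfun u t) (apply_bcontfun h t))"
proof -
  have "continuous_on {-1..1} (\<lambda>t. (\<lambda>p. fder f (fst p) (snd p)) (apply_bcontfun u t, apply_bcontfun h t))"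
    by (rule continuous_on_compose2[OF csmooth_continuous_on[OF csmooth_tangent[OF f]]])
      (use u in \<open>auto simp: paths_in_def intro!: continuous_on_Pair\<close>)
  then show ?thesis by simp
qed

lemma superpos_deriv_apply:
  assumes "csmooth S f" "u \<in> paths_in S"
  shows "apply_bcontfun (superpos_deriv f u h) t = fder f (u (clip t)) (h (clip t))"
  unfolding superpos_deriv_def by (rule path_of_apply[OF continuous_on_superpos_deriv[OF assms]])

text \<open>The tangent map vanishes on the compact set of zero vectors along the path, so it is
  below 1 on a tube of some radius e around it. Scaling a direction to length e / 2 gives the
  constant 2 / e, uniform in time.\<close>

lemma superpos_deriv_bound:
  assumes f: "csmooth S f" and u: "u \<in> paths_in S"
  obtains K where "K \<ge> 0" "\<And>t v. t \<in> {-1..1} \<Longrightarrow> norm (fder f (u t) v) \<le> K * norm v"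
proof -
  let ?T = "\<lambda>p. fder f (fst p) (snd p)"
  let ?Q = "(\<lambda>t. (apply_bcontfun u t, 0)) ` {-1..1}"
  let ?O = "(S \<times> UNIV) \<inter> ?T -` ball 0 1"
  note T = csmooth_tangent[OF f]
  have lin: "linear (fder f x)" if "x \<in> S" for x
    using csmooth_has_derivative[OF f that] has_derivative_linear by blast
  have "compact ?Q" by (intro compact_continuous_image continuous_on_Pair) auto
  moreover have "open ?O"
    by (rule continuous_open_preimage[OF csmooth_continuous_on[OF T] csmooth_open[OF T] open_ball])
  moreover have "?Q \<subseteq> ?O" using u lin by (auto simp: paths_in_def linear_0)
  ultimately obtain e where e: "e > 0" "(\<Union>x\<in>?Q. ball x e) \<subseteq> ?O"
    by (rule compact_subset_open_imp_ball_epsilon_subset)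
  show thesis
  proof (rule that[of "2 / e"])
    fix t :: real and v assume t: "t \<in> {-1..1}"
    show "norm (fder f (u t) v) \<le> 2 / e * norm v"
    proof (cases "v = 0")
      case True
      then show ?thesis using lin[OF paths_inD[OF u t]] by (simp add: linear_0)
    next
      case False
      let ?w = "(e / (2 * norm v)) *\<^sub>R v"
      have "(u t, ?w) \<in> ball (u t, 0) e" using e False by (simp add: dist_Pair_Pair)
      then have "(u t, ?w) \<in> ?O" using e(2) t by blast
      then have "norm (fder f (u t) ?w) < 1" by simp
      then have "e / (2 * norm v) * norm (fder f (u t) v) < 1"
        using lin[OF paths_inD[OF u t]] e by (simp add: linear_scale)
      then show ?thesis using e False by (simp add: field_simps)
    qed
  qed (use e in simp)
qed

text \<open>Along the compact image of a path differentiability is uniform: each point has a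
  neighborhood where the increment estimate holds for every pair of points, and a Lebesgue number of
  this cover serves all times at once.\<close>

lemma superpos_has_derivative:
  assumes f: "csmooth S f" and u: "u \<in> paths_in S"
  shows "(superpos f has_derivative superpos_deriv f u) (at u)"
proof -
  note cf = csmooth_continuous_on[OF f]
  have lin: "linear (fder f x)" if "x \<in> S" for x
    using csmooth_has_derivative[OF f that] has_derivative_linear by blast
  note lu = lin[OF paths_inD[OF u clip_in]]
  obtain K where K: "K \<ge> 0" "\<And>t v. t \<in> {-1..1} \<Longrightarrow> norm (fder f (u t) v) \<le> K * norm v"
    using superpos_deriv_bound[OF f u] by metis
  have bl: "bounded_linear (superpos_deriv f u)"
  proof (rule bounded_linear_intro[of _ K])
    show "superpos_deriv f u (h + k) = superpos_deriv f u h + superpos_deriv f u k" for h k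
      by (rule bcontfun_eqI) (simp add: superpos_deriv_apply[OF f u] linear_add[OF lu])
    show "superpos_deriv f u (r *\<^sub>R h) = r *\<^sub>R superpos_deriv f u h" for r h
      by (rule bcontfun_eqI) (simp add: superpos_deriv_apply[OF f u] linear_scale[OF lu])
    show "norm (superpos_deriv f u h) \<le> norm h * K" for h
    proof (rule norm_bound)
      fix t
      have "norm (fder f (u (clip t)) (h (clip t))) \<le> K * norm (h (clip t))" by (rule K(2)) simp
      also have "\<dots> \<le> K * norm h" using K(1) norm_bounded by (intro mult_left_mono)
      finally show "norm (superpos_deriv f u h t) \<le> norm h * K"
        by (simp add: superpos_deriv_apply[OF f u] mult.commute)
    qed
  qed
  show ?thesis
    unfolding has_derivative_at_alt
  proof (intro conjI allI impI bl)
    fix e :: real assume e: "e > 0"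
    define \<G> where "\<G> = {G. open G \<and> G \<subseteq> S \<and>
      (\<forall>y\<in>G. \<forall>z\<in>G. norm (f y - f z - fder f z (y - z)) \<le> e * norm (y - z))}"
    have "apply_bcontfun u ` {-1..1} \<subseteq> \<Union>\<G>"
    proof (rule image_subsetI)
      fix t :: real assume t: "t \<in> {-1..1}"
      have x: "u t \<in> S" by (rule paths_inD[OF u t])
      \<comment> \<open>One half pays for strict differentiability at \<open>u t\<close>, the other
        for the change of the derivative from \<open>u t\<close> to the base point
        \<open>z\<close>.\<close>
      have e2: "e / 2 > 0" using e by simp
      obtain d1 where d1: "d1 > 0" "ball (u t) d1 \<subseteq> S"
        "\<And>y v. y \<in> ball (u t) d1 \<Longrightarrow> norm (fder f y v - fder f (u t) v) \<le> e / 2 * norm v"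
        using csmooth_derivative_near[OF f x e2] by metis
      obtain d2 where d2: "d2 > 0" "ball (u t) d2 \<subseteq> S"
        "\<And>y z. y \<in> ball (u t) d2 \<Longrightarrow> z \<in> ball (u t) d2 \<Longrightarrow> norm (f y - f z - fder f (u t) (y - z)) \<le> e / 2 * norm (y - z)"
        using csmooth_strict_derivative[OF f x e2] by metis
      have *: "norm (f y - f z - fder f z (y - z)) \<le> e * norm (y - z)"
        if "y \<in> ball (u t) (min d1 d2)" "z \<in> ball (u t) (min d1 d2)" for y z
      proof -
        have "norm (f y - f z - fder f (u t) (y - z)) \<le> e / 2 * norm (y - z)"
          using that by (intro d2(3)) simp_all
        moreover have "norm (fder f z (y - z) - fder f (u t) (y - z)) \<le> e / 2 * norm (y - z)"
          using that by (intro d1(3)) simp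
        ultimately show ?thesis
          using norm_triangle_ineq4[of "f y - f z - fder f (u t) (y - z)" "fder f z (y - z) - fder f (u t) (y - z)"]
          by simp
      qed
      have "ball (u t) (min d1 d2) \<subseteq> S" using d1(2) by auto
      then have "ball (u t) (min d1 d2) \<in> \<G>" unfolding \<G>_def using * by (intro CollectI conjI ballI open_ball)
      moreover have "u t \<in> ball (u t) (min d1 d2)" using d1 d2 by simp
      ultimately show "u t \<in> \<Union>\<G>" by blast
    qed
    moreover have "open G" if "G \<in> \<G>" for G using that by (simp add: \<G>_def)
    ultimately obtain d where d: "d > 0" "\<And>x. x \<in> apply_bcontfun u ` {-1..1} \<Longrightarrow> \<exists>G\<in>\<G>. ball x d \<subseteq> G"
      using Heine_Borel_lemma[OF compact_path_image, of u \<G>] by metis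
    obtain d' where d': "d' > 0" "ball u d' \<subseteq> paths_in S"
      using open_paths_in[OF csmooth_open[OF f]] u open_contains_ball by blast
    show "\<exists>d>0. \<forall>v. norm (v - u) < d \<longrightarrow>
        norm (superpos f v - superpos f u - superpos_deriv f u (v - u)) \<le> e * norm (v - u)"
    proof (intro exI[of _ "min d d'"] conjI allI impI)
      fix v assume v: "norm (v - u) < min d d'"
      then have vS: "v \<in> paths_in S" using d'(2) by (auto simp: dist_norm norm_minus_commute)
      show "norm (superpos f v - superpos f u - superpos_deriv f u (v - u)) \<le> e * norm (v - u)"
      proof (rule norm_bound)
        fix t
        let ?t = "clip t"
        obtain G where G: "G \<in> \<G>" "ball (u ?t) d \<subseteq> G" using d(2)[of "u ?t"] clip_in[of t] by blast
        have nb: "norm (v ?t - u ?t) \<le> norm (v - u)" using norm_bounded[of "v - u" ?t] by simp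
        have "v ?t \<in> ball (u ?t) d" using nb v by (simp add: dist_norm norm_minus_commute)
        then have "v ?t \<in> G" using G(2) by blast
        moreover have "u ?t \<in> G" using G(2) d(1) by (simp add: subset_eq)
        ultimately have "norm (f (v ?t) - f (u ?t) - fder f (u ?t) (v ?t - u ?t)) \<le> e * norm (v ?t - u ?t)"
          using G(1) unfolding \<G>_def by blast
        also have "\<dots> \<le> e * norm (v - u)" using nb e by (intro mult_left_mono) auto
        finally show "norm ((superpos f v - superpos f u - superpos_deriv f u (v - u)) t) \<le> e * norm (v - u)"
          by (simp add: superpos_apply[OF cf vS] superpos_apply[OF cf u] superpos_deriv_apply[OF f u])
      qed
    qed (use d d' in auto)
  qed
qed

section \<open>Paths with values in sequence spaces\<close>

definition path_join :: "(real \<Rightarrow>\<^sub>C 'a::real_normed_vector seqs) \<Rightarrow> (real \<Rightarrow>\<^sub>C 'a seqs) \<Rightarrow> real \<Rightarrow>\<^sub>C 'a seqs" where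
  "path_join u v = Bcontfun (\<lambda>t. join (u t) (v t))"

definition path_emb :: "(real \<Rightarrow>\<^sub>C 'a::real_normed_vector) \<Rightarrow> real \<Rightarrow>\<^sub>C 'a seqs" where
  "path_emb u = Bcontfun (\<lambda>t. emb (u t))"

lemma Bcontfun_linear_apply:
  assumes "bounded_linear L"
  shows "apply_bcontfun (Bcontfun (\<lambda>t. L (apply_bcontfun w t))) t = L (apply_bcontfun w t)"
proof -
  obtain M where M: "\<And>v. norm (L v) \<le> norm v * M" "M > 0" using bounded_linear.pos_bounded[OF assms] by blast
  have c: "continuous_on UNIV (\<lambda>t. L (apply_bcontfun w t))"
    by (rule continuous_on_compose2[OF linear_continuous_on[OF assms, of UNIV]]) auto
  have "norm (L (apply_bcontfun w t)) \<le> norm w * M" for t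
    using M(1)[of "apply_bcontfun w t"] mult_right_mono[OF norm_bounded[of w t], of M] M(2) by linarith
  from Bcontfun_inverse[OF bcontfun_normI[OF c this]] show ?thesis by simp
qed

lemma path_emb_apply [simp]: "apply_bcontfun (path_emb u) t = emb (u t)"
  unfolding path_emb_def by (rule Bcontfun_linear_apply[OF bounded_linear_emb])

lemma path_join_apply [simp]: "apply_bcontfun (path_join u v) t = join (u t) (v t)"
proof -
  have c: "continuous_on UNIV (\<lambda>t. join (apply_bcontfun u t) (apply_bcontfun v t))"
    using continuous_on_compose2[OF linear_continuous_on[OF bounded_linear_join_pair, of UNIV], of UNIV
        "\<lambda>t. (apply_bcontfun u t, apply_bcontfun v t)"]
    by (auto intro: continuous_on_Pair)
  have "norm (join (apply_bcontfun u t) (apply_bcontfun v t)) \<le> norm u + norm v" for t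
  proof (rule norm_bound)
    fix i
    have "norm (u t (i div 2)) \<le> norm u" "norm (v t (i div 2)) \<le> norm v"
      by (rule order_trans[OF norm_bounded norm_bounded])+
    then show "norm (join (apply_bcontfun u t) (apply_bcontfun v t) i) \<le> norm u + norm v"
      by (auto intro: add_increasing add_increasing2)
  qed
  from Bcontfun_inverse[OF bcontfun_normI[OF c this]] show ?thesis by (simp add: path_join_def)
qed

lemma bounded_linear_path_emb: "bounded_linear path_emb"
proof (rule bounded_linear_intro[of _ 1])
  show "path_emb (x + y) = path_emb x + path_emb y" for x y :: "real \<Rightarrow>\<^sub>C 'a"
    by (intro bcontfun_eqI) simp
  show "path_emb (r *\<^sub>R x) = r *\<^sub>R path_emb x" for r and x :: "real \<Rightarrow>\<^sub>C 'a"
    by (intro bcontfun_eqI) simp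
  show "norm (path_emb x) \<le> norm x * 1" for x :: "real \<Rightarrow>\<^sub>C 'a"
    by (intro norm_bound) (auto intro!: norm_bound norm_bounded)
qed

lemma bounded_linear_path_join:
  fixes A B :: "'x::real_normed_vector \<Rightarrow> real \<Rightarrow>\<^sub>C 'a::real_normed_vector seqs"
  assumes "bounded_linear A" "bounded_linear B"
  shows "bounded_linear (\<lambda>z. path_join (A z) (B z))"
proof -
  interpret A: bounded_linear A by fact
  interpret B: bounded_linear B by fact
  obtain M where M: "\<And>v. norm (A v) \<le> norm v * M" using A.bounded by blast
  obtain N where N: "\<And>v. norm (B v) \<le> norm v * N" using B.bounded by blast
  show ?thesis
  proof (rule bounded_linear_intro[of _ "M + N"])
    show "path_join (A (x + y)) (B (x + y)) = path_join (A x) (B x) + path_join (A y) (B y)" for x y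
      by (intro bcontfun_eqI) (simp add: A.add B.add)
    show "path_join (A (r *\<^sub>R x)) (B (r *\<^sub>R x)) = r *\<^sub>R path_join (A x) (B x)" for r x
      by (intro bcontfun_eqI) (simp add: A.scaleR B.scaleR)
    fix x
    have "norm (path_join (A x) (B x)) \<le> norm (A x) + norm (B x)"
    proof (intro norm_bound)
      fix t i
      have "norm (A x t (i div 2)) \<le> norm (A x)" "norm (B x t (i div 2)) \<le> norm (B x)"
        by (rule order_trans[OF norm_bounded norm_bounded])+
      then show "norm (path_join (A x) (B x) t i) \<le> norm (A x) + norm (B x)"
        by (auto intro: add_increasing add_increasing2)
    qed
    with M[of x] N[of x] show "norm (path_join (A x) (B x)) \<le> norm x * (M + N)"
      by (simp add: algebra_simps)
  qed
qed

lemma ndiff_csmooth: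
  assumes "open S" "\<And>k. ndiff k S f"
  shows "csmooth S f"
  using assms(1) ndiff_comp_linear[OF assms(1) bounded_linear_coord assms(2)] by (auto simp: csmooth_def kdiff_def)

text \<open>The tangent map of superposition by \<open>f\<close> is superposition by the tangent map
  of \<open>f\<close>, once a pair of paths is read as a path of pairs. The linear map
  \<open>A\<close> absorbs this rearrangement, which \<open>path_join\<close> performs.\<close>

lemma ndiff_superpos:
  fixes A :: "'x::real_normed_vector seqs \<Rightarrow> real \<Rightarrow>\<^sub>C 'a::real_normed_vector seqs"
  shows "open S \<Longrightarrow> (\<And>k. ndiff k S f) \<Longrightarrow> bounded_linear A \<Longrightarrow> ndiff k {z. A z \<in> paths_in S} (\<lambda>z. superpos f (A z))"
proof (induction k arbitrary: S f A)
  case (Suc k)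
  note S = Suc.prems(1) and f = Suc.prems(2) and A = Suc.prems(3)
  have cf: "csmooth S f" by (rule ndiff_csmooth[OF S f])
  have oA: "open {z. A z \<in> paths_in S}" by (rule open_linear_vimage[OF open_paths_in[OF S] A])
  define Tf where "Tf z = fder f (ev z) (od z)" for z
  define A' where "A' z = path_join (A (ev z)) (A (od z))" for z
  have A': "bounded_linear A'" unfolding A'_def
    by (intro bounded_linear_path_join bounded_linear_compose[OF A] bounded_linear_ev bounded_linear_od)
  have "ndiff k {z. A' z \<in> paths_in (tdom S)} (\<lambda>z. superpos Tf (A' z))"
    using ndiff_SucD(2)[OF f] by (intro Suc.IH open_tdom S A') (simp add: Tf_def[abs_def])
  moreover have "{z. A' z \<in> paths_in (tdom S)} = tdom {z. A z \<in> paths_in S}"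
    by (simp add: A'_def paths_in_def)
  moreover have "superpos Tf (A' z) = superpos_deriv f (A (ev z)) (A (od z))" for z
    by (simp add: superpos_def superpos_deriv_def Tf_def A'_def)
  ultimately have T: "ndiff k (tdom {z. A z \<in> paths_in S}) (\<lambda>z. superpos_deriv f (A (ev z)) (A (od z)))" by simp
  show ?case
  proof (rule ndiff_SucI[OF oA _ T])
    fix z assume "z \<in> {z. A z \<in> paths_in S}"
    then show "((\<lambda>z. superpos f (A z)) has_derivative (\<lambda>h. superpos_deriv f (A z) (A h))) (at z)"
      using diff_chain_at[OF bounded_linear_imp_has_derivative[OF A] superpos_has_derivative[OF cf]]
      by (simp add: o_def)
  qed
qed simp

theorem csmooth_superpos:
  assumes f: "csmooth S f"
  shows "csmooth (paths_in S) (superpos f)"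
proof -
  define F where "F z = f (apply_bcontfun z 0)" for z :: "'a seqs"
  have F: "ndiff k (zdom S) F" for k
    unfolding F_def using csmooth_kdiff[OF f] by (simp add: kdiff_def)
  have A: "bounded_linear (\<lambda>z::(real \<Rightarrow>\<^sub>C 'a) seqs. path_emb (apply_bcontfun z 0))"
    by (intro bounded_linear_compose[OF bounded_linear_path_emb] bounded_linear_coord)
  have "superpos F (path_emb u) = superpos f u" for u
    by (simp add: superpos_def F_def)
  moreover have "path_emb u \<in> paths_in (zdom S) \<longleftrightarrow> u \<in> paths_in S" for u
    by (simp add: paths_in_def)
  ultimately have "kdiff k (paths_in S) (superpos f)" for k
    using ndiff_superpos[OF open_coord[OF csmooth_open[OF f]] F A] by (simp add: kdiff_def)
  then show ?thesis using open_paths_in[OF csmooth_open[OF f]] by (simp add: csmooth_def)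
qed

subsection \<open>Smooth flows in Banach spaces\<close>

text \<open>The set where the solutions agree is closed in the interval and, by a local Lipschitz
  bound, open. Near a common point the mean value theorem halves any bound on the difference, so the
  difference is at most 2 d / 2^n for every n.\<close>

lemma ode_unique:
  fixes f :: "'a::real_normed_vector \<Rightarrow> 'a"
  assumes f: "csmooth S f" and J: "is_interval J" and t0: "t0 \<in> J" "\<gamma> t0 = \<eta> t0"
    and \<gamma>: "\<And>t. t \<in> J \<Longrightarrow> \<gamma> t \<in> S \<and> (\<gamma> has_vector_derivative f (\<gamma> t)) (at t within J)"
    and \<eta>: "\<And>t. t \<in> J \<Longrightarrow> \<eta> t \<in> S \<and> (\<eta> has_vector_derivative f (\<eta> t)) (at t within J)"
    and t: "t \<in> J"
  shows "\<gamma> t = \<eta> t"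
proof -
  define E where "E = {t \<in> J. \<gamma> t - \<eta> t = 0}"
  have cg: "continuous_on J \<gamma>" and ch: "continuous_on J \<eta>"
    using \<gamma> \<eta> has_vector_derivative_continuous continuous_on_eq_continuous_within by blast+
  have "closedin (top_of_set J) E"
    unfolding E_def using continuous_closedin_preimage_constant[OF continuous_on_diff[OF cg ch]] .
  moreover have "openin (top_of_set J) E"
    unfolding openin_euclidean_subtopology_iff
  proof (intro conjI ballI)
    show "E \<subseteq> J" by (auto simp: E_def)
    fix s assume s: "s \<in> E"
    then have sJ: "s \<in> J" and eq: "\<gamma> s = \<eta> s" by (auto simp: E_def)
    have x: "\<gamma> s \<in> S" using \<gamma> sJ by blast
    obtain d where d: "d > 0" "ball (\<gamma> s) d \<subseteq> S"
      "\<And>y z. y \<in> ball (\<gamma> s) d \<Longrightarrow> z \<in> ball (\<gamma> s) d \<Longrightarrow> norm (f y - f z - fder f (\<gamma> s) (y - z)) \<le> 1 * norm (y - z)"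
      using csmooth_strict_derivative[OF f x zero_less_one] by metis
    obtain C where C: "C > 0" "\<And>v. norm (fder f (\<gamma> s) v) \<le> norm v * C"
      using bounded_linear.pos_bounded[OF has_derivative_bounded_linear[OF csmooth_has_derivative[OF f x]]] by blast
    define L where "L = C + 1"
    have L: "L > 0" using C by (simp add: L_def)
    have lip: "norm (f y - f z) \<le> L * norm (y - z)" if "y \<in> ball (\<gamma> s) d" "z \<in> ball (\<gamma> s) d" for y z
      using d(3)[OF that] C(2)[of "y - z"] norm_triangle_sub[of "f y - f z" "fder f (\<gamma> s) (y - z)"]
      by (simp add: L_def algebra_simps)
    obtain e1 where e1: "e1 > 0" "\<And>r. r \<in> J \<Longrightarrow> dist r s < e1 \<Longrightarrow> dist (\<gamma> r) (\<gamma> s) < d"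
      using cg sJ d(1) unfolding continuous_on_iff by metis
    obtain e2 where e2: "e2 > 0" "\<And>r. r \<in> J \<Longrightarrow> dist r s < e2 \<Longrightarrow> dist (\<eta> r) (\<eta> s) < d"
      using ch sJ d(1) unfolding continuous_on_iff by metis
    \<comment> \<open>The last term yields the factor \<open>L * e \<le> 1/2\<close>; the others
      keep both solutions in the ball where \<open>L\<close> is a Lipschitz constant.\<close>
    define e where "e = min (min e1 e2) (1 / (2 * L))"
    have "L * e \<le> L * (1 / (2 * L))" unfolding e_def using L by (intro mult_left_mono) auto
    then have e: "e > 0" "e \<le> e1" "e \<le> e2" "L * e \<le> 1 / 2"
      using e1 e2 L by (auto simp: e_def)
    define I where "I = J \<inter> ball s e"
    have cI: "convex I" unfolding I_def using J by (intro convex_Int) (auto simp: is_interval_convex)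
    have sI: "s \<in> I" using sJ e by (simp add: I_def)
    have inb: "\<gamma> r \<in> ball (\<gamma> s) d" "\<eta> r \<in> ball (\<gamma> s) d" if "r \<in> I" for r
      using that e1(2)[of r] e2(2)[of r] e eq by (auto simp: I_def dist_commute)
    have "norm (\<gamma> r - \<eta> r) \<le> 2 * d * (1 / 2) ^ n" if "r \<in> I" for r n
      using that
    proof (induction n arbitrary: r)
      case 0
      have "norm (\<gamma> r - \<eta> r) \<le> dist (\<gamma> r) (\<gamma> s) + dist (\<gamma> s) (\<eta> r)" by (metis dist_norm dist_triangle)
      then show ?case using inb[OF 0] by (simp add: dist_commute)
    next
      case (Suc n)
      define B where "B = L * (2 * d * (1 / 2) ^ n)"
      have B0: "B \<ge> 0" using L d by (simp add: B_def)
      have "norm ((\<gamma> r - \<eta> r) - (\<gamma> s - \<eta> s)) \<le> B * norm (r - s)"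
      proof (rule differentiable_bound[OF cI, where f' = "\<lambda>r h. h *\<^sub>R (f (\<gamma> r) - f (\<eta> r))"])
        fix q assume q: "q \<in> I"
        then have qJ: "q \<in> J" by (simp add: I_def)
        have "((\<lambda>r. \<gamma> r - \<eta> r) has_vector_derivative f (\<gamma> q) - f (\<eta> q)) (at q within J)"
          using \<gamma>[OF qJ] \<eta>[OF qJ] by (intro has_vector_derivative_diff) auto
        then have "((\<lambda>r. \<gamma> r - \<eta> r) has_vector_derivative f (\<gamma> q) - f (\<eta> q)) (at q within I)"
          by (rule has_vector_derivative_within_subset) (auto simp: I_def)
        then show "((\<lambda>r. \<gamma> r - \<eta> r) has_derivative (\<lambda>h. h *\<^sub>R (f (\<gamma> q) - f (\<eta> q)))) (at q within I)"
          by (simp add: has_vector_derivative_def)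
        have "norm (f (\<gamma> q) - f (\<eta> q)) \<le> L * norm (\<gamma> q - \<eta> q)" by (rule lip[OF inb[OF q]])
        also have "\<dots> \<le> B" unfolding B_def using Suc.IH[OF q] L by (intro mult_left_mono) auto
        finally have "norm (f (\<gamma> q) - f (\<eta> q)) \<le> B" .
        then show "onorm (\<lambda>h. h *\<^sub>R (f (\<gamma> q) - f (\<eta> q))) \<le> B"
          using B0 by (intro onorm_bound) (auto simp: mult.commute[of B] intro: mult_left_mono)
      qed (use Suc.prems sI in auto)
      also have "\<dots> \<le> B * e"
        using Suc.prems B0 by (intro mult_left_mono) (auto simp: I_def dist_norm norm_minus_commute)
      also have "\<dots> = (L * e) * (2 * d * (1 / 2) ^ n)" by (simp add: B_def)
      also have "\<dots> \<le> 1 / 2 * (2 * d * (1 / 2) ^ n)" using e(4) d(1) by (intro mult_right_mono) auto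
      finally show ?case using eq by simp
    qed
    then have "norm (\<gamma> r - \<eta> r) \<le> 0" if "r \<in> I" for r
    proof (intro LIMSEQ_le_const[of "\<lambda>n. 2 * d * (1 / 2) ^ n"])
      have "(\<lambda>n. 2 * d * (1 / 2) ^ n) \<longlonglongrightarrow> 2 * d * 0"
        by (intro tendsto_mult tendsto_const LIMSEQ_realpow_zero) auto
      then show "(\<lambda>n. 2 * d * (1 / 2) ^ n) \<longlonglongrightarrow> 0" by simp
    qed (use that in auto)
    then show "\<exists>e>0. \<forall>x'\<in>J. dist x' s < e \<longrightarrow> x' \<in> E"
      using e by (intro exI[of _ e]) (auto simp: E_def I_def dist_commute)
  qed
  moreover have "connected J" using J by (simp add: is_interval_connected_1)
  ultimately have "E = J" using t0 unfolding connected_clopen by (auto simp: E_def)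
  then show ?thesis using t by (auto simp: E_def)
qed

text \<open>The signed integral from 0: as a difference of integrals from -1 it also covers negative
  times, where \<open>{0..t}\<close> would be empty.\<close>

definition path_int :: "(real \<Rightarrow>\<^sub>C 'a::banach) \<Rightarrow> real \<Rightarrow>\<^sub>C 'a" where
  "path_int u = path_of (\<lambda>t. integral {-1..t} u - integral {-1..0} u)"

lemma path_integrable: "apply_bcontfun u integrable_on {a..b::real}" for u :: "real \<Rightarrow>\<^sub>C 'a::banach"
  by (rule integrable_continuous_real) auto

lemma path_int_apply:
  "apply_bcontfun (path_int u) t = integral {-1..clip t} (apply_bcontfun u) - integral {-1..0} (apply_bcontfun u)"
  unfolding path_int_def
  by (rule path_of_apply) (intro continuous_on_diff indefinite_integral_continuous_1 path_integrable continuous_on_const)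

lemma bounded_linear_path_int: "bounded_linear path_int"
\<comment> \<open>3 = 2 + 1: the integral up to \<open>clip t\<close> runs over length at most 2,
  the other over length 1.\<close>
proof (rule bounded_linear_intro[of _ 3])
  fix u v :: "real \<Rightarrow>\<^sub>C 'a" and r :: real
  show "path_int (u + v) = path_int u + path_int v"
    by (rule bcontfun_eqI) (simp add: path_int_apply integral_add path_integrable)
  show "path_int (r *\<^sub>R u) = r *\<^sub>R path_int u"
    by (rule bcontfun_eqI) (simp add: path_int_apply scaleR_diff_right)
  show "norm (path_int u) \<le> norm u * 3"
  proof (rule norm_bound)
    fix t
    have "norm (integral {-1..s} (apply_bcontfun u)) \<le> norm u * (s - -1)" if "-1 \<le> s" for s
      by (rule integral_bound) (use that in \<open>auto intro: norm_bounded\<close>)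
    from this[of "clip t"] this[of 0]
    have "norm (path_int u t) \<le> norm u * (clip t + 1) + norm u"
      using norm_triangle_ineq4[of "integral {-1..clip t} (apply_bcontfun u)" "integral {-1..0} (apply_bcontfun u)"]
      by (simp add: path_int_apply)
    also have "\<dots> \<le> norm u * 2 + norm u"
      using clip_bounds(2)[of t] by (intro add_right_mono mult_left_mono) auto
    finally show "norm (path_int u t) \<le> norm u * 3" by simp
  qed
qed

lemma path_int_has_derivative:
  assumes "t \<in> {-1..1}"
  shows "(apply_bcontfun (path_int u) has_vector_derivative u t) (at t within {-1..1})"
proof -
  have "((\<lambda>t. integral {-1..t} u - integral {-1..0} u) has_vector_derivative u t - 0) (at t within {-1..1})"
    by (intro has_vector_derivative_diff has_vector_derivative_const integral_has_vector_derivative) (use assms in auto)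
  then have "((\<lambda>t. integral {-1..t} u - integral {-1..0} u) has_vector_derivative u t) (at t within {-1..1})" by simp
  then show ?thesis
    by (rule has_vector_derivative_transform[OF assms, rotated]) (simp add: path_int_apply clip_id)
qed

lemma bounded_linear_const_path: "bounded_linear (const_bcontfun :: 'a::real_normed_vector \<Rightarrow> real \<Rightarrow>\<^sub>C 'a)"
  by (rule bounded_linear_intro[of _ 1]) (auto intro!: bcontfun_eqI norm_bound)

text \<open>Rescaling time to \<open>[-1, 1]\<close> turns the initial value problem into the equation
  \<open>u = x + \<epsilon> \<integral> f(u)\<close> for paths; it is trivial at \<open>\<epsilon> = 0\<close>, and the inverse function theorem
  gives a solution that is smooth in \<open>\<epsilon>\<close> and \<open>x\<close>.  Evaluation at time \<open>1\<close> is the flow at time \<open>\<epsilon>\<close>.\<close>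

theorem csmooth_flow:
  fixes f :: "'a::banach \<Rightarrow> 'a"
  assumes f: "csmooth S f" and x0: "x0 \<in> S"
  obtains \<epsilon> N \<phi> where "\<epsilon> > 0" "open N" "x0 \<in> N" "N \<subseteq> S"
    "csmooth ({-\<epsilon><..<\<epsilon>} \<times> N) (\<lambda>(t, x). \<phi> t x)"
    "\<And>x. x \<in> N \<Longrightarrow> \<phi> 0 x = x"
    "\<And>t x. t \<in> {-\<epsilon><..<\<epsilon>} \<Longrightarrow> x \<in> N \<Longrightarrow>
      \<phi> t x \<in> S \<and> ((\<lambda>t. \<phi> t x) has_vector_derivative f (\<phi> t x)) (at t)"
proof -
  let ?P = "paths_in S"
  define D where "D = (UNIV :: real set) \<times> (UNIV :: 'a set) \<times> ?P"
  define G where "G u = path_int (superpos f u)" for u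
  \<comment> \<open>The parameters (time scale and initial value) are carried along as components,
    so that the inverse of \<open>H\<close> is the solution together with its smooth dependence on
    them.\<close>
  define H where "H p = (fst p, fst (snd p), snd (snd p) - fst p *\<^sub>R G (snd (snd p)))" for p :: "real \<times> 'a \<times> (real \<Rightarrow>\<^sub>C 'a)"
  have oP: "open ?P" by (rule open_paths_in[OF csmooth_open[OF f]])
  have oD: "open D" unfolding D_def by (intro open_Times oP open_UNIV)
  have G: "csmooth ?P G" unfolding G_def by (intro csmooth_linear_comp[OF bounded_linear_path_int] csmooth_superpos f)
  have b: "bounded_linear (\<lambda>p::real \<times> 'a \<times> (real \<Rightarrow>\<^sub>C 'a). fst p)"
    "bounded_linear (\<lambda>p::real \<times> 'a \<times> (real \<Rightarrow>\<^sub>C 'a). fst (snd p))"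
    "bounded_linear (\<lambda>p::real \<times> 'a \<times> (real \<Rightarrow>\<^sub>C 'a). snd (snd p))"
    by (intro bounded_linear_fst bounded_linear_compose[OF bounded_linear_fst] bounded_linear_compose[OF bounded_linear_snd]
        bounded_linear_snd)+
  have GD: "csmooth D (\<lambda>p. G (snd (snd p)))"
    by (rule csmooth_comp[OF csmooth_linear[OF oD b(3)] G]) (auto simp: D_def)
  have H: "csmooth D H" unfolding H_def
    by (intro csmooth_Pair csmooth_diff csmooth_scaleR csmooth_linear oD b GD)
  define p0 :: "real \<times> 'a \<times> (real \<Rightarrow>\<^sub>C 'a)" where "p0 = (0, x0, const_bcontfun x0)"
  have p0D: "p0 \<in> D" using x0 by (simp add: p0_def D_def paths_in_def)
  define k where "k = G (const_bcontfun x0)"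
  have "(H has_derivative (\<lambda>h. (fst h, fst (snd h),
      snd (snd h) - (fst p0 *\<^sub>R fder (\<lambda>p. G (snd (snd p))) p0 h + fst h *\<^sub>R G (snd (snd p0)))))) (at p0)"
    unfolding H_def[abs_def]
    by (intro has_derivative_Pair has_derivative_diff has_derivative_scaleR bounded_linear_imp_has_derivative b
        csmooth_has_derivative[OF GD p0D])
  then have "(H has_derivative (\<lambda>h. (fst h, fst (snd h), snd (snd h) - fst h *\<^sub>R k))) (at p0)"
    by (simp add: p0_def k_def)
  then have dH: "fder H p0 = (\<lambda>h. (fst h, fst (snd h), snd (snd h) - fst h *\<^sub>R k))"
    by (rule frechet_derivative_at[symmetric])
  \<comment> \<open>The inverse of the derivative of \<open>H\<close>: at \<open>p0\<close> the time
    scale is 0, so only its variation acts, along the fixed path \<open>k\<close>.\<close>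
  have "bounded_linear (\<lambda>h::real \<times> 'a \<times> (real \<Rightarrow>\<^sub>C 'a). (fst h, fst (snd h), snd (snd h) + fst h *\<^sub>R k))"
    by (intro bounded_linear_Pair bounded_linear_add b bounded_linear_scaleR_const)
  then obtain V where V: "open V" "p0 \<in> V" "V \<subseteq> D" "open (H ` V)" "inj_on H V" "csmooth (H ` V) (inv_into V H)"
    using csmooth_inverse[OF H p0D, of "\<lambda>h. (fst h, fst (snd h), snd (snd h) + fst h *\<^sub>R k)"]
    by (auto simp: dH)
  define U where "U t x = snd (snd (inv_into V H (t, x, const_bcontfun x)))" for t x
  have lin3: "bounded_linear (\<lambda>q::real \<times> 'a. (fst q, snd q, const_bcontfun (snd q) :: real \<Rightarrow>\<^sub>C 'a))"
    by (intro bounded_linear_Pair bounded_linear_fst bounded_linear_snd bounded_linear_compose[OF bounded_linear_const_path])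
  define Q where "Q = {q::real \<times> 'a. (fst q, snd q, const_bcontfun (snd q)) \<in> H ` V}"
  have oQ: "open Q" unfolding Q_def by (rule open_linear_vimage[OF V(4) lin3])
  have "H p0 = (0, x0, const_bcontfun x0)" by (simp add: H_def p0_def)
  then have "(0, x0) \<in> Q" using V(2) by (auto simp: Q_def intro: rev_image_eqI)
  then obtain A N where AN: "open A" "open N" "0 \<in> A" "x0 \<in> N" "A \<times> N \<subseteq> Q"
    using oQ open_prod_elim[of Q "(0, x0)"] by (metis mem_Times_iff fst_conv snd_conv)
  obtain \<epsilon> where \<epsilon>: "\<epsilon> > 0" "ball 0 \<epsilon> \<subseteq> A" using AN open_contains_ball by blast
  have inQ: "(t, x) \<in> Q" if "t \<in> {-\<epsilon><..<\<epsilon>}" "x \<in> N" for t x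
    using that \<epsilon>(2) AN(5) by (auto simp: subset_eq dist_real_def)
  have U: "U t x \<in> ?P" "U t x = const_bcontfun x + t *\<^sub>R G (U t x)" if "(t, x) \<in> Q" for t x
  proof -
    let ?q = "(t, x, const_bcontfun x :: real \<Rightarrow>\<^sub>C 'a)"
    have q: "?q \<in> H ` V" using that by (simp add: Q_def)
    have "H (inv_into V H ?q) = ?q" "inv_into V H ?q \<in> V" using q by (auto intro: f_inv_into_f inv_into_into)
    moreover obtain a b u where p: "inv_into V H ?q = (a, b, u)" by (cases "inv_into V H ?q") auto
    ultimately have "a = t" "b = x" "u - t *\<^sub>R G u = const_bcontfun x" "u \<in> ?P"
      using V(3) by (auto simp: H_def D_def)
    then show "U t x \<in> ?P" "U t x = const_bcontfun x + t *\<^sub>R G (U t x)"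
      by (auto simp: U_def p algebra_simps)
  qed
  note cf = csmooth_continuous_on[OF f]
  have U0: "U t x 0 = x" if "(t, x) \<in> Q" for t x
    by (subst U(2)[OF that]) (simp add: G_def path_int_apply clip_def)
  have dU: "(apply_bcontfun (U t x) has_vector_derivative t *\<^sub>R f (U t x \<tau>)) (at \<tau> within {-1..1})"
    if "(t, x) \<in> Q" "\<tau> \<in> {-1..1}" for t x \<tau>
  proof -
    have "(apply_bcontfun (G (U t x)) has_vector_derivative superpos f (U t x) \<tau>) (at \<tau> within {-1..1})"
      unfolding G_def by (rule path_int_has_derivative[OF that(2)])
    then have "((\<lambda>s. x + t *\<^sub>R G (U t x) s) has_vector_derivative 0 + t *\<^sub>R f (U t x \<tau>)) (at \<tau> within {-1..1})"
      using that(2)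
      by (intro has_vector_derivative_add has_vector_derivative_const
          bounded_linear.has_vector_derivative[OF bounded_linear_scaleR_right])
         (simp add: superpos_apply[OF cf U(1)[OF that(1)]] clip_id)
    moreover have "(\<lambda>s. x + t *\<^sub>R G (U t x) s) = apply_bcontfun (U t x)"
      by (rule ext, subst (2) U(2)[OF that(1)]) simp
    ultimately show ?thesis by simp
  qed
  define \<phi> where "\<phi> t x = U t x 1" for t x
  \<comment> \<open>Slowing down the path with scale t by the factor \<tau> solves the equation with
    scale t \<tau>; uniqueness identifies the two. Hence one path contains the flow at all times
    between -t and t.\<close>
  have scale: "U t x \<tau> = \<phi> (t * \<tau>) x" if t: "t \<in> {-\<epsilon><..<\<epsilon>}" and x: "x \<in> N" and \<tau>: "\<tau> \<in> {-1..1}" for t x \<tau>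
  proof -
    have tt: "t * \<tau> \<in> {-\<epsilon><..<\<epsilon>}"
    proof -
      have "\<bar>t * \<tau>\<bar> \<le> \<bar>t\<bar>" using \<tau> by (simp add: abs_mult mult_left_le abs_le_iff)
      then show ?thesis using t by auto
    qed
    note Q1 = inQ[OF t x] and Q2 = inQ[OF tt x]
    have in1: "\<tau> * s \<in> {-1..1}" if "s \<in> {-1..1}" for s
    proof -
      have "\<bar>\<tau> * s\<bar> \<le> 1" using that \<tau> by (simp add: abs_mult abs_le_iff mult_le_one)
      then show ?thesis by auto
    qed
    have sf: "csmooth S (\<lambda>y. (t * \<tau>) *\<^sub>R f y)"
      by (intro csmooth_scaleR csmooth_const csmooth_open[OF f] f)
    have "U t x (\<tau> * 1) = U (t * \<tau>) x 1"
    proof (rule ode_unique[OF sf, where J = "{-1..1}" and ?t0.0 = 0 and \<gamma> = "\<lambda>s. U t x (\<tau> * s)"])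
      show "U t x (\<tau> * 0) = U (t * \<tau>) x 0" using U0[OF Q1] U0[OF Q2] by simp
      show "U (t * \<tau>) x s \<in> S \<and> (apply_bcontfun (U (t * \<tau>) x) has_vector_derivative (t * \<tau>) *\<^sub>R f (U (t * \<tau>) x s)) (at s within {-1..1})"
        if "s \<in> {-1..1}" for s
        using dU[OF Q2 that] paths_inD[OF U(1)[OF Q2] that] by simp
      show "U t x (\<tau> * s) \<in> S \<and> ((\<lambda>s. U t x (\<tau> * s)) has_vector_derivative (t * \<tau>) *\<^sub>R f (U t x (\<tau> * s))) (at s within {-1..1})"
        if s: "s \<in> {-1..1}" for s
      proof
        show "U t x (\<tau> * s) \<in> S" by (rule paths_inD[OF U(1)[OF Q1] in1[OF s]])
        have d1: "((\<lambda>s. \<tau> * s) has_vector_derivative \<tau>) (at s within {-1..1})"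
          by (auto intro!: derivative_eq_intros)
        have d2: "(apply_bcontfun (U t x) has_vector_derivative t *\<^sub>R f (U t x (\<tau> * s))) (at (\<tau> * s) within (\<lambda>s. \<tau> * s) ` {-1..1})"
          by (rule has_vector_derivative_within_subset[OF dU[OF Q1 in1[OF s]]]) (use in1 in auto)
        from vector_diff_chain_within[OF d1 d2]
        show "((\<lambda>s. U t x (\<tau> * s)) has_vector_derivative (t * \<tau>) *\<^sub>R f (U t x (\<tau> * s))) (at s within {-1..1})"
          by (simp add: o_def mult.commute[of t \<tau>])
      qed
    qed auto
    then show ?thesis by (simp add: \<phi>_def)
  qed
  show thesis
  proof (rule that[OF \<epsilon>(1), of N \<phi>])
    show "open N" "x0 \<in> N" by fact+
    show \<phi>0: "\<phi> 0 x = x" if "x \<in> N" for x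
      using scale[of 0 x 0] U0[OF inQ[OF _ that, of 0]] that \<epsilon>(1) by simp
    have \<phi>S: "\<phi> t x \<in> S" if "t \<in> {-\<epsilon><..<\<epsilon>}" "x \<in> N" for t x
      unfolding \<phi>_def by (rule paths_inD[OF U(1)[OF inQ[OF that]]]) simp
    show "N \<subseteq> S" using \<phi>S[of 0] \<phi>0 \<epsilon>(1) by fastforce
    show "csmooth ({-\<epsilon><..<\<epsilon>} \<times> N) (\<lambda>(t, x). \<phi> t x)"
    proof -
      have "csmooth Q (\<lambda>q. inv_into V H (fst q, snd q, const_bcontfun (snd q)))"
        by (rule csmooth_comp[OF csmooth_linear[OF oQ lin3] V(6)]) (simp add: Q_def)
      from csmooth_linear_comp[OF bounded_linear_compose[OF bounded_linear_coord[of 1] b(3)] this]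
      have "csmooth Q (\<lambda>(t, x). \<phi> t x)" by (simp add: \<phi>_def U_def case_prod_beta')
      then show ?thesis
        by (rule csmooth_subset) (use inQ AN(2) in \<open>auto intro: open_Times\<close>)
    qed
    show "\<phi> t x \<in> S \<and> ((\<lambda>t. \<phi> t x) has_vector_derivative f (\<phi> t x)) (at t)"
      if t: "t \<in> {-\<epsilon><..<\<epsilon>}" and x: "x \<in> N" for t x
    proof
      show "\<phi> t x \<in> S" by (rule \<phi>S[OF t x])
      have "\<bar>t\<bar> < \<epsilon>" using t by auto
      \<comment> \<open>With a scale e strictly between |t| and \<epsilon>, the time t corresponds
        to the interior point t / e of [-1, 1], where the path has a two-sided derivative.\<close>
      then obtain e where e: "\<bar>t\<bar> < e" "e < \<epsilon>" using dense by blast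
      then have e0: "e > 0" "e \<in> {-\<epsilon><..<\<epsilon>}" by auto
      let ?s = "t / e"
      have s: "?s \<in> {-1<..<1}" using e(1) e0(1) by (simp add: pos_less_divide_eq pos_divide_less_eq abs_less_iff)
      have "(apply_bcontfun (U e x) has_vector_derivative e *\<^sub>R f (U e x ?s)) (at ?s within {-1..1})"
        by (rule dU[OF inQ[OF e0(2) x]]) (use s in auto)
      then have d2: "(apply_bcontfun (U e x) has_vector_derivative e *\<^sub>R f (U e x ?s)) (at ?s)"
        using at_within_Icc_at[of "-1" ?s 1] s by (simp only: greaterThanLessThan_iff)
      have "((\<lambda>t. t / e) has_real_derivative 1 / e) (at t)"
        by (rule DERIV_cdivide[OF DERIV_ident])
      then have d1: "((\<lambda>t. t / e) has_vector_derivative 1 / e) (at t)"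
        by (simp only: has_real_derivative_iff_has_vector_derivative)
      from vector_diff_chain_at[OF d1 d2]
      have "((\<lambda>t. U e x (t / e)) has_vector_derivative (1 / e) *\<^sub>R e *\<^sub>R f (U e x ?s)) (at t)"
        by (simp only: o_def)
      then have "((\<lambda>t. U e x (t / e)) has_vector_derivative f (\<phi> t x)) (at t)"
        using scale[OF e0(2) x, of ?s] s e0 by simp
      then show "((\<lambda>t. \<phi> t x) has_vector_derivative f (\<phi> t x)) (at t)"
      proof (rule has_vector_derivative_transform_within_open[where S = "{-e<..<e}"])
        fix r assume "r \<in> {-e<..<e}"
        then have "r / e \<in> {-1..1}" using e0(1) by (simp add: pos_le_divide_eq pos_divide_le_eq)
        from scale[OF e0(2) x this] show "U e x (r / e) = \<phi> r x" using e0 by simp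
      qed (use e in auto)
    qed
  qed
qed

subsection \<open>Integration of almost everywhere derivatives\<close>

lemma finite_measure_interval: "finite_measure (lebesgue_on {a..b::real})"
  by (rule finite_measure_lebesgue_on) simp

text \<open>Difference quotients are bounded by L and converge almost everywhere, so dominated
  convergence applies. Their integrals are difference quotients of a primitive of \<open>f\<close>
  at the two end points, which tend to values of \<open>f\<close>.\<close>

lemma lipschitz_integral_derivative:
  fixes f :: "real \<Rightarrow> 'b::euclidean_space"
  assumes lip: "L-lipschitz_on UNIV f" and ab: "a \<le> b"
  shows "integrable (lebesgue_on {a..b}) (\<lambda>x. vector_derivative f (at x))"
    and "integral {a..b} (\<lambda>x. vector_derivative f (at x)) = f b - f a"
proof -
  let ?M = "lebesgue_on {a..b}"
  let ?D = "\<lambda>x. vector_derivative f (at x)"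
  define h where "h n = 1 / real (Suc n)" for n
  define g where "g n x = real (Suc n) *\<^sub>R (f (x + h n) - f x)" for n x
  have cf: "continuous_on S f" for S
    using lipschitz_on_continuous_on[OF lip] continuous_on_subset by blast
  have cfh: "continuous_on S (\<lambda>x. f (x + h n))" for S n
    by (rule continuous_on_compose2[OF cf[of UNIV]]) (auto intro!: continuous_intros)
  have cg: "continuous_on S (g n)" for S n
    unfolding g_def by (intro continuous_intros cf cfh)
  have Dm: "?D \<in> borel_measurable ?M"
    using lipschitz_vector_derivative_measurable[OF lip] by (rule measurable_restrict_space1)
  have gm: "g n \<in> borel_measurable ?M" for n
  proof -
    have "g n \<in> borel_measurable borel" by (rule borel_measurable_continuous_onI[OF cg])
    then show ?thesis by (intro measurable_restrict_space1 measurable_completion) simp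
  qed
  have gb: "norm (g n x) \<le> L" for n x
  proof -
    have "norm (f (x + h n) - f x) \<le> L * h n"
      using lipschitz_onD[OF lip, of "x + h n" x] by (simp add: dist_norm h_def)
    then have "real (Suc n) * norm (f (x + h n) - f x) \<le> L"
      by (simp add: h_def field_simps del: of_nat_Suc)
    then show ?thesis by (simp only: g_def norm_scaleR abs_of_nat)
  qed
  have "AE x in lebesgue. f differentiable (at x)"
    using lipschitz_differentiable[OF lip] by (intro AE_I'[of "{x. \<not> f differentiable (at x)}"])
      (auto simp: negligible_iff_null_sets)
  then have "AE x in ?M. f differentiable (at x)"
    by (auto simp: AE_restrict_space_iff elim: eventually_mono)
  then have lim: "AE x in ?M. (\<lambda>n. g n x) \<longlonglongrightarrow> ?D x"
    by eventually_elim (use vector_derivative_quotient_lim in \<open>simp add: g_def h_def\<close>)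
  have fin: "integrable ?M (\<lambda>_. L)"
    by (rule finite_measure.integrable_const[OF finite_measure_interval])
  note dct = integrable_dominated_convergence[OF Dm gm fin lim] integrable_dominated_convergence2[OF Dm gm fin lim]
    integral_dominated_convergence[OF Dm gm fin lim]
  show int: "integrable ?M ?D" by (rule dct(1)) (simp add: gb)
  \<comment> \<open>Starting at a - 1 gives the primitive a two-sided derivative at \<open>a\<close>
    as well.\<close>
  define F where "F x = integral {a - 1..x} f" for x
  have Fd: "F differentiable (at x) \<and> vector_derivative F (at x) = f x" if "x \<in> {a..b}" for x
  proof -
    have "(F has_vector_derivative f x) (at x within {a - 1..b + 1})"
      unfolding F_def using that by (intro integral_has_vector_derivative cf) auto
    then have "(F has_vector_derivative f x) (at x)"
      using at_within_Icc_at[of "a - 1" x "b + 1"] that by simp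
    then show ?thesis by (auto intro: differentiableI_vector vector_derivative_at)
  qed
  have gi: "integral {a..b} (g n) = real (Suc n) *\<^sub>R (F (b + h n) - F b) - real (Suc n) *\<^sub>R (F (a + h n) - F a)" for n
  proof -
    have hn: "h n > 0" by (simp add: h_def)
    have Fi: "F v - F u = integral {u..v} f" if "a \<le> u" "u \<le> v" for u v
      unfolding F_def using that
      by (subst Henstock_Kurzweil_Integration.integral_combine[of "a - 1" u v f, symmetric])
        (auto intro: integrable_continuous_real cf)
    have "integral {a..b} (g n) = real (Suc n) *\<^sub>R (integral {a..b} (\<lambda>x. f (x + h n)) - integral {a..b} f)"
      unfolding g_def
      by (simp add: integral_diff integrable_continuous_real cf cfh)
    also have "integral {a..b} (\<lambda>x. f (x + h n)) = integral {a + h n..b + h n} f"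
      using integral_shift[of a "h n" b f] cf by (simp add: o_def)
    also have "\<dots> = F (b + h n) - F (a + h n)" using Fi[of "a + h n" "b + h n"] ab hn by simp
    also have "integral {a..b} f = F b - F a" using Fi[of a b] ab by simp
    finally show ?thesis by (simp add: algebra_simps)
  qed
  have "(\<lambda>n. integral {a..b} (g n)) \<longlonglongrightarrow> f b - f a"
    unfolding gi h_def
    using vector_derivative_quotient_lim[of F b] vector_derivative_quotient_lim[of F a] Fd[of a] Fd[of b] ab
    by (intro tendsto_diff) auto
  moreover have "(\<lambda>n. integral {a..b} (g n)) \<longlonglongrightarrow> integral {a..b} ?D"
  proof -
    have "integral\<^sup>L ?M (g n) = integral {a..b} (g n)" for n
      by (rule lebesgue_integral_eq_integral[OF dct(2)]) (simp_all add: gb)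
    moreover have "integral\<^sup>L ?M ?D = integral {a..b} ?D"
      by (rule lebesgue_integral_eq_integral[OF int]) simp
    moreover have "(\<lambda>n. integral\<^sup>L ?M (g n)) \<longlonglongrightarrow> integral\<^sup>L ?M ?D"
      by (rule dct(3)) (simp add: gb)
    ultimately show ?thesis by simp
  qed
  ultimately show "integral {a..b} ?D = f b - f a" by (rule LIMSEQ_unique[symmetric])
qed

lemma interval_restrict_measurable:
  fixes d :: "real \<Rightarrow> 'b::real_normed_vector"
  assumes "d \<in> borel_measurable (lebesgue_on {a..b})" "{u..v} \<subseteq> {a..b}"
  shows "d \<in> borel_measurable (lebesgue_on {u..v})"
  using measurable_restrict_mono[OF assms] .

lemma bounded_integrable_on:
  fixes d :: "real \<Rightarrow> 'b::euclidean_space"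
  assumes m: "d \<in> borel_measurable (lebesgue_on {a..b})" and B: "AE x in lebesgue_on {a..b}. norm (d x) \<le> B"
  shows "integrable (lebesgue_on {a..b}) d"
  by (rule finite_measure.integrable_const_bound[OF finite_measure_interval B m])

lemma AE_restrict_subinterval:
  assumes "AE x in lebesgue_on {a..b::real}. P x" "{u..v} \<subseteq> {a..b}"
  shows "AE x in lebesgue_on {u..v}. P x"
  using assms(1) by (auto simp: AE_restrict_space_iff elim!: eventually_mono) (use assms(2) in auto)

text \<open>Adding the bound B makes the function a density. The measures with densities d + B and B
  on the interval agree on all half-lines, hence are equal, and so are their densities almost
  everywhere.\<close>

lemma AE_zero_if_interval_integrals_zero_real:
  fixes d :: "real \<Rightarrow> real"
  assumes m: "d \<in> borel_measurable (lebesgue_on {a..b})"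
    and B: "AE x in lebesgue_on {a..b}. norm (d x) \<le> B" and ab: "a \<le> b"
    and z: "\<And>u. a \<le> u \<Longrightarrow> u \<le> b \<Longrightarrow> integral {u..b} d = 0"
  shows "AE x in lebesgue_on {a..b}. d x = 0"
proof -
  let ?I = "indicator {a..b} :: real \<Rightarrow> real"
  define d0 where "d0 x = ?I x *\<^sub>R d x" for x
  have i0: "integrable lebesgue d0"
    unfolding d0_def using bounded_integrable_on[OF m B] by (subst (asm) integrable_restrict_space) auto
  \<comment> \<open>A Borel representative of the extension by zero: the uniqueness theorems for
    measures and densities are used over \<open>lborel\<close>.\<close>
  obtain e where e: "e \<in> borel_measurable lborel" "AE x in lborel. d0 x = e x"
    using completion_ex_borel_measurable_real[OF borel_measurable_integrable[OF i0]] by blast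
  have e': "AE x in lebesgue. d0 x = e x" using e(2) by (rule AE_completion)
  have ie: "integrable lborel e"
  proof -
    have "integrable lebesgue e"
      using i0 e' e(1) by (subst integrable_cong_AE[symmetric, OF _ _ e']) (auto intro: measurable_completion borel_measurable_integrable)
    then show ?thesis using e(1) by (subst (asm) integrable_completion)
  qed
  have Bd: "AE x in lebesgue. norm (d0 x) \<le> B * ?I x"
    using B by (auto simp: AE_restrict_space_iff d0_def indicator_def elim!: eventually_mono)
  have Be: "AE x in lborel. norm (e x) \<le> B * ?I x"
  proof -
    have "AE x in lebesgue. norm (e x) \<le> B * ?I x" using e' Bd by eventually_elim simp
    then show ?thesis using e(1) by (subst (asm) AE_completion_iff) auto
  qed
  define G where "G x = e x + B * ?I x" for x
  define H where "H x = B * ?I x" for x :: real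
  have Gm: "G \<in> borel_measurable borel" "H \<in> borel_measurable borel" unfolding G_def H_def using e(1) by auto
  have iI: "integrable lborel (\<lambda>x. B * ?I x)" by (intro integrable_mult_right) (simp add: integrable_indicator_iff emeasure_lborel_cbox_finite[of a b, simplified])
  have iG: "integrable lborel G" "integrable lborel H" unfolding G_def H_def by (intro Bochner_Integration.integrable_add ie iI)+
  have pos: "AE x in lborel. 0 \<le> G x" "AE x in lborel. 0 \<le> H x" using Be by (auto simp: G_def H_def elim!: eventually_mono)
  have ez: "(\<integral>x. e x * indicator {u<..} x \<partial>lborel) = 0" for u
  proof -
    let ?u = "max u a"
    have "(\<integral>x. e x * indicator {u<..} x \<partial>lborel) = (\<integral>x. e x * indicator {u<..} x \<partial>lebesgue)"
      using e(1) by (intro integral_completion[symmetric]) auto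
    also have "\<dots> = (\<integral>x. indicator {?u..b} x *\<^sub>R d x \<partial>lebesgue)"
    proof (rule integral_cong_AE)
      show "(\<lambda>x. e x * indicator {u<..} x) \<in> borel_measurable lebesgue"
        using e(1) by (intro measurable_completion) auto
      have "d \<in> borel_measurable (lebesgue_on {?u..b})" by (rule interval_restrict_measurable[OF m]) auto
      then show "(\<lambda>x. indicator {?u..b} x *\<^sub>R d x) \<in> borel_measurable lebesgue"
        by (simp add: borel_measurable_restrict_space_iff)
      have "AE x in lebesgue. x \<noteq> u"
        by (rule AE_completion) (rule AE_lborel_singleton)
      with e' show "AE x in lebesgue. e x * indicator {u<..} x = indicator {?u..b} x *\<^sub>R d x"
        by eventually_elim (auto simp: d0_def indicator_def split: if_splits)
    qed
    also have "\<dots> = integral\<^sup>L (lebesgue_on {?u..b}) d" by (simp add: integral_restrict_space)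
    also have "\<dots> = integral {?u..b} d"
      by (intro lebesgue_integral_eq_integral bounded_integrable_on[of _ _ _ B] interval_restrict_measurable[OF m]
          AE_restrict_subinterval[OF B]) auto
    also have "\<dots> = 0" using z[of ?u] by (cases "?u \<le> b") auto
    finally show ?thesis .
  qed
  have em: "emeasure (density lborel (\<lambda>x. ennreal (K x))) {u<..} = ennreal (\<integral>x. K x * indicator {u<..} x \<partial>lborel)"
    if "K \<in> borel_measurable borel" "integrable lborel K" "AE x in lborel. 0 \<le> K x" for K :: "real \<Rightarrow> real" and u
  proof -
    have "emeasure (density lborel (\<lambda>x. ennreal (K x))) {u<..} = (\<integral>\<^sup>+x. ennreal (K x) * indicator {u<..} x \<partial>lborel)"
      using that(1) by (intro emeasure_density) auto
    also have "\<dots> = (\<integral>\<^sup>+x. ennreal (K x * indicator {u<..} x) \<partial>lborel)"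
      by (intro nn_integral_cong) (auto simp: indicator_def)
    also have "\<dots> = ennreal (\<integral>x. K x * indicator {u<..} x \<partial>lborel)"
      using that(2,3) by (intro nn_integral_eq_integral integrable_real_mult_indicator) (auto elim!: eventually_mono)
    finally show ?thesis .
  qed
  have "density lborel (\<lambda>x. ennreal (G x)) = density lborel (\<lambda>x. ennreal (H x))"
  proof (rule measure_eqI_lessThan)
    fix u
    have "(\<integral>x. G x * indicator {u<..} x \<partial>lborel)
        = (\<integral>x. e x * indicator {u<..} x \<partial>lborel) + (\<integral>x. H x * indicator {u<..} x \<partial>lborel)"
      unfolding G_def H_def distrib_right
      by (intro Bochner_Integration.integral_add integrable_real_mult_indicator ie iI) auto
    then show "emeasure (density lborel (\<lambda>x. ennreal (G x))) {u<..} = emeasure (density lborel (\<lambda>x. ennreal (H x))) {u<..}"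
      unfolding em[OF Gm(1) iG(1) pos(1)] em[OF Gm(2) iG(2) pos(2)] by (simp add: ez)
    show "emeasure (density lborel (\<lambda>x. ennreal (G x))) {u<..} < \<infinity>"
      unfolding em[OF Gm(1) iG(1) pos(1)] by simp
  qed auto
  then have "AE x in lborel. ennreal (G x) = ennreal (H x)"
    using Gm by (intro sigma_finite_measure.density_unique[OF sigma_finite_lborel]) auto
  with pos have "AE x in lborel. e x = 0"
    by eventually_elim (simp add: G_def H_def)
  then have "AE x in lebesgue. e x = 0" by (rule AE_completion)
  with e' have "AE x in lebesgue. d0 x = 0" by eventually_elim simp
  then show ?thesis by (auto simp: AE_restrict_space_iff d0_def elim!: eventually_mono)
qed

lemma AE_zero_if_interval_integrals_zero:
  fixes d :: "real \<Rightarrow> real ^ 'n"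
  assumes m: "d \<in> borel_measurable (lebesgue_on {a..b})"
    and B: "AE x in lebesgue_on {a..b}. norm (d x) \<le> B" and ab: "a \<le> b"
    and z: "\<And>u. a \<le> u \<Longrightarrow> u \<le> b \<Longrightarrow> integral {u..b} d = 0"
  shows "AE x in lebesgue_on {a..b}. d x = 0"
proof -
  have "AE x in lebesgue_on {a..b}. d x $ i = 0" for i
  proof (rule AE_zero_if_interval_integrals_zero_real[OF _ _ ab])
    show "(\<lambda>x. d x $ i) \<in> borel_measurable (lebesgue_on {a..b})"
      by (rule measurable_compose[OF m borel_measurable_continuous_onI[OF linear_continuous_on[OF bounded_linear_vec_nth]]])
    show "AE x in lebesgue_on {a..b}. norm (d x $ i) \<le> B"
      using B
    proof eventually_elim
      case (elim x)
      show ?case using order_trans[OF component_le_norm_cart[of "d x" i] elim] by simp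
    qed
    fix u assume u: "a \<le> u" "u \<le> b"
    have "d integrable_on {u..b}"
      by (intro integrable_on_lebesgue_on bounded_integrable_on[of _ _ _ B] interval_restrict_measurable[OF m]
          AE_restrict_subinterval[OF B]) (use u in auto)
    from integral_linear[OF this bounded_linear_vec_nth, of i] show "integral {u..b} (\<lambda>x. d x $ i) = 0"
      using z[OF u] by (simp add: o_def)
  qed
  then have "AE x in lebesgue_on {a..b}. \<forall>i. d x $ i = 0" by (simp add: AE_all_countable)
  then show ?thesis by eventually_elim (simp add: vec_eq_iff)
qed

subsection \<open>Completeness of the space of mean-zero Lipschitz functions\<close>

lemma integral_AE_bound:
  fixes d :: "real \<Rightarrow> 'b::euclidean_space"
  assumes m: "d \<in> borel_measurable (lebesgue_on {a..b})"
    and B: "AE x in lebesgue_on {a..b}. norm (d x) \<le> B" and ab: "a \<le> b"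
  shows "norm (integral {a..b} d) \<le> B * (b - a)"
proof -
  have i: "integrable (lebesgue_on {a..b}) d" by (rule bounded_integrable_on[OF m B])
  have "integral {a..b} d = integral\<^sup>L (lebesgue_on {a..b}) d"
    by (rule lebesgue_integral_eq_integral[OF i, symmetric]) simp
  also have "norm \<dots> \<le> (\<integral>x. norm (d x) \<partial>lebesgue_on {a..b})" by (rule integral_norm_bound)
  also have "\<dots> \<le> (\<integral>x. B \<partial>lebesgue_on {a..b})"
    by (rule integral_mono_AE[OF integrable_norm[OF i] finite_measure.integrable_const[OF finite_measure_interval] B])
  also have "\<dots> = B * (b - a)"
    using ab by (simp add: measure_restrict_space)
  finally show ?thesis .
qed

lemma subcircle:
  fixes d :: "real \<Rightarrow> 'b::euclidean_space"
  assumes "d \<in> borel_measurable circle" "AE \<theta> in circle. norm (d \<theta>) \<le> B" "0 \<le> a" "b \<le> 2 * pi"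
  shows "d \<in> borel_measurable (lebesgue_on {a..b})" "AE \<theta> in lebesgue_on {a..b}. norm (d \<theta>) \<le> B"
    "d integrable_on {a..b}"
proof -
  have s: "{a..b} \<subseteq> {0..2 * pi}" using assms(3,4) by auto
  show 1: "d \<in> borel_measurable (lebesgue_on {a..b})" by (rule interval_restrict_measurable[OF assms(1) s])
  show 2: "AE \<theta> in lebesgue_on {a..b}. norm (d \<theta>) \<le> B" by (rule AE_restrict_subinterval[OF assms(2) s])
  show "d integrable_on {a..b}" by (rule integrable_on_lebesgue_on[OF bounded_integrable_on[OF 1 2]]) simp
qed

lemma circle_integral:
  fixes d :: "real \<Rightarrow> 'b::euclidean_space"
  assumes "d \<in> borel_measurable circle" "AE \<theta> in circle. norm (d \<theta>) \<le> B"
  shows "integrable circle d" "integral\<^sup>L circle d = integral {0..2 * pi} d"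
proof -
  show i: "integrable circle d" by (rule bounded_integrable_on[OF assms])
  show "integral\<^sup>L circle d = integral {0..2 * pi} d" by (rule lebesgue_integral_eq_integral[OF i]) simp
qed

text \<open>Positive total measure: the almost-everywhere filter of the circle is not
  trivial.\<close>

lemma AE_circle_const: "(AE \<theta> in circle. P) \<Longrightarrow> P"
  using emeasure_circle by (simp only: eventually_const_iff ae_filter_eq_bot_iff) blast

lemma integral_tderiv: "a \<le> b \<Longrightarrow> integral {a..b} (tderiv c) = curve c b - curve c a"
proof -
  assume ab: "a \<le> b"
  obtain L where "L-lipschitz_on UNIV (curve c)" using curve_lipschitz by blast
  from lipschitz_integral_derivative(2)[OF this ab] show ?thesis by (simp add: tderiv_def[abs_def])
qed

lemma integral_circle_tderiv: "integral {0..2 * pi} (tderiv c) = 0"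
  using integral_tderiv[of 0 "2 * pi" c] curve_periodic[of c 0] by simp

lemma tderiv_AE_norm: "AE \<theta> in circle. norm (tderiv c \<theta>) \<le> norm c"
proof -
  obtain B where "AE \<theta> in circle. norm (tderiv c \<theta>) \<le> B" using tderiv_bounded by blast
  from Linf_norm_AE[OF tderiv_measurable this] show ?thesis
    by (rule eventually_mono) (use norm_parts_nonneg(1)[of c] in \<open>simp add: norm_W1inf0_def\<close>)
qed

lemma tderiv_diff: "AE \<theta> in circle. tderiv (c - h) \<theta> = tderiv c \<theta> - tderiv h \<theta>"
proof -
  have e: "c + (-1) *\<^sub>R h = c - h" by simp
  show ?thesis
    using tderiv_add[of c "(-1) *\<^sub>R h", unfolded e] tderiv_scaleR[of "-1" h] by eventually_elim simp
qed

text \<open>A Poincare inequality: as the mean vanishes, 2 pi c(x) is the integral of c(x) - c(y)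
  over y, and the oscillation of c is at most 2 pi B.\<close>

lemma norm_W1inf0_le:
  fixes c :: "'n::finite W1inf0"
  assumes B: "AE \<theta> in circle. norm (tderiv c \<theta>) \<le> B"
  shows "norm c \<le> (1 + 2 * pi) * B"
proof -
  have ae: "AE \<theta> in circle. 0 \<le> B" using B by eventually_elim (rule order_trans[OF norm_ge_zero])
  then have B0: "0 \<le> B" by (rule AE_circle_const)
  have lip: "norm (curve c b - curve c a) \<le> B * (b - a)" if "0 \<le> a" "a \<le> b" "b \<le> 2 * pi" for a b
    using integral_AE_bound[OF subcircle(1,2)[OF tderiv_measurable B that(1,3)] that(2)] integral_tderiv[OF that(2), of c]
    by simp
  have osc: "norm (curve c x - curve c y) \<le> B * (2 * pi)" if "x \<in> {0..2 * pi}" "y \<in> {0..2 * pi}" for x y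
  proof (cases "x \<le> y")
    case True
    have "norm (curve c x - curve c y) \<le> B * (y - x)" using lip[of x y] True that by (simp add: norm_minus_commute)
    also have "\<dots> \<le> B * (2 * pi)" using that B0 by (intro mult_left_mono) auto
    finally show ?thesis .
  next
    case False
    have "norm (curve c x - curve c y) \<le> B * (x - y)" using lip[of y x] False that by simp
    also have "\<dots> \<le> B * (2 * pi)" using that B0 by (intro mult_left_mono) auto
    finally show ?thesis .
  qed
  have cb: "norm (curve c x) \<le> 2 * pi * B" if x: "x \<in> {0..2 * pi}" for x
  proof -
    have ci: "curve c integrable_on {0..2 * pi}" by (rule integrable_continuous_real[OF curve_continuous])
    have "integral {0..2 * pi} (\<lambda>y. curve c x - curve c y) = (2 * pi) *\<^sub>R curve c x"
      by (subst integral_diff[OF integrable_const_ivl ci]) (simp add: curve_mean)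
    moreover have "norm (integral {0..2 * pi} (\<lambda>y. curve c x - curve c y)) \<le> (B * (2 * pi)) * (2 * pi - 0)"
      using osc[OF x] by (intro integral_bound continuous_on_diff continuous_on_const curve_continuous) auto
    ultimately have "(2 * pi) * norm (curve c x) \<le> (2 * pi) * (2 * pi * B)" by (simp add: algebra_simps)
    then show ?thesis by (rule mult_left_le_imp_le) simp
  qed
  have "AE \<theta> in circle. norm (curve c \<theta>) \<le> 2 * pi * B"
    by (rule AE_I2) (use cb in \<open>auto simp: space_restrict_space\<close>)
  then have "Linf_norm (curve c) \<le> 2 * pi * B" by (rule Linf_norm_least[OF curve_measurable])
  moreover have "Linf_norm (tderiv c) \<le> B" by (rule Linf_norm_least[OF tderiv_measurable B])
  ultimately show ?thesis by (simp add: norm_W1inf0_def algebra_simps)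
qed

text \<open>The primitive from 0 takes the same value at both ends of the period because the
  integral of \<open>k\<close> vanishes, so it extends periodically without losing the Lipschitz
  bound; subtracting its mean lands in \<open>W1inf0\<close>.\<close>

lemma W1inf0_primitive:
  fixes k :: "real \<Rightarrow> real ^ 'n::finite"
  assumes m: "k \<in> borel_measurable circle" and B: "AE \<theta> in circle. norm (k \<theta>) \<le> B"
    and z: "integral {0..2 * pi} k = 0"
  shows "\<exists>c :: 'n W1inf0. AE \<theta> in circle. tderiv c \<theta> = k \<theta>"
proof -
  have ae: "AE \<theta> in circle. 0 \<le> B" using B by eventually_elim (rule order_trans[OF norm_ge_zero])
  then have B0: "0 \<le> B" by (rule AE_circle_const)
  define K where "K x = integral {0..x} k" for x
  have Kdiff: "K v - K u = integral {u..v} k" if "0 \<le> u" "u \<le> v" "v \<le> 2 * pi" for u v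
    unfolding K_def using that
    by (subst Henstock_Kurzweil_Integration.integral_combine[of 0 u v k, symmetric])
      (auto intro: subcircle(3)[OF m B])
  have Kl: "norm (K v - K u) \<le> B * (v - u)" if "0 \<le> u" "u \<le> v" "v \<le> 2 * pi" for u v
    unfolding Kdiff[OF that] by (rule integral_AE_bound[OF subcircle(1,2)[OF m B that(1,3)] that(2)])
  have K0: "K 0 = 0" "K (2 * pi) = 0" by (auto simp: K_def z)
  have cK: "continuous_on {0..2 * pi} K"
    unfolding K_def by (rule indefinite_integral_continuous_1[OF subcircle(3)[OF m B]]) auto
  define mean where "mean = (1 / (2 * pi)) *\<^sub>R integral {0..2 * pi} K"
  define q where "q x = \<lfloor>x / (2 * pi)\<rfloor>" for x
  define p where "p x = x - 2 * pi * q x" for x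
  have p: "0 \<le> p x" "p x < 2 * pi" for x
  proof -
    have "of_int (q x) \<le> x / (2 * pi)" "x / (2 * pi) < of_int (q x) + 1" unfolding q_def by linarith+
    then show "0 \<le> p x" "p x < 2 * pi" by (simp_all add: p_def field_simps)
  qed
  define C where "C x = K (p x) - mean" for x
  \<comment> \<open>At 2 pi the reduction modulo the period returns 0, where \<open>K\<close> has
    the same value.\<close>
  have Cin: "C x = K x - mean" if "x \<in> {0..2 * pi}" for x
  proof (cases "x = 2 * pi")
    case True
    then show ?thesis by (simp add: C_def p_def q_def K0)
  next
    case False
    then have "q x = 0" using that by (auto simp: q_def floor_eq_iff field_simps)
    then show ?thesis by (simp add: C_def p_def)
  qed
  have Cl: "norm (C y - C x) \<le> B * (y - x)" if "x \<le> y" for x y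
  proof (cases "q x = q y")
    case True
    then have "p y - p x = y - x" by (simp add: p_def)
    then show ?thesis using Kl[of "p x" "p y"] p[of x] p[of y] that by (simp add: C_def)
  next
    case False
    have "q x \<le> q y" unfolding q_def using that by (intro floor_mono divide_right_mono) auto
    with False have "q x + 1 \<le> q y" by simp
    then have "real_of_int (q x) + 1 \<le> real_of_int (q y)" by linarith
    then have "2 * pi * (real_of_int (q x) + 1) \<le> 2 * pi * real_of_int (q y)" by (intro mult_left_mono) auto
    then have le: "(2 * pi - p x) + p y \<le> y - x" by (simp add: p_def algebra_simps)
    \<comment> \<open>The period boundary is crossed through 2 pi and 0, at both of which
      \<open>K\<close> vanishes.\<close>
    have "C y - C x = (K (p y) - K 0) + (K (2 * pi) - K (p x))" by (simp add: C_def K0)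
    also have "norm \<dots> \<le> B * (p y - 0) + B * (2 * pi - p x)"
      by (rule order_trans[OF norm_triangle_ineq add_mono[OF Kl Kl]]) (use p[of x] p[of y] in auto)
    also have "\<dots> = B * ((2 * pi - p x) + p y)" by (simp add: algebra_simps)
    also have "\<dots> \<le> B * (y - x)" using le B0 by (rule mult_left_mono)
    finally show ?thesis .
  qed
  have "C (\<theta> + 2 * pi) = C \<theta>" for \<theta>
  proof -
    have "(\<theta> + 2 * pi) / (2 * pi) = \<theta> / (2 * pi) + 1" by (simp add: field_simps)
    then have "q (\<theta> + 2 * pi) = q \<theta> + 1" by (simp add: q_def)
    then show ?thesis by (simp add: C_def p_def algebra_simps)
  qed
  moreover have "B-lipschitz_on UNIV C"
  proof (rule lipschitz_onI)
    fix x y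
    show "dist (C x) (C y) \<le> B * dist x y"
      using Cl[of x y] Cl[of y x] by (cases "x \<le> y") (auto simp: dist_norm norm_minus_commute)
  qed (rule B0)
  moreover have "integral {0..2 * pi} C = 0"
  proof -
    have "integral {0..2 * pi} C = integral {0..2 * pi} (\<lambda>x. K x - mean)"
      by (rule integral_cong[OF Cin])
    also have "\<dots> = 0"
      by (subst integral_diff[OF integrable_continuous_real[OF cK] integrable_const_ivl]) (simp add: mean_def)
    finally show ?thesis .
  qed
  ultimately have "C \<in> {c. (\<forall>\<theta>. c (\<theta> + 2 * pi) = c \<theta>) \<and> (\<exists>L. L-lipschitz_on UNIV c) \<and> integral {0..2 * pi} c = 0}" by blast
  then have cC: "curve (W1inf0_of C) = C" by (rule W1inf0_of_inverse)
  let ?c = "W1inf0_of C"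
  obtain B' where B': "AE \<theta> in circle. norm (tderiv ?c \<theta>) \<le> B'" using tderiv_bounded by blast
  \<comment> \<open>On one period \<open>C\<close> and \<open>K\<close> differ by a constant, so
    both derivatives have equal integrals over all \<open>{u..2 * pi}\<close>.\<close>
  have "AE \<theta> in circle. tderiv ?c \<theta> - k \<theta> = 0"
  proof (rule AE_zero_if_interval_integrals_zero)
    show "(\<lambda>\<theta>. tderiv ?c \<theta> - k \<theta>) \<in> borel_measurable circle"
      by (intro borel_measurable_diff tderiv_measurable m)
    show "AE \<theta> in circle. norm (tderiv ?c \<theta> - k \<theta>) \<le> B' + B"
      using B' B by eventually_elim (rule order_trans[OF norm_triangle_ineq4 add_mono])
    fix u :: real assume u: "0 \<le> u" "u \<le> 2 * pi"
    have "integral {u..2 * pi} (\<lambda>\<theta>. tderiv ?c \<theta> - k \<theta>) = integral {u..2 * pi} (tderiv ?c) - integral {u..2 * pi} k"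
      by (intro integral_diff subcircle(3)[OF tderiv_measurable B'] subcircle(3)[OF m B] u order_refl)
    also have "\<dots> = (C (2 * pi) - C u) - (K (2 * pi) - K u)"
      using integral_tderiv[OF u(2), of ?c] Kdiff[OF u] by (simp add: cC)
    also have "\<dots> = 0" using Cin[of u] Cin[of "2 * pi"] u by simp
    finally show "integral {u..2 * pi} (\<lambda>\<theta>. tderiv ?c \<theta> - k \<theta>) = 0" .
  qed simp
  then show ?thesis by (intro exI[of _ ?c]) (auto elim: eventually_mono)
qed

text \<open>There are countably many pairs of indices, so all pairwise bounds hold off one null set.
  There the derivatives are Cauchy pointwise, and letting one index tend to infinity gives the
  uniform estimate.\<close>

lemma tderiv_limit:
  fixes X :: "nat \<Rightarrow> 'n::finite W1inf0"
  assumes "Cauchy X"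
  obtains k where "k \<in> borel_measurable circle"
    "\<forall>e>0. \<exists>N. \<forall>n\<ge>N. AE \<theta> in circle. norm (tderiv (X n) \<theta> - k \<theta>) \<le> e"
proof -
  have ae: "AE \<theta> in circle. \<forall>n m. norm (tderiv (X n) \<theta> - tderiv (X m) \<theta>) \<le> norm (X n - X m)"
    unfolding AE_all_countable
  proof (intro allI)
    fix n m show "AE \<theta> in circle. norm (tderiv (X n) \<theta> - tderiv (X m) \<theta>) \<le> norm (X n - X m)"
      using tderiv_diff[of "X n" "X m"] tderiv_AE_norm[of "X n - X m"] by eventually_elim simp
  qed
  define k where "k \<theta> = lim (\<lambda>n. tderiv (X n) \<theta>)" for \<theta>
  have N: "\<exists>N. \<forall>n\<ge>N. \<forall>m\<ge>N. norm (X n - X m) < e" if "e > 0" for e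
    using assms that unfolding Cauchy_def dist_norm by blast
  show thesis
  proof (rule that[of k])
    show "k \<in> borel_measurable circle"
      unfolding k_def by (intro borel_measurable_lim_metric tderiv_measurable)
    show "\<forall>e>0. \<exists>N. \<forall>n\<ge>N. AE \<theta> in circle. norm (tderiv (X n) \<theta> - k \<theta>) \<le> e"
    proof (intro allI impI)
      fix e :: real assume "e > 0"
      then obtain M where M: "\<And>n m. n \<ge> M \<Longrightarrow> m \<ge> M \<Longrightarrow> norm (X n - X m) < e" using N by blast
      have "AE \<theta> in circle. norm (tderiv (X n) \<theta> - k \<theta>) \<le> e" if n: "n \<ge> M" for n
        using ae
      proof eventually_elim
        case (elim \<theta>)
        have "Cauchy (\<lambda>n. tderiv (X n) \<theta>)"
          unfolding Cauchy_def dist_norm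
        proof (intro allI impI)
          fix r :: real assume "r > 0"
          then obtain M where "\<forall>n\<ge>M. \<forall>m\<ge>M. norm (X n - X m) < r" using N by blast
          then show "\<exists>M. \<forall>m\<ge>M. \<forall>n\<ge>M. norm (tderiv (X m) \<theta> - tderiv (X n) \<theta>) < r"
            using elim by (meson order_le_less_trans)
        qed
        then have l: "(\<lambda>n. tderiv (X n) \<theta>) \<longlonglongrightarrow> k \<theta>"
          unfolding k_def by (simp add: Cauchy_convergent_iff convergent_LIMSEQ_iff)
        show ?case
        proof (rule Lim_bounded[where M = M])
          show "(\<lambda>m. norm (tderiv (X n) \<theta> - tderiv (X m) \<theta>)) \<longlonglongrightarrow> norm (tderiv (X n) \<theta> - k \<theta>)"
            by (intro tendsto_intros l)
          show "\<forall>m\<ge>M. norm (tderiv (X n) \<theta> - tderiv (X m) \<theta>) \<le> e"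
            using elim M[OF n] by (meson less_imp_le order_trans)
        qed
      qed
      then show "\<exists>N. \<forall>n\<ge>N. AE \<theta> in circle. norm (tderiv (X n) \<theta> - k \<theta>) \<le> e" by blast
    qed
  qed
qed

text \<open>The derivatives converge in L^infinity, their limit has a primitive in
  \<open>W1inf0\<close>, and by the Poincare inequality convergence of derivatives is convergence in
  norm.\<close>

instance W1inf0 :: (finite) banach
proof
  fix X :: "nat \<Rightarrow> 'a W1inf0" assume X: "Cauchy X"
  obtain k where k: "k \<in> borel_measurable circle"
    "\<forall>e>0. \<exists>N. \<forall>n\<ge>N. AE \<theta> in circle. norm (tderiv (X n) \<theta> - k \<theta>) \<le> e"
    by (rule tderiv_limit[OF X])
  have kb: "AE \<theta> in circle. norm (k \<theta>) \<le> norm (X n) + e"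
    if "AE \<theta> in circle. norm (tderiv (X n) \<theta> - k \<theta>) \<le> e" for n e
    using that tderiv_AE_norm[of "X n"]
  proof eventually_elim
    case (elim \<theta>)
    then show ?case
      using norm_triangle_sub[of "k \<theta>" "tderiv (X n) \<theta>"] norm_minus_commute[of "k \<theta>" "tderiv (X n) \<theta>"]
      by linarith
  qed
  obtain N0 where N0: "AE \<theta> in circle. norm (tderiv (X N0) \<theta> - k \<theta>) \<le> 1" using k(2)[rule_format, OF zero_less_one] by blast
  note B = kb[OF N0]
  \<comment> \<open>Derivatives of closed curves have mean zero, so the integral of the limit is
    bounded by its distance to any \<open>X n\<close>.\<close>
  have int0: "norm (integral {0..2 * pi} k) \<le> e * (2 * pi)" if e0: "e > 0" for e
  proof -
    obtain n where n: "AE \<theta> in circle. norm (tderiv (X n) \<theta> - k \<theta>) \<le> e" using k(2)[rule_format, OF e0] by blast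
    have "integral {0..2 * pi} (\<lambda>\<theta>. tderiv (X n) \<theta> - k \<theta>) = integral {0..2 * pi} (tderiv (X n)) - integral {0..2 * pi} k"
      by (intro integral_diff subcircle(3)[OF tderiv_measurable tderiv_AE_norm] subcircle(3)[OF k(1) B]) simp_all
    moreover have "norm (integral {0..2 * pi} (\<lambda>\<theta>. tderiv (X n) \<theta> - k \<theta>)) \<le> e * (2 * pi - 0)"
      by (intro integral_AE_bound n borel_measurable_diff tderiv_measurable k(1)) simp
    ultimately show ?thesis by (simp add: integral_circle_tderiv)
  qed
  have "norm (integral {0..2 * pi} k) \<le> 0 + e" if "e > 0" for e
  proof -
    have "norm (integral {0..2 * pi} k) \<le> e / (2 * pi) * (2 * pi)" using that by (intro int0) simp
    then show ?thesis by simp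
  qed
  then have "integral {0..2 * pi} k = 0" using field_le_epsilon[of "norm (integral {0..2 * pi} k)" 0] by simp
  then obtain c :: "'a W1inf0" where c: "AE \<theta> in circle. tderiv c \<theta> = k \<theta>"
    using W1inf0_primitive[OF k(1) B] by blast
  have "X \<longlonglongrightarrow> c"
  proof (rule LIMSEQ_I)
    fix e :: real assume e: "e > 0"
    \<comment> \<open>Divides out the constant of \<open>norm_W1inf0_le\<close>, and a further 2 for
      strictness.\<close>
    define e' where "e' = e / 2 / (1 + 2 * pi)"
    have P: "1 + 2 * pi > 0" by (simp add: add_pos_pos)
    then have "1 + 2 * pi \<noteq> 0" by simp
    then have "(1 + 2 * pi) * e' = e / 2"
      unfolding e'_def times_divide_eq_right[of _ "e / 2"] by (rule nonzero_mult_div_cancel_left)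
    with e P have e': "e' > 0" "(1 + 2 * pi) * e' < e" by (simp_all add: e'_def)
    obtain N where N: "\<And>n. n \<ge> N \<Longrightarrow> AE \<theta> in circle. norm (tderiv (X n) \<theta> - k \<theta>) \<le> e'" using k(2)[rule_format, OF e'(1)] by blast
    have "norm (X n - c) < e" if "n \<ge> N" for n
    proof -
      have "AE \<theta> in circle. norm (tderiv (X n - c) \<theta>) \<le> e'"
        using N[OF that] c tderiv_diff[of "X n" c] by eventually_elim simp
      from norm_W1inf0_le[OF this] e'(2) show ?thesis by linarith
    qed
    then show "\<exists>no. \<forall>n\<ge>no. norm (X n - c) < e" by blast
  qed
  then show "convergent X" by (rule convergentI)
qed

subsection \<open>Essentially bounded functions\<close>

text \<open>Essential boundedness with an explicit bound and values in any Euclidean space, so that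
  scalar and vector functions are treated alike; \<open>Linf_iff_bmeas\<close> relates it to
  \<open>Linf\<close>.\<close>

definition bmeas :: "(real \<Rightarrow> 'b::euclidean_space) \<Rightarrow> bool" where
  "bmeas k \<longleftrightarrow> k \<in> borel_measurable circle \<and> (\<exists>B. AE \<theta> in circle. norm (k \<theta>) \<le> B)"

lemma bmeasI: "k \<in> borel_measurable circle \<Longrightarrow> AE \<theta> in circle. norm (k \<theta>) \<le> B \<Longrightarrow> bmeas k"
  by (auto simp: bmeas_def)

lemma bmeas_integrable: "bmeas k \<Longrightarrow> integrable circle k"
  unfolding bmeas_def using circle_integral(1) by blast

lemma bmeas_bilinear:
  fixes f :: "real \<Rightarrow> 'b::euclidean_space" and g :: "real \<Rightarrow> 'c::euclidean_space" and b :: "'b \<Rightarrow> 'c \<Rightarrow> 'd::euclidean_space"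
  assumes b: "bounded_bilinear b" and f: "bmeas f" and g: "bmeas g"
  shows "bmeas (\<lambda>\<theta>. b (f \<theta>) (g \<theta>))"
proof -
  obtain K where K: "K > 0" "\<And>u v. norm (b u v) \<le> norm u * norm v * K"
    using bounded_bilinear.pos_bounded[OF b] by blast
  obtain A B where A: "AE \<theta> in circle. norm (f \<theta>) \<le> A" and B: "AE \<theta> in circle. norm (g \<theta>) \<le> B"
    using f g by (auto simp: bmeas_def)
  have fm: "f \<in> borel_measurable circle" and gm: "g \<in> borel_measurable circle" using f g by (auto simp: bmeas_def)
  have "continuous_on UNIV (\<lambda>p. b (fst p) (snd p))"
    by (intro bounded_bilinear.continuous_on[OF b] continuous_on_fst continuous_on_snd continuous_on_id)
  then have "(\<lambda>p. b (fst p) (snd p)) \<in> borel_measurable borel" by (rule borel_measurable_continuous_onI)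
  moreover have "(\<lambda>\<theta>. (f \<theta>, g \<theta>)) \<in> borel_measurable circle"
    by (intro borel_measurable_Pair fm gm)
  ultimately have "(\<lambda>\<theta>. b (fst (f \<theta>, g \<theta>)) (snd (f \<theta>, g \<theta>))) \<in> borel_measurable circle"
    by (rule measurable_compose[rotated])
  then have "(\<lambda>\<theta>. b (f \<theta>) (g \<theta>)) \<in> borel_measurable circle" by simp
  moreover have "AE \<theta> in circle. norm (b (f \<theta>) (g \<theta>)) \<le> A * B * K"
    using A B
  proof eventually_elim
    case (elim \<theta>)
    have "0 \<le> A" using elim(1) norm_ge_zero order_trans by blast
    then have "norm (f \<theta>) * norm (g \<theta>) * K \<le> A * B * K"
      using elim K(1) by (intro mult_right_mono mult_mono) auto
    with K(2) show ?case by (rule order_trans)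
  qed
  ultimately show ?thesis by (rule bmeasI)
qed

lemma bmeas_diff:
  assumes f: "bmeas f" and g: "bmeas g"
  shows "bmeas (\<lambda>\<theta>. f \<theta> - g \<theta>)"
proof -
  obtain A B where A: "AE \<theta> in circle. norm (f \<theta>) \<le> A" and B: "AE \<theta> in circle. norm (g \<theta>) \<le> B"
    using f g by (auto simp: bmeas_def)
  have "AE \<theta> in circle. norm (f \<theta> - g \<theta>) \<le> A + B"
    using A B by eventually_elim (rule order_trans[OF norm_triangle_ineq4 add_mono])
  then show ?thesis using f g by (auto simp: bmeas_def)
qed

lemma bmeas_const: "bmeas (\<lambda>_. v)"
  by (rule bmeasI[of _ "norm v"]) auto

lemma bmeas_tderiv: "bmeas (tderiv c)"
  by (rule bmeasI[OF tderiv_measurable tderiv_AE_norm])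

lemma bmeas_norm: "bmeas f \<Longrightarrow> bmeas (\<lambda>\<theta>. norm (f \<theta>))"
  by (auto simp: bmeas_def)

lemmas bmeas_scaleR = bmeas_bilinear[OF bounded_bilinear_scaleR]
  and bmeas_inner = bmeas_bilinear[OF bounded_bilinear_inner]

text \<open>\<open>L\<^sup>\<infinity>(S\<^sup>1; \<real>\<^sup>n)\<close> is realised as the Banach space \<open>W\<^sup>1\<^sup>,\<^sup>\<infinity>\<^sub>0 \<times> \<real>\<^sup>n\<close>: the pair \<open>(p, m)\<close>
  stands for the function \<open>p' + m\<close>, whose mean is \<open>m\<close>.  Scalar functions are stored with all
  components equal.\<close>

type_synonym 'n lrep = "'n W1inf0 \<times> (real ^ 'n)"

definition lfun :: "'n::finite lrep \<Rightarrow> real \<Rightarrow> real ^ 'n" where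
  "lfun a \<theta> = tderiv (fst a) \<theta> + snd a"

definition lrep_of :: "(real \<Rightarrow> real ^ 'n::finite) \<Rightarrow> 'n lrep" where
  "lrep_of k = (SOME a. AE \<theta> in circle. lfun a \<theta> = k \<theta>)"

lemma lfun_measurable: "lfun a \<in> borel_measurable circle"
  unfolding lfun_def by (intro borel_measurable_add tderiv_measurable borel_measurable_const)

lemma lfun_bound: "AE \<theta> in circle. norm (lfun a \<theta>) \<le> 2 * norm a"
  using tderiv_AE_norm[of "fst a"]
proof eventually_elim
  case (elim \<theta>)
  have "norm (fst a) \<le> norm a" "norm (snd a) \<le> norm a"
    using norm_fst_le[of "fst a" "snd a"] norm_snd_le[of "snd a" "fst a"] by simp_all
  then show ?case unfolding lfun_def using norm_triangle_ineq[of "tderiv (fst a) \<theta>" "snd a"] elim by linarith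
qed

lemma lfun_add: "AE \<theta> in circle. lfun (a + b) \<theta> = lfun a \<theta> + lfun b \<theta>"
  using tderiv_add[of "fst a" "fst b"] by eventually_elim (simp add: lfun_def)

lemma lfun_scaleR: "AE \<theta> in circle. lfun (r *\<^sub>R a) \<theta> = r *\<^sub>R lfun a \<theta>"
  using tderiv_scaleR[of r "fst a"] by eventually_elim (simp add: lfun_def scaleR_add_right)

lemma lfun_diff: "AE \<theta> in circle. lfun (a - b) \<theta> = lfun a \<theta> - lfun b \<theta>"
  using tderiv_diff[of "fst a" "fst b"] by eventually_elim (simp add: lfun_def)

lemma integral_lfun: "integral {0..2 * pi} (lfun a) = (2 * pi) *\<^sub>R snd a"
proof -
  have "integral {0..2 * pi} (\<lambda>\<theta>. tderiv (fst a) \<theta> + snd a) = integral {0..2 * pi} (tderiv (fst a)) + integral {0..2 * pi} (\<lambda>_. snd a)"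
    by (rule integral_add[OF subcircle(3)[OF tderiv_measurable tderiv_AE_norm] integrable_const_ivl]) simp_all
  then show ?thesis by (simp add: lfun_def[abs_def] integral_circle_tderiv)
qed

text \<open>If |p' + m| is at most B, then |m| is at most B and |p'| at most 2 B, so the Poincare
  constant 1 + 2 pi enters twice and the mean adds 1.\<close>

definition lrep_const :: real where "lrep_const = 2 * (1 + 2 * pi) + 1"

lemma lrep_const_pos: "lrep_const > 0"
  by (simp add: lrep_const_def add_pos_pos)

lemma norm_lrep_le:
  assumes B: "AE \<theta> in circle. norm (lfun a \<theta>) \<le> B"
  shows "norm a \<le> lrep_const * B"
proof -
  have "norm (integral {0..2 * pi} (lfun a)) \<le> B * (2 * pi - 0)"
    by (rule integral_AE_bound[OF lfun_measurable B]) simp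
  then have s: "norm (snd a) \<le> B" by (simp add: integral_lfun)
  have "AE \<theta> in circle. norm (tderiv (fst a) \<theta>) \<le> 2 * B"
    using B
  proof eventually_elim
    case (elim \<theta>)
    have "tderiv (fst a) \<theta> = lfun a \<theta> - snd a" by (simp add: lfun_def)
    then show ?case using norm_triangle_ineq4[of "lfun a \<theta>" "snd a"] elim s by simp
  qed
  then have "norm (fst a) \<le> (1 + 2 * pi) * (2 * B)" by (rule norm_W1inf0_le)
  moreover have "norm a \<le> norm (fst a) + norm (snd a)"
    using norm_Pair_le[of "fst a" "snd a"] by simp
  ultimately show ?thesis using s by (simp add: lrep_const_def algebra_simps)
qed

lemma lfun_eqI: "AE \<theta> in circle. lfun a \<theta> = lfun b \<theta> \<Longrightarrow> a = b"
proof -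
  assume e: "AE \<theta> in circle. lfun a \<theta> = lfun b \<theta>"
  have "AE \<theta> in circle. norm (lfun (a - b) \<theta>) \<le> 0" using e lfun_diff[of a b] by eventually_elim simp
  from norm_lrep_le[OF this] show "a = b" by simp
qed

text \<open>The mean goes into the second component; what remains has integral zero and is the
  derivative of an element of \<open>W1inf0\<close>.\<close>

lemma lfun_lrep_of:
  fixes k :: "real \<Rightarrow> real ^ 'n::finite"
  assumes m: "k \<in> borel_measurable circle" and B: "AE \<theta> in circle. norm (k \<theta>) \<le> B"
  shows "AE \<theta> in circle. lfun (lrep_of k) \<theta> = k \<theta>"
proof -
  define mean where "mean = (1 / (2 * pi)) *\<^sub>R integral {0..2 * pi} k"
  have "\<exists>c :: 'n W1inf0. AE \<theta> in circle. tderiv c \<theta> = k \<theta> - mean"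
  proof (rule W1inf0_primitive)
    show "(\<lambda>\<theta>. k \<theta> - mean) \<in> borel_measurable circle" by (intro borel_measurable_diff m borel_measurable_const)
    show "AE \<theta> in circle. norm (k \<theta> - mean) \<le> B + norm mean"
      using B by eventually_elim (rule order_trans[OF norm_triangle_ineq4 add_right_mono])
    have "integral {0..2 * pi} (\<lambda>\<theta>. k \<theta> - mean) = integral {0..2 * pi} k - integral {0..2 * pi} (\<lambda>_. mean)"
      by (rule integral_diff[OF subcircle(3)[OF m B] integrable_const_ivl]) simp_all
    then show "integral {0..2 * pi} (\<lambda>\<theta>. k \<theta> - mean) = 0" by (simp add: mean_def)
  qed
  then obtain c :: "'n W1inf0" where "AE \<theta> in circle. tderiv c \<theta> = k \<theta> - mean" by blast
  then have "AE \<theta> in circle. lfun (c, mean) \<theta> = k \<theta>" by eventually_elim (simp add: lfun_def)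
  then show ?thesis unfolding lrep_of_def by (rule someI)
qed

lemma lrep_of_eqI: "AE \<theta> in circle. lfun a \<theta> = k \<theta> \<Longrightarrow> lrep_of k = a"
proof -
  assume a: "AE \<theta> in circle. lfun a \<theta> = k \<theta>"
  then have "AE \<theta> in circle. lfun (lrep_of k) \<theta> = k \<theta>" unfolding lrep_of_def by (rule someI)
  with a have "AE \<theta> in circle. lfun (lrep_of k) \<theta> = lfun a \<theta>" by eventually_elim simp
  then show "lrep_of k = a" by (rule lfun_eqI)
qed

section \<open>Pointwise products of essentially bounded functions\<close>

definition lmul :: "(real ^ 'n \<Rightarrow> real ^ 'n \<Rightarrow> real ^ 'n) \<Rightarrow> 'n::finite lrep \<Rightarrow> 'n lrep \<Rightarrow> 'n lrep" where
  "lmul b x y = lrep_of (\<lambda>\<theta>. b (lfun x \<theta>) (lfun y \<theta>))"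

context
  fixes b :: "real ^ 'n::finite \<Rightarrow> real ^ 'n \<Rightarrow> real ^ 'n"
  assumes b: "bounded_bilinear b"
begin

lemma lfun_lmul: "AE \<theta> in circle. lfun (lmul b x y) \<theta> = b (lfun x \<theta>) (lfun y \<theta>)"
proof -
  have "bmeas (lfun x)" "bmeas (lfun y)" by (rule bmeasI[OF lfun_measurable lfun_bound])+
  from bmeas_bilinear[OF b this] show ?thesis unfolding lmul_def bmeas_def using lfun_lrep_of by blast
qed

lemma lmul_eqI: "AE \<theta> in circle. lfun z \<theta> = b (lfun x \<theta>) (lfun y \<theta>) \<Longrightarrow> lmul b x y = z"
  unfolding lmul_def by (rule lrep_of_eqI)

text \<open>The algebraic laws hold pointwise almost everywhere and pass to representatives because
  \<open>lfun\<close> is injective.\<close>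

lemma bounded_bilinear_lmul: "bounded_bilinear (lmul b)"
proof -
  interpret b: bounded_bilinear b by (rule b)
  obtain K where K: "K > 0" "\<And>u v. norm (b u v) \<le> norm u * norm v * K" using b.pos_bounded by blast
  show ?thesis
  proof (rule bounded_bilinear.intro)
    fix x x' y y' :: "'n lrep" and r :: real
    have "AE \<theta> in circle. lfun (lmul b x y + lmul b x' y) \<theta> = b (lfun (x + x') \<theta>) (lfun y \<theta>)"
      using lfun_add[of "lmul b x y" "lmul b x' y"] lfun_lmul[of x y] lfun_lmul[of x' y] lfun_add[of x x']
      by eventually_elim (simp add: b.add_left)
    then show "lmul b (x + x') y = lmul b x y + lmul b x' y" by (rule lmul_eqI)
    have "AE \<theta> in circle. lfun (lmul b x y + lmul b x y') \<theta> = b (lfun x \<theta>) (lfun (y + y') \<theta>)"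
      using lfun_add[of "lmul b x y" "lmul b x y'"] lfun_lmul[of x y] lfun_lmul[of x y'] lfun_add[of y y']
      by eventually_elim (simp add: b.add_right)
    then show "lmul b x (y + y') = lmul b x y + lmul b x y'" by (rule lmul_eqI)
    have "AE \<theta> in circle. lfun (r *\<^sub>R lmul b x y) \<theta> = b (lfun (r *\<^sub>R x) \<theta>) (lfun y \<theta>)"
      using lfun_scaleR[of r "lmul b x y"] lfun_lmul[of x y] lfun_scaleR[of r x]
      by eventually_elim (simp add: b.scaleR_left)
    then show "lmul b (r *\<^sub>R x) y = r *\<^sub>R lmul b x y" by (rule lmul_eqI)
    have "AE \<theta> in circle. lfun (r *\<^sub>R lmul b x y) \<theta> = b (lfun x \<theta>) (lfun (r *\<^sub>R y) \<theta>)"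
      using lfun_scaleR[of r "lmul b x y"] lfun_lmul[of x y] lfun_scaleR[of r y]
      by eventually_elim (simp add: b.scaleR_right)
    then show "lmul b x (r *\<^sub>R y) = r *\<^sub>R lmul b x y" by (rule lmul_eqI)
    show "\<exists>K. \<forall>x y. norm (lmul b x y) \<le> norm x * norm y * K"
    \<comment> \<open>The factor 4 comes from the factor 2 in \<open>lfun_bound\<close>, used for
      both arguments.\<close>
    proof (intro exI[of _ "lrep_const * (4 * K)"] allI)
      fix x y
      have "AE \<theta> in circle. norm (lfun (lmul b x y) \<theta>) \<le> (2 * norm x) * (2 * norm y) * K"
        using lfun_lmul[of x y] lfun_bound[of x] lfun_bound[of y]
      proof eventually_elim
        case (elim \<theta>)
        have "norm (lfun x \<theta>) * norm (lfun y \<theta>) * K \<le> (2 * norm x) * (2 * norm y) * K"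
          using elim K(1) by (intro mult_right_mono mult_mono) auto
        with K(2)[of "lfun x \<theta>" "lfun y \<theta>"] elim(1) show ?case by simp
      qed
      from norm_lrep_le[OF this] show "norm (lmul b x y) \<le> norm x * norm y * (lrep_const * (4 * K))"
        by (simp add: algebra_simps)
    qed
  qed
qed

end

text \<open>The inner product returned as a constant vector, so that multiplying it into a vector
  componentwise is scalar multiplication.\<close>

definition vdot :: "real ^ 'n::finite \<Rightarrow> real ^ 'n \<Rightarrow> real ^ 'n" where
  "vdot u v = (u \<bullet> v) *\<^sub>R 1"

lemma bounded_bilinear_vdot: "bounded_bilinear (vdot :: real ^ 'n::finite \<Rightarrow> real ^ 'n \<Rightarrow> real ^ 'n)"
  unfolding vdot_def bilinear_conv_bounded_bilinear[symmetric] bilinear_def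
  by (auto intro!: linearI simp: inner_left_distrib inner_right_distrib scaleR_add_left)

lemma bounded_bilinear_vtimes: "bounded_bilinear (\<lambda>u v :: real ^ 'n::finite. u * v)"
  unfolding bilinear_conv_bounded_bilinear[symmetric] bilinear_def
  by (auto intro!: linearI simp: vec_eq_iff algebra_simps)

abbreviation ldot :: "'n::finite lrep \<Rightarrow> 'n lrep \<Rightarrow> 'n lrep" where "ldot \<equiv> lmul vdot"
abbreviation ltimes :: "'n::finite lrep \<Rightarrow> 'n lrep \<Rightarrow> 'n lrep" where "ltimes \<equiv> lmul (\<lambda>u v. u * v)"

lemmas lfun_ldot = lfun_lmul[OF bounded_bilinear_vdot]
  and lfun_ltimes = lfun_lmul[OF bounded_bilinear_vtimes]

lemma scaled_one_times [simp]: "(r *\<^sub>R 1) * v = r *\<^sub>R v" for v :: "real ^ 'n::finite"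
  by (simp add: vec_eq_iff)

subsection \<open>The projection onto functions with vanishing integral\<close>

lemma immersionsE:
  assumes "c \<in> immersions"
  obtains m where "m > 0" "AE \<theta> in circle. m \<le> norm (tderiv c \<theta>)"
proof -
  let ?f = "\<lambda>\<theta>. - ereal (norm (tderiv c \<theta>))"
  have "0 < - esssup circle ?f" using assms by (simp add: immersions_def essinf_def)
  then obtain m where m: "0 < ereal m" "ereal m < - esssup circle ?f" using ereal_dense2 by blast
  have "AE \<theta> in circle. ?f \<theta> \<le> esssup circle ?f" by (rule esssup_AE)
  then have "AE \<theta> in circle. m \<le> norm (tderiv c \<theta>)"
  proof eventually_elim
    case (elim \<theta>)
    have "esssup circle ?f \<le> - ereal m"
      using less_imp_le[OF m(2)] ereal_minus_le_minus[of "- ereal m" "esssup circle ?f"] by simp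
    with elim have "- ereal (norm (tderiv c \<theta>)) \<le> - ereal m" by (rule order_trans)
    then show ?case by simp
  qed
  with m(1) show thesis by (intro that[of m]) simp_all
qed

lemma immersionsI:
  assumes m: "m > 0" and "AE \<theta> in circle. m \<le> norm (tderiv c \<theta>)"
  shows "c \<in> immersions"
proof -
  let ?f = "\<lambda>\<theta>. - ereal (norm (tderiv c \<theta>))"
  have "?f \<in> borel_measurable circle" using tderiv_measurable[of c] by measurable
  moreover have "AE \<theta> in circle. ?f \<theta> \<le> ereal (- m)" using assms(2) by eventually_elim simp
  ultimately have "esssup circle ?f \<le> ereal (- m)" by (rule esssup_I)
  then have le: "ereal m \<le> essinf circle (\<lambda>\<theta>. ereal (norm (tderiv c \<theta>)))"
    unfolding essinf_def using ereal_minus_le_minus[of "ereal (- m)" "esssup circle ?f"] by simp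
  have "0 < ereal m" using m by simp
  then have "0 < essinf circle (\<lambda>\<theta>. ereal (norm (tderiv c \<theta>)))" using le by (rule less_le_trans)
  then show ?thesis unfolding immersions_def by blast
qed

text \<open>A perturbation below m / 2 in norm changes the speed by less than m / 2 almost
  everywhere, which leaves the lower bound m / 2.\<close>

lemma open_immersions: "open (immersions :: 'n::finite W1inf0 set)"
proof (rule Topological_Spaces.openI)
  fix c :: "'n W1inf0" assume "c \<in> immersions"
  then obtain m where m: "m > 0" "AE \<theta> in circle. m \<le> norm (tderiv c \<theta>)" by (rule immersionsE)
  have "ball c (m / 2) \<subseteq> immersions"
  proof
    fix h assume "h \<in> ball c (m / 2)"
    then have h: "norm (c - h) < m / 2" by (simp add: dist_norm)
    have "AE \<theta> in circle. m / 2 \<le> norm (tderiv h \<theta>)"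
      using m(2) tderiv_AE_norm[of "c - h"] tderiv_diff[of c h]
    proof eventually_elim
      case (elim \<theta>)
      have "norm (tderiv c \<theta>) \<le> norm (tderiv h \<theta>) + norm (tderiv c \<theta> - tderiv h \<theta>)" by (rule norm_triangle_sub)
      then show ?case using elim h by simp
    qed
    then show "h \<in> immersions" by (rule immersionsI[rotated]) (use m in simp)
  qed
  then show "\<exists>T. open T \<and> c \<in> T \<and> T \<subseteq> immersions" using m by (intro exI[of _ "ball c (m / 2)"]) auto
qed

lemma Linf_iff_bmeas: "k \<in> Linf \<longleftrightarrow> bmeas k"
proof
  assume k: "k \<in> Linf"
  let ?s = "esssup circle (\<lambda>\<theta>. ereal (norm (k \<theta>)))"
  have "?s \<noteq> \<infinity>" using k by (auto simp: Linf_def)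
  then obtain n where n: "?s < ereal (real n)" using less_PInf_Ex_of_nat by blast
  have "AE \<theta> in circle. ereal (norm (k \<theta>)) \<le> ?s" by (rule esssup_AE)
  then have "AE \<theta> in circle. norm (k \<theta>) \<le> real n"
  proof eventually_elim
    case (elim \<theta>)
    have "ereal (norm (k \<theta>)) \<le> ereal (real n)" using elim n by (metis less_imp_le order_trans)
    then show ?case by simp
  qed
  then show "bmeas k" using k by (intro bmeasI) (auto simp: Linf_def)
next
  assume k: "bmeas k"
  then obtain B where B: "AE \<theta> in circle. norm (k \<theta>) \<le> B" by (auto simp: bmeas_def)
  have km: "k \<in> borel_measurable circle" using k by (simp add: bmeas_def)
  then have "(\<lambda>\<theta>. ereal (norm (k \<theta>))) \<in> borel_measurable circle" by measurable
  moreover have "AE \<theta> in circle. ereal (norm (k \<theta>)) \<le> ereal B" using B by eventually_elim simp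
  ultimately have "esssup circle (\<lambda>\<theta>. ereal (norm (k \<theta>))) \<le> ereal B" by (rule esssup_I)
  then have "esssup circle (\<lambda>\<theta>. ereal (norm (k \<theta>))) < \<infinity>" by (rule order_le_less_trans) simp
  then show "k \<in> Linf" using km by (simp add: Linf_def)
qed

lemma integral_ds:
  fixes f :: "real \<Rightarrow> 'b::euclidean_space"
  assumes "bmeas f"
  shows "(\<integral>\<theta>. f \<theta> \<partial>ds c) = (\<integral>\<theta>. norm (tderiv c \<theta>) *\<^sub>R f \<theta> \<partial>circle)"
proof -
  have "(\<lambda>\<theta>. norm (tderiv c \<theta>)) \<in> borel_measurable circle" using tderiv_measurable[of c] by measurable
  then show ?thesis
    unfolding ds_def using assms by (intro integral_density) (auto simp: bmeas_def)
qed

lemma bmeas_inverse_speed: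
  assumes "c \<in> immersions"
  shows "bmeas (\<lambda>\<theta>. inverse (norm (tderiv c \<theta>)))"
proof -
  obtain m where m: "m > 0" "AE \<theta> in circle. m \<le> norm (tderiv c \<theta>)" using assms by (rule immersionsE)
  show ?thesis
  proof (rule bmeasI)
    show "(\<lambda>\<theta>. inverse (norm (tderiv c \<theta>))) \<in> borel_measurable circle" using tderiv_measurable[of c] by measurable
    show "AE \<theta> in circle. norm (inverse (norm (tderiv c \<theta>))) \<le> inverse m"
      using m(2) by eventually_elim (use m(1) in \<open>simp add: le_imp_inverse_le\<close>)
  qed
qed

lemma bmeas_Ds: "c \<in> immersions \<Longrightarrow> bmeas (Ds c h)"
  unfolding Ds_def[abs_def] by (intro bmeas_scaleR bmeas_inverse_speed bmeas_tderiv)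

lemma speed_nonzero: "c \<in> immersions \<Longrightarrow> AE \<theta> in circle. 0 < norm (tderiv c \<theta>)"
  by (erule immersionsE) (auto elim!: eventually_mono)

lemma len_eq: "len c = (\<integral>\<theta>. norm (tderiv c \<theta>) \<partial>circle)"
  unfolding len_def using integral_ds[OF bmeas_const[of "1::real"], of c] by simp

lemma len_pos:
  assumes "c \<in> immersions"
  shows "len c > 0"
proof -
  obtain m where m: "m > 0" "AE \<theta> in circle. m \<le> norm (tderiv c \<theta>)" using assms by (rule immersionsE)
  have "(\<integral>\<theta>. m \<partial>circle) \<le> len c"
    unfolding len_eq
    by (rule integral_mono_AE[OF finite_measure.integrable_const[OF finite_measure_interval]
          bmeas_integrable[OF bmeas_norm[OF bmeas_tderiv]] m(2)])
  moreover have "(\<integral>\<theta>. m \<partial>circle) = m * (2 * pi)" by (simp add: measure_restrict_space)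
  ultimately show ?thesis using m(1) by (smt (verit) mult_pos_pos pi_gt_zero)
qed

text \<open>Subtracting the ds-mean is one orthogonal projection. Any two projections differ by an
  element of \<open>Linf0 c\<close> orthogonal to that space, hence to itself, and the speed is
  positive almost everywhere.\<close>

lemma proj0_eq:
  assumes c: "c \<in> immersions" and k: "bmeas k"
  shows "AE \<theta> in circle. proj0 c k \<theta> = k \<theta> - (1 / len c) *\<^sub>R (\<integral>\<theta>. k \<theta> \<partial>ds c)"
proof -
  define v where "v = (1 / len c) *\<^sub>R (\<integral>\<theta>. k \<theta> \<partial>ds c)"
  define p0 where "p0 \<theta> = k \<theta> - v" for \<theta>
  let ?s = "\<lambda>\<theta>. norm (tderiv c \<theta>)"
  note s = bmeas_norm[OF bmeas_tderiv[of c]]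
  have bp0: "bmeas p0" unfolding p0_def by (intro bmeas_diff bmeas_const k)
  have i: "integrable circle (\<lambda>\<theta>. ?s \<theta> *\<^sub>R f \<theta>)" if "bmeas f" for f :: "real \<Rightarrow> 'b::euclidean_space"
    by (intro bmeas_integrable bmeas_scaleR s that)
  have ds_diff: "(\<integral>\<theta>. f \<theta> - g \<theta> \<partial>ds c) = (\<integral>\<theta>. f \<theta> \<partial>ds c) - (\<integral>\<theta>. g \<theta> \<partial>ds c)"
    if "bmeas f" "bmeas g" for f g :: "real \<Rightarrow> 'b::euclidean_space"
    unfolding integral_ds[OF that(1)] integral_ds[OF that(2)] integral_ds[OF bmeas_diff[OF that]] scaleR_diff_right
    by (rule Bochner_Integration.integral_diff[OF i[OF that(1)] i[OF that(2)]])
  have ds_const: "(\<integral>\<theta>. v \<partial>ds c) = len c *\<^sub>R v"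
  proof -
    have "(\<integral>\<theta>. v \<partial>ds c) = (\<integral>\<theta>. ?s \<theta> *\<^sub>R v \<partial>circle)" by (rule integral_ds[OF bmeas_const])
    also have "\<dots> = (\<integral>\<theta>. ?s \<theta> \<partial>circle) *\<^sub>R v"
      by (rule integral_scaleR_left) (use bmeas_integrable[OF s] in simp)
    finally show ?thesis by (simp add: len_eq)
  qed
  have "(\<integral>\<theta>. p0 \<theta> \<partial>ds c) = 0"
    unfolding p0_def ds_diff[OF k bmeas_const] ds_const using len_pos[OF c] by (simp add: v_def)
  then have p0L: "p0 \<in> Linf0 c" using bp0 by (simp add: Linf0_def Linf_iff_bmeas)
  have orth: "(\<integral>\<theta>. (k \<theta> - p0 \<theta>) \<bullet> q \<theta> \<partial>ds c) = 0" if q: "q \<in> Linf0 c" for q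
  proof -
    have bq: "bmeas q" and zq: "(\<integral>\<theta>. q \<theta> \<partial>ds c) = 0" using q by (auto simp: Linf0_def Linf_iff_bmeas)
    have "(\<integral>\<theta>. (k \<theta> - p0 \<theta>) \<bullet> q \<theta> \<partial>ds c) = (\<integral>\<theta>. v \<bullet> q \<theta> \<partial>ds c)" by (simp add: p0_def)
    also have "\<dots> = (\<integral>\<theta>. ?s \<theta> *\<^sub>R (v \<bullet> q \<theta>) \<partial>circle)" by (rule integral_ds[OF bmeas_inner[OF bmeas_const bq]])
    also have "\<dots> = (\<integral>\<theta>. v \<bullet> (?s \<theta> *\<^sub>R q \<theta>) \<partial>circle)" by simp
    also have "\<dots> = v \<bullet> (\<integral>\<theta>. ?s \<theta> *\<^sub>R q \<theta> \<partial>circle)" by (rule integral_inner_right) (use i[OF bq] in simp)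
    also have "\<dots> = 0" using zq by (simp add: integral_ds[OF bq])
    finally show ?thesis .
  qed
  define p where "p = proj0 c k"
  have "p \<in> Linf0 c \<and> (\<forall>q\<in>Linf0 c. (\<integral>\<theta>. (k \<theta> - p \<theta>) \<bullet> q \<theta> \<partial>ds c) = 0)"
    unfolding p_def proj0_def by (rule someI[of _ p0]) (use p0L orth in blast)
  then have p: "p \<in> Linf0 c" "\<And>q. q \<in> Linf0 c \<Longrightarrow> (\<integral>\<theta>. (k \<theta> - p \<theta>) \<bullet> q \<theta> \<partial>ds c) = 0" by auto
  have bp: "bmeas p" and zp: "(\<integral>\<theta>. p \<theta> \<partial>ds c) = 0" using p(1) by (auto simp: Linf0_def Linf_iff_bmeas)
  \<comment> \<open>The difference of the two projections is itself an admissible test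
    function.\<close>
  define q where "q \<theta> = p0 \<theta> - p \<theta>" for \<theta>
  have bq: "bmeas q" unfolding q_def by (intro bmeas_diff bp0 bp)
  have qL: "q \<in> Linf0 c"
    using bq ds_diff[OF bp0 bp, folded q_def] zp p0L by (simp add: Linf0_def Linf_iff_bmeas)
  have "(\<integral>\<theta>. (k \<theta> - p \<theta>) \<bullet> q \<theta> - (k \<theta> - p0 \<theta>) \<bullet> q \<theta> \<partial>ds c) = 0"
    by (subst ds_diff) (use p(2)[OF qL] orth[OF qL] in \<open>auto intro!: bmeas_inner bmeas_diff k bp bp0 bq\<close>)
  then have "(\<integral>\<theta>. q \<theta> \<bullet> q \<theta> \<partial>ds c) = 0" by (simp add: q_def inner_diff_left)
  then have "(\<integral>\<theta>. ?s \<theta> *\<^sub>R (q \<theta> \<bullet> q \<theta>) \<partial>circle) = 0" by (simp only: integral_ds[OF bmeas_inner[OF bq bq]])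
  then have "AE \<theta> in circle. ?s \<theta> *\<^sub>R (q \<theta> \<bullet> q \<theta>) = 0"
    using i[OF bmeas_inner[OF bq bq]] by (subst (asm) integral_nonneg_eq_0_iff_AE) auto
  with speed_nonzero[OF c] have "AE \<theta> in circle. p \<theta> = k \<theta> - v"
    by eventually_elim (simp add: q_def p0_def)
  then show ?thesis by (simp add: p_def v_def)
qed

subsection \<open>The geodesic equation in terms of bilinear operations\<close>

definition lder :: "'n::finite W1inf0 \<Rightarrow> 'n lrep" where "lder c = (c, 0)"

lemma lfun_lder: "lfun (lder c) \<theta> = tderiv c \<theta>"
  by (simp add: lfun_def lder_def)

lemma bounded_linear_lder: "bounded_linear lder"
  unfolding lder_def by (intro bounded_linear_Pair bounded_linear_ident bounded_linear_zero)

definition lconst :: "real ^ 'n \<Rightarrow> 'n::finite lrep" where "lconst v = (0, v)"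

lemma lfun_lconst: "AE \<theta> in circle. lfun (lconst v) \<theta> = v"
  using tderiv_scaleR[of 0 0] by eventually_elim (simp add: lfun_def lconst_def)

lemma bounded_linear_lconst: "bounded_linear lconst"
  unfolding lconst_def by (intro bounded_linear_Pair bounded_linear_ident bounded_linear_zero)

text \<open>The mean of a scalar function. All components of \<open>snd a\<close> are then equal,
  and averaging them gives a linear functional on the whole space.\<close>

definition lavg :: "'n::finite lrep \<Rightarrow> real" where
  "lavg a = (snd a \<bullet> 1) / real CARD('n)"

lemma bounded_linear_lavg: "bounded_linear (lavg :: 'n::finite lrep \<Rightarrow> real)"
  unfolding lavg_def
  by (intro bounded_linear_compose[OF bounded_linear_divide] bounded_linear_inner_left_comp bounded_linear_snd)

lemma one_inner_one: "(1 :: real ^ 'n::finite) \<bullet> 1 = real CARD('n)"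
  by (simp add: inner_vec_def)

lemma lavg_eq:
  assumes "AE \<theta> in circle. lfun a \<theta> = s \<theta> *\<^sub>R (1 :: real ^ 'n::finite)" "bmeas s"
  shows "(\<integral>\<theta>. s \<theta> \<partial>circle) = 2 * pi * lavg a"
proof -
  have bf: "bmeas (lfun a)" by (rule bmeasI[OF lfun_measurable lfun_bound])
  have "(\<integral>\<theta>. lfun a \<theta> \<bullet> 1 \<partial>circle) = integral\<^sup>L circle (lfun a) \<bullet> 1"
    by (rule integral_inner_left) (use bmeas_integrable[OF bf] in simp)
  also have "integral\<^sup>L circle (lfun a) = (2 * pi) *\<^sub>R snd a"
    using circle_integral(2)[OF lfun_measurable lfun_bound, of a] by (simp add: integral_lfun)
  finally have 1: "(\<integral>\<theta>. lfun a \<theta> \<bullet> 1 \<partial>circle) = 2 * pi * (real CARD('n) * lavg a)" by (simp add: lavg_def)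
  have "(\<integral>\<theta>. lfun a \<theta> \<bullet> 1 \<partial>circle) = (\<integral>\<theta>. real CARD('n) * s \<theta> \<partial>circle)"
  proof (rule integral_cong_AE)
    show "(\<lambda>\<theta>. lfun a \<theta> \<bullet> 1) \<in> borel_measurable circle"
      using bmeas_inner[OF bf bmeas_const] by (simp add: bmeas_def)
    show "(\<lambda>\<theta>. real CARD('n) * s \<theta>) \<in> borel_measurable circle"
      using bmeas_scaleR[OF bmeas_const assms(2), of "real CARD('n)"] by (simp add: bmeas_def)
    show "AE \<theta> in circle. lfun a \<theta> \<bullet> 1 = real CARD('n) * s \<theta>"
      using assms(1) by eventually_elim (simp add: one_inner_one)
  qed
  also have "\<dots> = real CARD('n) * (\<integral>\<theta>. s \<theta> \<partial>circle)" by simp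
  finally show ?thesis using 1 by simp
qed

definition rspeed :: "'n::finite W1inf0 \<Rightarrow> 'n lrep" where
  "rspeed c = lrep_of (\<lambda>\<theta>. inverse (norm (tderiv c \<theta>)) *\<^sub>R 1)"

text \<open>Written as |c_\<theta>|^2 / |c_\<theta>|, so that \<open>rspeed\<close> is the one
  non-polynomial ingredient whose smoothness has to be shown.\<close>

definition speed :: "'n::finite W1inf0 \<Rightarrow> 'n lrep" where
  "speed c = ltimes (rspeed c) (ldot (lder c) (lder c))"

lemma lfun_rspeed:
  assumes "c \<in> immersions"
  shows "AE \<theta> in circle. lfun (rspeed c) \<theta> = inverse (norm (tderiv c \<theta>)) *\<^sub>R 1"
proof -
  have "bmeas (\<lambda>\<theta>. inverse (norm (tderiv c \<theta>)) *\<^sub>R (1 :: real ^ 'a))"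
    by (intro bmeas_scaleR bmeas_inverse_speed assms bmeas_const)
  then show ?thesis unfolding rspeed_def bmeas_def using lfun_lrep_of by blast
qed

lemma lfun_speed:
  assumes "c \<in> immersions"
  shows "AE \<theta> in circle. lfun (speed c) \<theta> = norm (tderiv c \<theta>) *\<^sub>R 1"
  using lfun_rspeed[OF assms] lfun_ltimes[of "rspeed c" "ldot (lder c) (lder c)"] lfun_ldot[of "lder c" "lder c"] speed_nonzero[OF assms]
proof eventually_elim
  case (elim \<theta>)
  then show ?case
    by (simp add: speed_def vdot_def lfun_lder dot_square_norm power2_eq_square)
qed

lemma len_eq_speed: "c \<in> immersions \<Longrightarrow> len c = 2 * pi * lavg (speed c)"
  unfolding len_eq by (rule lavg_eq[OF lfun_speed bmeas_norm[OF bmeas_tderiv]])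

lemma lavg_speed_pos: "c \<in> immersions \<Longrightarrow> lavg (speed c) > 0"
  using len_pos[of c] by (simp add: len_eq_speed zero_less_mult_iff)

text \<open>ds cancels one of the two factors 1/|c_\<theta>|, and 2 pi cancels between the length
  and the integral.\<close>

definition gmetric :: "'n::finite W1inf0 \<Rightarrow> 'n W1inf0 \<Rightarrow> 'n W1inf0 \<Rightarrow> real" where
  "gmetric c h k = inverse (lavg (speed c)) * lavg (ltimes (rspeed c) (ldot (lder h) (lder k)))"

lemma metric_G_eq:
  assumes c: "c \<in> immersions"
  shows "metric_G c h k = gmetric c h k"
proof -
  let ?r = "\<lambda>\<theta>. inverse (norm (tderiv c \<theta>))"
  have b: "bmeas (\<lambda>\<theta>. ?r \<theta> *\<^sub>R (tderiv h \<theta> \<bullet> tderiv k \<theta>))"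
    by (intro bmeas_scaleR bmeas_inner bmeas_inverse_speed[OF c] bmeas_tderiv)
  have bd: "bmeas (\<lambda>\<theta>. Ds c h \<theta> \<bullet> Ds c k \<theta>)" by (intro bmeas_inner bmeas_Ds c)
  have "(\<integral>\<theta>. Ds c h \<theta> \<bullet> Ds c k \<theta> \<partial>ds c) = (\<integral>\<theta>. norm (tderiv c \<theta>) *\<^sub>R (Ds c h \<theta> \<bullet> Ds c k \<theta>) \<partial>circle)"
    by (rule integral_ds[OF bd])
  also have "\<dots> = (\<integral>\<theta>. ?r \<theta> *\<^sub>R (tderiv h \<theta> \<bullet> tderiv k \<theta>) \<partial>circle)"
  proof (rule integral_cong_AE)
    show "(\<lambda>\<theta>. norm (tderiv c \<theta>) *\<^sub>R (Ds c h \<theta> \<bullet> Ds c k \<theta>)) \<in> borel_measurable circle"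
      using bmeas_scaleR[OF bmeas_norm[OF bmeas_tderiv[of c]] bd] by (simp add: bmeas_def)
    show "(\<lambda>\<theta>. ?r \<theta> *\<^sub>R (tderiv h \<theta> \<bullet> tderiv k \<theta>)) \<in> borel_measurable circle" using b by (simp add: bmeas_def)
    show "AE \<theta> in circle. norm (tderiv c \<theta>) *\<^sub>R (Ds c h \<theta> \<bullet> Ds c k \<theta>) = ?r \<theta> *\<^sub>R (tderiv h \<theta> \<bullet> tderiv k \<theta>)"
      using speed_nonzero[OF c] by eventually_elim (simp add: Ds_def)
  qed
  also have "\<dots> = 2 * pi * lavg (ltimes (rspeed c) (ldot (lder h) (lder k)))"
  proof (rule lavg_eq[OF _ b])
    show "AE \<theta> in circle. lfun (ltimes (rspeed c) (ldot (lder h) (lder k))) \<theta> = (?r \<theta> *\<^sub>R (tderiv h \<theta> \<bullet> tderiv k \<theta>)) *\<^sub>R 1"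
      using lfun_rspeed[OF c] lfun_ltimes[of "rspeed c" "ldot (lder h) (lder k)"] lfun_ldot[of "lder h" "lder k"]
      by eventually_elim (simp add: vdot_def lfun_lder)
  qed
  finally show ?thesis
    using lavg_speed_pos[OF c] by (simp add: metric_G_def gmetric_def len_eq_speed[OF c] field_simps)
qed

text \<open>The argument of the projection times |c_\<theta>|, the density of ds: of the three
  factors 1/|c_\<theta>| hidden in the D_s, two remain.\<close>

definition kforce :: "'n::finite W1inf0 \<Rightarrow> 'n W1inf0 \<Rightarrow> 'n lrep" where
  "kforce c h = ltimes (rspeed c) (ltimes (rspeed c)
     (ltimes (ldot (lder c) (lder h)) (lder h) - (1/2) *\<^sub>R ltimes (ldot (lder h) (lder h)) (lder c)))"

text \<open>With v the ds-mean of k, D_s g = k - v means g_\<theta> = |c_\<theta>| (k - v). So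
  inverting D_s is taking a primitive, which \<open>fst\<close> extracts from a representative of
  mean zero.\<close>

definition grhs :: "'n::finite W1inf0 \<Rightarrow> 'n W1inf0 \<Rightarrow> 'n W1inf0" where
  "grhs c h = gmetric c c h *\<^sub>R h - (1/2 * gmetric c h h) *\<^sub>R c
     + fst (kforce c h - inverse (lavg (speed c)) *\<^sub>R ltimes (speed c) (lconst (snd (kforce c h))))"

lemma geodesic_rhs_eq:
  fixes c h :: "'n::finite W1inf0"
  assumes c: "c \<in> immersions"
  shows "geodesic_rhs c h = grhs c h"
proof -
  let ?s = "\<lambda>\<theta>. norm (tderiv c \<theta>)"
  define k where "k \<theta> = (Ds c c \<theta> \<bullet> Ds c h \<theta>) *\<^sub>R Ds c h \<theta> - (1/2 * (norm (Ds c h \<theta>))\<^sup>2) *\<^sub>R Ds c c \<theta>" for \<theta>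
  have bk: "bmeas k"
  proof -
    have "bmeas (\<lambda>\<theta>. (Ds c c \<theta> \<bullet> Ds c h \<theta>) *\<^sub>R Ds c h \<theta> - ((1/2) *\<^sub>R (Ds c h \<theta> \<bullet> Ds c h \<theta>)) *\<^sub>R Ds c c \<theta>)"
      by (intro bmeas_diff bmeas_scaleR bmeas_inner bmeas_const bmeas_Ds c)
    then show ?thesis by (simp add: k_def[abs_def] dot_square_norm)
  qed
  have kf: "AE \<theta> in circle. lfun (kforce c h) \<theta> = ?s \<theta> *\<^sub>R k \<theta>"
  proof -
    let ?a = "ltimes (ldot (lder c) (lder h)) (lder h)" and ?b = "ltimes (ldot (lder h) (lder h)) (lder c)"
    show ?thesis
      using lfun_ltimes[of "rspeed c" "ltimes (rspeed c) (?a - (1/2) *\<^sub>R ?b)"] lfun_ltimes[of "rspeed c" "?a - (1/2) *\<^sub>R ?b"]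
        lfun_diff[of ?a "(1/2) *\<^sub>R ?b"] lfun_scaleR[of "1/2" ?b] lfun_ltimes[of "ldot (lder c) (lder h)" "lder h"]
        lfun_ltimes[of "ldot (lder h) (lder h)" "lder c"] lfun_ldot[of "lder c" "lder h"] lfun_ldot[of "lder h" "lder h"]
        lfun_rspeed[OF c] speed_nonzero[OF c]
    proof eventually_elim
      case (elim \<theta>)
      let ?i = "inverse (?s \<theta>)"
      have "lfun (kforce c h) \<theta> = ?i *\<^sub>R ?i *\<^sub>R ((tderiv c \<theta> \<bullet> tderiv h \<theta>) *\<^sub>R tderiv h \<theta> - (1/2) *\<^sub>R (tderiv h \<theta> \<bullet> tderiv h \<theta>) *\<^sub>R tderiv c \<theta>)"
        using elim by (simp add: kforce_def vdot_def lfun_lder)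
      also have "\<dots> = ?s \<theta> *\<^sub>R k \<theta>"
        using elim(10) by (simp add: k_def Ds_def scaleR_diff_right dot_square_norm power2_eq_square field_simps)
      finally show ?case .
    qed
  qed
  have int: "(\<integral>\<theta>. k \<theta> \<partial>ds c) = (2 * pi) *\<^sub>R snd (kforce c h)"
  proof -
    have "(\<integral>\<theta>. k \<theta> \<partial>ds c) = (\<integral>\<theta>. ?s \<theta> *\<^sub>R k \<theta> \<partial>circle)" by (rule integral_ds[OF bk])
    also have "\<dots> = (\<integral>\<theta>. lfun (kforce c h) \<theta> \<partial>circle)"
    proof (rule integral_cong_AE)
      show "(\<lambda>\<theta>. ?s \<theta> *\<^sub>R k \<theta>) \<in> borel_measurable circle"
        using bmeas_scaleR[OF bmeas_norm[OF bmeas_tderiv[of c]] bk] by (simp add: bmeas_def)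
      show "AE \<theta> in circle. ?s \<theta> *\<^sub>R k \<theta> = lfun (kforce c h) \<theta>" using kf by eventually_elim simp
    qed (rule lfun_measurable)
    also have "\<dots> = (2 * pi) *\<^sub>R snd (kforce c h)"
      using circle_integral(2)[OF lfun_measurable lfun_bound, of "kforce c h"] by (simp add: integral_lfun)
    finally show ?thesis .
  qed
  define v where "v = inverse (lavg (speed c)) *\<^sub>R snd (kforce c h)"
  have v: "(1 / len c) *\<^sub>R (\<integral>\<theta>. k \<theta> \<partial>ds c) = v"
    using lavg_speed_pos[OF c] by (simp add: int len_eq_speed[OF c] v_def field_simps)
  define z where "z = kforce c h - inverse (lavg (speed c)) *\<^sub>R ltimes (speed c) (lconst (snd (kforce c h)))"
  have fz: "AE \<theta> in circle. lfun z \<theta> = ?s \<theta> *\<^sub>R (k \<theta> - v)"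
    using kf lfun_diff[of "kforce c h" "inverse (lavg (speed c)) *\<^sub>R ltimes (speed c) (lconst (snd (kforce c h)))"]
      lfun_scaleR[of "inverse (lavg (speed c))" "ltimes (speed c) (lconst (snd (kforce c h)))"]
      lfun_ltimes[of "speed c" "lconst (snd (kforce c h))"] lfun_lconst[of "snd (kforce c h)"] lfun_speed[OF c]
    by eventually_elim (simp add: z_def v_def scaleR_diff_right)
  \<comment> \<open>Only with vanishing mean component is the function represented by
    \<open>z\<close> the derivative of \<open>fst z\<close>.\<close>
  have z0: "snd z = 0"
  proof -
    have bkv: "bmeas (\<lambda>\<theta>. k \<theta> - v)" by (intro bmeas_diff bk bmeas_const)
    have "(2 * pi) *\<^sub>R snd z = (\<integral>\<theta>. lfun z \<theta> \<partial>circle)"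
      using circle_integral(2)[OF lfun_measurable lfun_bound, of z] by (simp add: integral_lfun)
    also have "\<dots> = (\<integral>\<theta>. ?s \<theta> *\<^sub>R (k \<theta> - v) \<partial>circle)"
    proof (rule integral_cong_AE[OF lfun_measurable _ fz])
      show "(\<lambda>\<theta>. ?s \<theta> *\<^sub>R (k \<theta> - v)) \<in> borel_measurable circle"
        using bmeas_scaleR[OF bmeas_norm[OF bmeas_tderiv[of c]] bkv] by (simp add: bmeas_def)
    qed
    also have "\<dots> = (\<integral>\<theta>. ?s \<theta> *\<^sub>R k \<theta> - ?s \<theta> *\<^sub>R v \<partial>circle)" by (simp add: scaleR_diff_right)
    also have "\<dots> = (\<integral>\<theta>. ?s \<theta> *\<^sub>R k \<theta> \<partial>circle) - (\<integral>\<theta>. ?s \<theta> *\<^sub>R v \<partial>circle)"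
      by (intro Bochner_Integration.integral_diff bmeas_integrable bmeas_scaleR bmeas_norm bmeas_tderiv bk bmeas_const)
    also have "(\<integral>\<theta>. ?s \<theta> *\<^sub>R k \<theta> \<partial>circle) = (2 * pi) *\<^sub>R snd (kforce c h)"
      using int integral_ds[OF bk, of c] by simp
    also have "(\<integral>\<theta>. ?s \<theta> *\<^sub>R v \<partial>circle) = len c *\<^sub>R v"
      unfolding len_eq by (rule integral_scaleR_left) (rule bmeas_integrable[OF bmeas_norm[OF bmeas_tderiv]])
    also have "\<dots> = (2 * pi) *\<^sub>R snd (kforce c h)" using lavg_speed_pos[OF c] by (simp add: len_eq_speed[OF c] v_def)
    finally show ?thesis by simp
  qed
  have Dz: "AE \<theta> in circle. Ds c (fst z) \<theta> = proj0 c k \<theta>"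
    using fz proj0_eq[OF c bk] speed_nonzero[OF c]
  proof eventually_elim
    case (elim \<theta>)
    have "tderiv (fst z) \<theta> = ?s \<theta> *\<^sub>R (k \<theta> - v)" using elim(1) z0 by (simp add: lfun_def)
    then show ?case using elim(2,3) by (simp add: Ds_def v)
  qed
  have "Ds_inv c (proj0 c k) = fst z"
    unfolding Ds_inv_def
  proof (rule the_equality)
    show "AE \<theta> in circle. Ds c (fst z) \<theta> = proj0 c k \<theta>" by (rule Dz)
    \<comment> \<open>Uniqueness makes the definite description in \<open>Ds_inv\<close> meaningful:
      positive speed can be cancelled, and the derivative determines an element of mean
      zero.\<close>
    fix g assume "AE \<theta> in circle. Ds c g \<theta> = proj0 c k \<theta>"
    with Dz speed_nonzero[OF c] have "AE \<theta> in circle. lfun (lder g) \<theta> = lfun (lder (fst z)) \<theta>"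
    proof eventually_elim
      case (elim \<theta>)
      have "inverse (?s \<theta>) *\<^sub>R tderiv g \<theta> = inverse (?s \<theta>) *\<^sub>R tderiv (fst z) \<theta>"
        using elim(3)[folded elim(1)] by (simp only: Ds_def)
      then show ?case using elim(2) by (simp add: lfun_lder)
    qed
    then have "lder g = lder (fst z)" by (rule lfun_eqI)
    then show "g = fst z" by (simp add: lder_def)
  qed
  then show ?thesis
    unfolding geodesic_rhs_def grhs_def k_def[abs_def] z_def by (simp add: metric_G_eq[OF c])
qed

subsection \<open>Smoothness of the geodesic equation\<close>

lemma kdiff_comp_fst:
  assumes "open S" "kdiff k S f"
  shows "kdiff k (S \<times> UNIV) (\<lambda>p. f (fst p))"
  by (rule kdiff_comp[OF open_Times[OF assms(1) open_UNIV] assms(1)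
        kdiff_linear[OF open_Times[OF assms(1) open_UNIV] bounded_linear_fst] assms(2)]) auto

text \<open>The derivative is polynomial in the inverse and the direction, so each order yields the
  next.\<close>

lemma csmooth_inverse_real: "csmooth {0<..} (inverse :: real \<Rightarrow> real)"
proof -
  have "kdiff k {0<..} (inverse :: real \<Rightarrow> real)" for k
  proof (induction k)
    case (Suc k)
    have o: "open ({0<..} \<times> (UNIV :: real set) :: (real \<times> real) set)" by (intro open_Times) auto
    have i: "kdiff k ({0<..} \<times> UNIV) (\<lambda>p :: real \<times> real. inverse (fst p))"
      by (rule kdiff_comp_fst[OF open_greaterThan Suc])
    show ?case
    proof (rule kdiff_SucI)
      show "(inverse has_derivative (\<lambda>h. - (inverse x * h * inverse x))) (at x)" if "x \<in> {0<..}" for x :: real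
        by (rule has_derivative_inverse') (use that in auto)
      show "kdiff k ({0<..} \<times> UNIV) (\<lambda>p :: real \<times> real. - (inverse (fst p) * snd p * inverse (fst p)))"
        by (intro kdiff_uminus[OF o] kdiff_bilinear[OF bounded_bilinear_mult o] i kdiff_linear[OF o bounded_linear_snd])
    qed simp
  qed simp
  then show ?thesis by (simp add: csmooth_def)
qed

text \<open>A constant depending only on the lower bound \<open>m\<close> lets this pointwise
  estimate pass to the L^infinity norm. The 3 leaves room for 1/2 + 2, the two contributions to the
  remainder.\<close>

lemma inverse_norm_expansion:
  fixes x y :: "'a::real_inner"
  assumes m: "m > 0" and x: "m \<le> norm x" and h: "norm (y - x) \<le> m / 2"
  shows "\<bar>inverse (norm y) - inverse (norm x) + inverse (norm x) ^ 3 * (x \<bullet> (y - x))\<bar> \<le> 3 / m ^ 3 * (norm (y - x))\<^sup>2"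
proof -
  define a b d where "a = norm x" and "b = norm y" and "d = norm (y - x)"
  have ab: "\<bar>b - a\<bar> \<le> d" unfolding a_def b_def d_def by (rule norm_triangle_ineq3)
  have a: "a \<ge> m" "a > 0" using x m by (auto simp: a_def)
  have b: "b \<ge> m / 2" "b > 0" using ab h a m by (auto simp: d_def)
  have "(norm y)\<^sup>2 = a\<^sup>2 + 2 * (x \<bullet> (y - x)) + d\<^sup>2"
    by (simp add: a_def d_def power2_norm_eq_inner inner_diff inner_commute algebra_simps)
  \<comment> \<open>Expressing the inner product by norms leaves an exact rational identity in the
    real numbers a, b, d.\<close>
  then have e: "x \<bullet> (y - x) = (b\<^sup>2 - a\<^sup>2 - d\<^sup>2) / 2" by (simp add: b_def)
  have "inverse b - inverse a + inverse a ^ 3 * (x \<bullet> (y - x))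
      = (b - a)\<^sup>2 * (1 / (2 * a ^ 3) + 1 / (a\<^sup>2 * b)) - d\<^sup>2 * (1 / (2 * a ^ 3))"
    unfolding e using a b by (simp add: field_simps power2_eq_square power3_eq_cube)
  moreover have "1 / (2 * a ^ 3) \<le> 1 / (2 * m ^ 3)"
    using a m by (intro divide_left_mono mult_left_mono power_mono) auto
  moreover have "1 / (a\<^sup>2 * b) \<le> 2 / m ^ 3"
  proof -
    have "m\<^sup>2 * (m / 2) \<le> a\<^sup>2 * b" using a b m by (intro mult_mono power_mono) auto
    then have "1 / (a\<^sup>2 * b) \<le> 1 / (m\<^sup>2 * (m / 2))" using a b m by (intro divide_left_mono) auto
    also have "\<dots> = 2 / m ^ 3" by (simp add: power2_eq_square power3_eq_cube)
    finally show ?thesis .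
  qed
  moreover have "(b - a)\<^sup>2 \<le> d\<^sup>2" using ab by (simp add: abs_le_square_iff[symmetric])
  ultimately have "inverse b - inverse a + inverse a ^ 3 * (x \<bullet> (y - x)) \<le> d\<^sup>2 * (1 / (2 * m ^ 3) + 2 / m ^ 3)"
    and "- (d\<^sup>2 * (1 / (2 * m ^ 3))) \<le> inverse b - inverse a + inverse a ^ 3 * (x \<bullet> (y - x))"
  proof -
    assume eq: "inverse b - inverse a + inverse a ^ 3 * (x \<bullet> (y - x))
        = (b - a)\<^sup>2 * (1 / (2 * a ^ 3) + 1 / (a\<^sup>2 * b)) - d\<^sup>2 * (1 / (2 * a ^ 3))"
      and 1: "1 / (2 * a ^ 3) \<le> 1 / (2 * m ^ 3)" and 2: "1 / (a\<^sup>2 * b) \<le> 2 / m ^ 3" and 3: "(b - a)\<^sup>2 \<le> d\<^sup>2"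
    have p: "0 \<le> 1 / (2 * a ^ 3)" "0 \<le> 1 / (a\<^sup>2 * b)" using a b by auto
    have "(b - a)\<^sup>2 * (1 / (2 * a ^ 3) + 1 / (a\<^sup>2 * b)) \<le> d\<^sup>2 * (1 / (2 * m ^ 3) + 2 / m ^ 3)"
      using 1 2 3 p by (intro mult_mono add_mono) auto
    moreover have "0 \<le> d\<^sup>2 * (1 / (2 * a ^ 3))" using p by simp
    ultimately show "inverse b - inverse a + inverse a ^ 3 * (x \<bullet> (y - x)) \<le> d\<^sup>2 * (1 / (2 * m ^ 3) + 2 / m ^ 3)"
      unfolding eq by linarith
    have "d\<^sup>2 * (1 / (2 * a ^ 3)) \<le> d\<^sup>2 * (1 / (2 * m ^ 3))" using 1 by (intro mult_left_mono) auto
    moreover have "0 \<le> (b - a)\<^sup>2 * (1 / (2 * a ^ 3) + 1 / (a\<^sup>2 * b))" using p by simp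
    ultimately show "- (d\<^sup>2 * (1 / (2 * m ^ 3))) \<le> inverse b - inverse a + inverse a ^ 3 * (x \<bullet> (y - x))"
      unfolding eq by linarith
  qed
  moreover have "d\<^sup>2 * (1 / (2 * m ^ 3) + 2 / m ^ 3) \<le> 3 / m ^ 3 * d\<^sup>2" "d\<^sup>2 * (1 / (2 * m ^ 3)) \<le> 3 / m ^ 3 * d\<^sup>2"
    using m by (auto simp: field_simps)
  ultimately show ?thesis unfolding a_def[symmetric] b_def[symmetric] d_def[symmetric] by linarith
qed

text \<open>The formal derivative - <c_\<theta>, h_\<theta>> / |c_\<theta>|^3.\<close>

definition rspeed' :: "'n::finite W1inf0 \<Rightarrow> 'n W1inf0 \<Rightarrow> 'n lrep" where
  "rspeed' c h = - ltimes (rspeed c) (ltimes (rspeed c) (ltimes (rspeed c) (ldot (lder c) (lder h))))"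

lemma bounded_linear_rspeed': "bounded_linear (rspeed' c)"
  unfolding rspeed'_def
  by (intro bounded_linear_minus bounded_linear_compose[OF bounded_bilinear.bounded_linear_right[OF bounded_bilinear_lmul[OF bounded_bilinear_vtimes]]]
      bounded_linear_compose[OF bounded_bilinear.bounded_linear_right[OF bounded_bilinear_lmul[OF bounded_bilinear_vdot]]]
      bounded_linear_lder)

lemma lfun_uminus: "AE \<theta> in circle. lfun (- a) \<theta> = - lfun a \<theta>"
  using lfun_scaleR[of "-1" a] by eventually_elim simp

lemma rspeed_has_derivative:
  fixes c :: "'n::finite W1inf0"
  assumes c: "c \<in> immersions"
  shows "(rspeed has_derivative rspeed' c) (at c)"
  unfolding has_derivative_at_alt
proof (intro conjI allI impI bounded_linear_rspeed')
  fix e :: real assume e: "e > 0"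
  obtain m where m: "m > 0" "AE \<theta> in circle. m \<le> norm (tderiv c \<theta>)" using c by (rule immersionsE)
  define N where "N = norm (1 :: real ^ 'n)"
  define K where "K = lrep_const * (3 / m ^ 3 * N)"
  have K: "K \<ge> 0" unfolding K_def N_def using m lrep_const_pos by simp
  obtain d0 where d0: "d0 > 0" "ball c d0 \<subseteq> immersions" using open_immersions c open_contains_ball by blast
  \<comment> \<open>\<open>d0\<close> keeps \<open>y\<close> an immersion, m / 2 is the range of the
    pointwise expansion, and e / (K + 1) beats the quadratic remainder.\<close>
  define d where "d = min d0 (min (m / 2) (e / (K + 1)))"
  have d: "d > 0" using d0 m e K by (simp add: d_def)
  have "norm (rspeed y - rspeed c - rspeed' c (y - c)) \<le> e * norm (y - c)" if y: "norm (y - c) < d" for y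
  proof -
    have yi: "y \<in> immersions" using d0(2) y by (auto simp: d_def dist_norm norm_minus_commute)
    let ?x = "ldot (lder c) (lder (y - c))"
    have "AE \<theta> in circle. norm (lfun (rspeed y - rspeed c - rspeed' c (y - c)) \<theta>) \<le> 3 / m ^ 3 * (norm (y - c))\<^sup>2 * N"
      using lfun_diff[of "rspeed y - rspeed c" "rspeed' c (y - c)"] lfun_diff[of "rspeed y" "rspeed c"]
        lfun_uminus[of "ltimes (rspeed c) (ltimes (rspeed c) (ltimes (rspeed c) ?x))"]
        lfun_ltimes[of "rspeed c" "ltimes (rspeed c) (ltimes (rspeed c) ?x)"]
        lfun_ltimes[of "rspeed c" "ltimes (rspeed c) ?x"] lfun_ltimes[of "rspeed c" ?x] lfun_ldot[of "lder c" "lder (y - c)"]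
        lfun_rspeed[OF c] lfun_rspeed[OF yi] tderiv_diff[of y c] tderiv_AE_norm[of "y - c"] m(2)
    proof eventually_elim
      case (elim \<theta>)
      let ?c = "tderiv c \<theta>" and ?y = "tderiv y \<theta>"
      have n: "norm (?y - ?c) \<le> norm (y - c)" using elim(10,11) by simp
      have "lfun (rspeed y - rspeed c - rspeed' c (y - c)) \<theta>
          = (inverse (norm ?y) - inverse (norm ?c) + inverse (norm ?c) ^ 3 * (?c \<bullet> (?y - ?c))) *\<^sub>R (1 :: real ^ 'n)"
        using elim(1-10)
        by (simp add: rspeed'_def vdot_def lfun_lder scaleR_diff_left scaleR_add_left power3_eq_cube mult.assoc)
      moreover have "\<bar>inverse (norm ?y) - inverse (norm ?c) + inverse (norm ?c) ^ 3 * (?c \<bullet> (?y - ?c))\<bar> \<le> 3 / m ^ 3 * (norm (y - c))\<^sup>2"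
      proof (rule order_trans[OF inverse_norm_expansion[OF m(1) elim(12)]])
        show "norm (?y - ?c) \<le> m / 2" using n y by (simp add: d_def)
        show "3 / m ^ 3 * (norm (?y - ?c))\<^sup>2 \<le> 3 / m ^ 3 * (norm (y - c))\<^sup>2"
          using n m(1) by (intro mult_left_mono power_mono) auto
      qed
      ultimately show ?case
        unfolding N_def by (simp only: norm_scaleR mult_right_mono norm_ge_zero)
    qed
    from norm_lrep_le[OF this]
    have "norm (rspeed y - rspeed c - rspeed' c (y - c)) \<le> (K * norm (y - c)) * norm (y - c)"
      by (simp add: K_def power2_eq_square algebra_simps)
    also have "\<dots> \<le> e * norm (y - c)"
    proof (rule mult_right_mono)
      have "norm (y - c) \<le> e / (K + 1)" using y by (simp add: d_def)
      then have "(K + 1) * norm (y - c) \<le> e" using K by (simp add: pos_le_divide_eq mult.commute)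
      moreover have "K * norm (y - c) \<le> (K + 1) * norm (y - c)" by (intro mult_right_mono) auto
      ultimately show "K * norm (y - c) \<le> e" by linarith
    qed simp
    finally show ?thesis .
  qed
  with d show "\<exists>d>0. \<forall>y. norm (y - c) < d \<longrightarrow> norm (rspeed y - rspeed c - rspeed' c (y - c)) \<le> e * norm (y - c)" by blast
qed

text \<open>The derivative of \<open>1/|c'|\<close> is polynomial in \<open>1/|c'|\<close>, \<open>c\<close> and the direction, so each order of
  differentiability yields the next.\<close>

lemma csmooth_rspeed: "csmooth immersions (rspeed :: 'n::finite W1inf0 \<Rightarrow> 'n lrep)"
proof -
  let ?I = "immersions :: 'n W1inf0 set"
  let ?T = "?I \<times> (UNIV :: 'n W1inf0 set)"
  have o: "open ?T" by (intro open_Times open_immersions open_UNIV)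
  have "kdiff k ?I rspeed" for k
  proof (induction k)
    case (Suc k)
    have r: "kdiff k ?T (\<lambda>p. rspeed (fst p))" by (rule kdiff_comp_fst[OF open_immersions Suc])
    have "kdiff k ?T (\<lambda>p. rspeed' (fst p) (snd p))"
      unfolding rspeed'_def
      by (intro kdiff_uminus[OF o] kdiff_bilinear[OF bounded_bilinear_lmul[OF bounded_bilinear_vtimes] o]
          kdiff_bilinear[OF bounded_bilinear_lmul[OF bounded_bilinear_vdot] o] r
          kdiff_linear[OF o] bounded_linear_compose[OF bounded_linear_lder] bounded_linear_fst bounded_linear_snd)
    then show ?case by (intro kdiff_SucI[OF open_immersions rspeed_has_derivative])
  qed simp
  then show ?thesis by (simp add: csmooth_def open_immersions)
qed

lemma csmooth_grhs:
  "csmooth (immersions \<times> UNIV) (\<lambda>p :: 'n::finite W1inf0 \<times> 'n W1inf0. grhs (fst p) (snd p))"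
proof -
  let ?T = "immersions \<times> UNIV :: ('n W1inf0 \<times> 'n W1inf0) set"
  have o: "open ?T" by (intro open_Times open_immersions open_UNIV)
  have fs: "csmooth ?T fst" "csmooth ?T snd"
    by (intro csmooth_linear o bounded_linear_fst bounded_linear_snd)+
  note t = csmooth_bilinear[OF bounded_bilinear_lmul[OF bounded_bilinear_vtimes]]
    csmooth_bilinear[OF bounded_bilinear_lmul[OF bounded_bilinear_vdot]]
  have r: "csmooth ?T (\<lambda>p. rspeed (fst p))" by (rule csmooth_comp[OF fs(1) csmooth_rspeed]) auto
  have l: "csmooth ?T (\<lambda>p. lder (fst p))" "csmooth ?T (\<lambda>p. lder (snd p))"
    by (intro csmooth_linear_comp[OF bounded_linear_lder] fs)+
  have s: "csmooth ?T (\<lambda>p. speed (fst p))" unfolding speed_def by (intro t r l)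
  have q: "csmooth ?T (\<lambda>p. inverse (lavg (speed (fst p))))"
    by (rule csmooth_comp[OF csmooth_linear_comp[OF bounded_linear_lavg s] csmooth_inverse_real])
      (auto simp: lavg_speed_pos)
  note m = csmooth_bilinear[OF bounded_bilinear_mult]
  have g: "csmooth ?T (\<lambda>p. gmetric (fst p) (fst p) (snd p))" "csmooth ?T (\<lambda>p. gmetric (fst p) (snd p) (snd p))"
    unfolding gmetric_def by (intro m q csmooth_linear_comp[OF bounded_linear_lavg] t r l)+
  have k: "csmooth ?T (\<lambda>p. kforce (fst p) (snd p))"
    unfolding kforce_def by (intro t r l csmooth_diff csmooth_scaleR csmooth_const o)
  have sk: "csmooth ?T (\<lambda>p. lconst (snd (kforce (fst p) (snd p))))"
    by (rule csmooth_linear_comp[OF bounded_linear_compose[OF bounded_linear_lconst bounded_linear_snd] k])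
  show ?thesis
    unfolding grhs_def
    by (intro csmooth_add csmooth_diff csmooth_scaleR m csmooth_const o g fs q k sk t s
        csmooth_linear_comp[OF bounded_linear_fst])
qed

text \<open>Every summand contains the velocity exactly twice. This homogeneity allows time and
  velocity to be rescaled against each other.\<close>

lemma grhs_scaleR: "grhs c (r *\<^sub>R h) = (r\<^sup>2) *\<^sub>R grhs c h"
proof -
  interpret d: bounded_bilinear ldot by (rule bounded_bilinear_lmul[OF bounded_bilinear_vdot])
  interpret t: bounded_bilinear ltimes by (rule bounded_bilinear_lmul[OF bounded_bilinear_vtimes])
  have l: "lder (r *\<^sub>R h) = r *\<^sub>R lder h" by (simp add: lder_def)
  have a: "lavg (r *\<^sub>R x) = r * lavg x" for r and x :: "'a lrep" by (simp add: lavg_def)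
  have "gmetric c c (r *\<^sub>R h) = r * gmetric c c h" "gmetric c (r *\<^sub>R h) (r *\<^sub>R h) = r\<^sup>2 * gmetric c h h"
    by (simp_all add: gmetric_def l a d.scaleR_left d.scaleR_right t.scaleR_right power2_eq_square)
  moreover have "kforce c (r *\<^sub>R h) = (r\<^sup>2) *\<^sub>R kforce c h"
    by (simp add: kforce_def l d.scaleR_left d.scaleR_right t.scaleR_left t.scaleR_right power2_eq_square
        t.diff_right scaleR_diff_right)
  moreover have "lconst (x *\<^sub>R v) = x *\<^sub>R lconst v" for x and v :: "real ^ 'a" by (simp add: lconst_def)
  ultimately show ?thesis
    by (simp add: grhs_def t.scaleR_right scaleR_add_right scaleR_diff_right power2_eq_square mult_ac)
qed

subsection \<open>Geodesics and the exponential map\<close>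

abbreviation (input) phase :: "('n::finite W1inf0 \<times> 'n W1inf0) set" where
  "phase \<equiv> immersions \<times> UNIV"

definition spray :: "'n::finite W1inf0 \<times> 'n W1inf0 \<Rightarrow> 'n W1inf0 \<times> 'n W1inf0" where
  "spray p = (snd p, grhs (fst p) (snd p))"

lemma open_phase: "open (phase :: ('n::finite W1inf0 \<times> 'n W1inf0) set)"
  by (intro open_Times open_immersions open_UNIV)

lemma csmooth_spray: "csmooth phase spray"
  unfolding spray_def by (intro csmooth_Pair csmooth_grhs csmooth_linear open_phase bounded_linear_snd)

text \<open>Reduction to a first-order system on phase space. Solutions stay in
  \<open>immersions\<close>, where \<open>geodesic_rhs\<close> may be replaced by the smooth
  \<open>grhs\<close>.\<close>

lemma geodesic_ivp_iff:
  "geodesic_ivp J \<gamma> c h \<longleftrightarrow> open J \<and> is_interval J \<and> 0 \<in> J \<and>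
    (\<exists>x. x 0 = (c, h) \<and> (\<forall>t\<in>J. fst (x t) = \<gamma> t \<and> x t \<in> phase \<and> (x has_vector_derivative spray (x t)) (at t)))"
  (is "?L \<longleftrightarrow> ?R")
proof
  assume ?L
  then obtain \<gamma>' where g: "open J" "is_interval J" "0 \<in> J" "\<gamma> 0 = c" "\<gamma>' 0 = h"
    "\<And>t. t \<in> J \<Longrightarrow> \<gamma> t \<in> immersions \<and> (\<gamma> has_vector_derivative \<gamma>' t) (at t) \<and>
        (\<gamma>' has_vector_derivative geodesic_rhs (\<gamma> t) (\<gamma>' t)) (at t)"
    unfolding geodesic_ivp_def by blast
  have "((\<lambda>t. (\<gamma> t, \<gamma>' t)) has_vector_derivative spray (\<gamma> t, \<gamma>' t)) (at t)" if "t \<in> J" for t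
  proof -
    have i: "\<gamma> t \<in> immersions" and d: "(\<gamma> has_vector_derivative \<gamma>' t) (at t)"
      "(\<gamma>' has_vector_derivative geodesic_rhs (\<gamma> t) (\<gamma>' t)) (at t)"
      using g(6)[OF that] by blast+
    from has_vector_derivative_Pair[OF d] show ?thesis by (simp add: spray_def geodesic_rhs_eq[OF i])
  qed
  with g show ?R by (intro conjI exI[of _ "\<lambda>t. (\<gamma> t, \<gamma>' t)"]) auto
next
  assume ?R
  then obtain x where x: "open J" "is_interval J" "0 \<in> J" "x 0 = (c, h)"
    "\<And>t. t \<in> J \<Longrightarrow> fst (x t) = \<gamma> t \<and> x t \<in> phase \<and> (x has_vector_derivative spray (x t)) (at t)" by blast
  have "\<gamma> t \<in> immersions \<and> (\<gamma> has_vector_derivative snd (x t)) (at t) \<and>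
        ((\<lambda>t. snd (x t)) has_vector_derivative geodesic_rhs (\<gamma> t) (snd (x t))) (at t)" if t: "t \<in> J" for t
  proof -
    have i: "\<gamma> t \<in> immersions" using x(5)[OF t] by (auto simp: mem_Times_iff)
    have d: "(x has_vector_derivative spray (x t)) (at t)" using x(5)[OF t] by blast
    have "((\<lambda>t. fst (x t)) has_vector_derivative snd (x t)) (at t)"
      using bounded_linear.has_vector_derivative[OF bounded_linear_fst d] by (simp add: spray_def)
    then have "(\<gamma> has_vector_derivative snd (x t)) (at t)"
      by (rule has_vector_derivative_transform_within_open[OF _ x(1) t]) (use x(5) in blast)
    moreover have "((\<lambda>t. snd (x t)) has_vector_derivative geodesic_rhs (\<gamma> t) (snd (x t))) (at t)"
      using bounded_linear.has_vector_derivative[OF bounded_linear_snd d] x(5)[OF t]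
      by (simp add: spray_def geodesic_rhs_eq[OF i])
    ultimately show ?thesis using i by blast
  qed
  moreover have "\<gamma> 0 = c" using x(4) x(5)[OF x(3)] by simp
  ultimately show ?L unfolding geodesic_ivp_def using x(1-4) by (intro conjI exI[of _ "\<lambda>t. snd (x t)"]) auto
qed

lemma geodesic_unique:
  assumes "geodesic_ivp J \<gamma> c h" "geodesic_ivp J \<eta> c h" "t \<in> J"
  shows "\<gamma> t = \<eta> t"
proof -
  obtain x where x: "open J" "is_interval J" "0 \<in> J" "x 0 = (c, h)"
    "\<And>t. t \<in> J \<Longrightarrow> fst (x t) = \<gamma> t \<and> x t \<in> phase \<and> (x has_vector_derivative spray (x t)) (at t)"
    using assms(1) unfolding geodesic_ivp_iff by blast
  obtain y where y: "y 0 = (c, h)"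
    "\<And>t. t \<in> J \<Longrightarrow> fst (y t) = \<eta> t \<and> y t \<in> phase \<and> (y has_vector_derivative spray (y t)) (at t)"
    using assms(2) unfolding geodesic_ivp_iff by blast
  have "x t = y t"
  proof (rule ode_unique[OF csmooth_spray x(2,3) _ _ _ assms(3)])
    show "x t \<in> phase \<and> (x has_vector_derivative spray (x t)) (at t within J)" if "t \<in> J" for t
      using x(5)[OF that] has_vector_derivative_at_within by blast
    show "y t \<in> phase \<and> (y has_vector_derivative spray (y t)) (at t within J)" if "t \<in> J" for t
      using y(2)[OF that] has_vector_derivative_at_within by blast
  qed (simp add: x(4) y(1))
  then show ?thesis using x(5)[OF assms(3)] y(2)[OF assms(3)] by simp
qed

lemma geodesic_ivp_subset:
  assumes "geodesic_ivp J \<gamma> c h" "open I" "is_interval I" "0 \<in> I" "I \<subseteq> J"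
  shows "geodesic_ivp I \<gamma> c h"
proof -
  obtain \<gamma>' where "\<gamma> 0 = c" "\<gamma>' 0 = h"
    "\<And>t. t \<in> J \<Longrightarrow> \<gamma> t \<in> immersions \<and> (\<gamma> has_vector_derivative \<gamma>' t) (at t) \<and>
        (\<gamma>' has_vector_derivative geodesic_rhs (\<gamma> t) (\<gamma>' t)) (at t)"
    using assms(1) unfolding geodesic_ivp_def by blast
  then show ?thesis
    unfolding geodesic_ivp_def using assms(2-5) by (intro conjI exI[of _ \<gamma>'] ballI) blast+
qed

text \<open>Two solutions reaching time 1 agree on the intersection of their intervals, which
  contains 0 and 1; so the definite description does not depend on the solution.\<close>

lemma geodesic_exp_eq:
  assumes g: "geodesic_ivp J \<gamma> c h" and "1 \<in> J"
  shows "geodesic_exp c h = \<gamma> 1"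
  unfolding geodesic_exp_def
proof (rule the_equality)
  show "\<exists>J \<eta>. 1 \<in> J \<and> geodesic_ivp J \<eta> c h \<and> \<eta> 1 = \<gamma> 1" using assms by blast
  fix p assume "\<exists>J \<eta>. 1 \<in> J \<and> geodesic_ivp J \<eta> c h \<and> \<eta> 1 = p"
  then obtain I \<eta> where e: "1 \<in> I" "geodesic_ivp I \<eta> c h" "\<eta> 1 = p" by blast
  have IJ: "open (I \<inter> J)" "is_interval (I \<inter> J)" "0 \<in> I \<inter> J"
    using g e(2) by (auto simp: geodesic_ivp_def is_interval_Int)
  have "\<eta> 1 = \<gamma> 1"
    by (rule geodesic_unique[OF geodesic_ivp_subset[OF e(2) IJ] geodesic_ivp_subset[OF g IJ]]) (use assms e in auto)
  with e show "p = \<gamma> 1" by simp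
qed

text \<open>Speeding up by s multiplies the velocity by s and the acceleration by s^2, in accordance
  with \<open>grhs_scaleR\<close>.\<close>

lemma geodesic_rescale:
  assumes "geodesic_ivp J \<gamma> c h"
  shows "geodesic_ivp {t. s * t \<in> J} (\<lambda>t. \<gamma> (s * t)) c (s *\<^sub>R h)"
proof -
  obtain \<gamma>' where g: "open J" "is_interval J" "0 \<in> J" "\<gamma> 0 = c" "\<gamma>' 0 = h"
    "\<And>t. t \<in> J \<Longrightarrow> \<gamma> t \<in> immersions \<and> (\<gamma> has_vector_derivative \<gamma>' t) (at t) \<and>
        (\<gamma>' has_vector_derivative geodesic_rhs (\<gamma> t) (\<gamma>' t)) (at t)"
    using assms unfolding geodesic_ivp_def by blast
  have "open {t. s * t \<in> J}" by (rule open_linear_vimage[OF g(1) bounded_linear_mult_right])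
  moreover have "is_interval {t. s * t \<in> J}"
    using convex_linear_vimage[of "(*) s" J] g(2) bounded_linear.linear[OF bounded_linear_mult_right]
    by (simp add: is_interval_convex_1 vimage_def)
  moreover have "\<gamma> (s * t) \<in> immersions \<and> ((\<lambda>t. \<gamma> (s * t)) has_vector_derivative s *\<^sub>R \<gamma>' (s * t)) (at t) \<and>
      ((\<lambda>t. s *\<^sub>R \<gamma>' (s * t)) has_vector_derivative geodesic_rhs (\<gamma> (s * t)) (s *\<^sub>R \<gamma>' (s * t))) (at t)"
    if t: "s * t \<in> J" for t
  proof -
    have d: "((\<lambda>t. s * t) has_vector_derivative s) (at t)"
      by (auto intro!: derivative_eq_intros)
    have gt: "\<gamma> (s * t) \<in> immersions" "(\<gamma> has_vector_derivative \<gamma>' (s * t)) (at (s * t))"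
      "(\<gamma>' has_vector_derivative geodesic_rhs (\<gamma> (s * t)) (\<gamma>' (s * t))) (at (s * t))"
      using g(6)[OF t] by blast+
    have "((\<lambda>t. \<gamma> (s * t)) has_vector_derivative s *\<^sub>R \<gamma>' (s * t)) (at t)"
      using vector_diff_chain_at[OF d gt(2)] by (simp only: o_def)
    moreover have "((\<lambda>t. \<gamma>' (s * t)) has_vector_derivative s *\<^sub>R geodesic_rhs (\<gamma> (s * t)) (\<gamma>' (s * t))) (at t)"
      using vector_diff_chain_at[OF d gt(3)] by (simp only: o_def)
    then have "((\<lambda>t. s *\<^sub>R \<gamma>' (s * t)) has_vector_derivative s *\<^sub>R s *\<^sub>R geodesic_rhs (\<gamma> (s * t)) (\<gamma>' (s * t))) (at t)"
      by (rule bounded_linear.has_vector_derivative[OF bounded_linear_scaleR_right])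
    moreover have "s *\<^sub>R s *\<^sub>R geodesic_rhs (\<gamma> (s * t)) (\<gamma>' (s * t)) = geodesic_rhs (\<gamma> (s * t)) (s *\<^sub>R \<gamma>' (s * t))"
      using gt(1) by (simp add: geodesic_rhs_eq grhs_scaleR power2_eq_square)
    ultimately show ?thesis using gt(1) by simp
  qed
  ultimately show ?thesis
    unfolding geodesic_ivp_def using g(3-5) by (intro conjI exI[of _ "\<lambda>t. s *\<^sub>R \<gamma>' (s * t)"]) auto
qed

lemma geodesic_flow:
  fixes c\<^sub>0 h\<^sub>0 :: "'n::finite W1inf0"
  assumes "c\<^sub>0 \<in> immersions"
  obtains \<epsilon> N \<Phi> where "\<epsilon> > 0" "open N" "(c\<^sub>0, h\<^sub>0) \<in> N" "N \<subseteq> phase"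
    "\<And>c h. (c, h) \<in> N \<Longrightarrow> geodesic_ivp {-\<epsilon><..<\<epsilon>} (\<Phi> (c, h)) c h"
    "csmooth ({-\<epsilon><..<\<epsilon>} \<times> N) (\<lambda>(t, c, h). \<Phi> (c, h) t)"
proof -
  have p: "(c\<^sub>0, h\<^sub>0) \<in> phase" using assms by simp
  show thesis
  proof (rule csmooth_flow[OF csmooth_spray p])
    fix \<epsilon> N \<phi>
    assume f: "\<epsilon> > 0" "open N" "(c\<^sub>0, h\<^sub>0) \<in> N" "N \<subseteq> phase"
      "csmooth ({-\<epsilon><..<\<epsilon>} \<times> N) (\<lambda>(t, x). \<phi> t x)"
      "\<And>x. x \<in> N \<Longrightarrow> \<phi> 0 x = x"
      "\<And>t x. t \<in> {-\<epsilon><..<\<epsilon>} \<Longrightarrow> x \<in> N \<Longrightarrow>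
        \<phi> t x \<in> phase \<and> ((\<lambda>t. \<phi> t x) has_vector_derivative spray (\<phi> t x)) (at t)"
    show thesis
    proof (rule that[OF f(1-4)])
      show "geodesic_ivp {-\<epsilon><..<\<epsilon>} ((\<lambda>x t. fst (\<phi> t x)) (c, h)) c h" if n: "(c, h) \<in> N" for c h
        unfolding geodesic_ivp_iff
      proof (intro conjI exI[of _ "\<lambda>t. \<phi> t (c, h)"] ballI)
        fix t assume "t \<in> {-\<epsilon><..<\<epsilon>}"
        from f(7)[OF this n] show "\<phi> t (c, h) \<in> phase"
          "((\<lambda>t. \<phi> t (c, h)) has_vector_derivative spray (\<phi> t (c, h))) (at t)" by blast+
      qed (use f(1) f(6)[OF n] in \<open>simp_all add: is_interval_oo\<close>)
      show "csmooth ({-\<epsilon><..<\<epsilon>} \<times> N) (\<lambda>(t, c, h). (\<lambda>x t. fst (\<phi> t x)) (c, h) t)"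
        using csmooth_linear_comp[OF bounded_linear_fst f(5)] by (simp add: case_prod_beta')
    qed
  qed
qed

definition exp_map :: "'n::finite W1inf0 \<times> 'n W1inf0 \<Rightarrow> 'n W1inf0" where
  "exp_map p = geodesic_exp (fst p) (snd p)"

text \<open>Bundles the wanted properties in a form stable under arbitrary unions, so that local
  domains can be merged; openness is contained in \<open>csmooth\<close>.\<close>

definition exp_domain :: "('n::finite W1inf0 \<times> 'n W1inf0) set \<Rightarrow> bool" where
  "exp_domain U \<longleftrightarrow> U \<subseteq> phase \<and> (\<forall>(c, h)\<in>U. \<exists>J \<gamma>. 1 \<in> J \<and> geodesic_ivp J \<gamma> c h) \<and> csmooth U exp_map"

lemma exp_domain_near_zero:
  fixes c\<^sub>0 :: "'n::finite W1inf0"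
  assumes "c\<^sub>0 \<in> immersions"
  shows "\<exists>U. (c\<^sub>0, 0) \<in> U \<and> exp_domain U"
proof (rule geodesic_flow[OF assms, of 0])
  fix \<epsilon> N and \<Phi> :: "'n W1inf0 \<times> 'n W1inf0 \<Rightarrow> real \<Rightarrow> 'n W1inf0"
  assume f: "\<epsilon> > 0" "open N" "(c\<^sub>0, 0) \<in> N" "N \<subseteq> phase"
    "\<And>c h :: 'n W1inf0. (c, h) \<in> N \<Longrightarrow> geodesic_ivp {-\<epsilon><..<\<epsilon>} (\<Phi> (c, h)) c h"
    "csmooth ({-\<epsilon><..<\<epsilon>} \<times> N) (\<lambda>(t, c, h). \<Phi> (c, h) t)"
  \<comment> \<open>A fixed positive time at which the flow is defined: following velocity h / s up
    to time s is following h up to time 1.\<close>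
  define s where "s = \<epsilon> / 2"
  have s: "s > 0" "s \<in> {-\<epsilon><..<\<epsilon>}" using f(1) by (auto simp: s_def)
  have lin: "bounded_linear (\<lambda>p::'n W1inf0 \<times> 'n W1inf0. (fst p, (1 / s) *\<^sub>R snd p))"
    by (intro bounded_linear_Pair bounded_linear_fst bounded_linear_compose[OF bounded_linear_scaleR_right] bounded_linear_snd)
  define U where "U = {p::'n W1inf0 \<times> 'n W1inf0. (fst p, (1 / s) *\<^sub>R snd p) \<in> N}"
  have oU: "open U" unfolding U_def by (rule open_linear_vimage[OF f(2) lin])
  have g: "geodesic_ivp {t. s * t \<in> {-\<epsilon><..<\<epsilon>}} (\<lambda>t. \<Phi> (c, (1 / s) *\<^sub>R h) (s * t)) c h" if "(c, h) \<in> U" for c h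
    using geodesic_rescale[OF f(5), of c "(1 / s) *\<^sub>R h" s] that s by (simp add: U_def)
  have "csmooth U (\<lambda>p. (s, fst p, (1 / s) *\<^sub>R snd p))"
    by (intro csmooth_Pair csmooth_const oU csmooth_linear bounded_linear_fst
        bounded_linear_compose[OF bounded_linear_scaleR_right] bounded_linear_snd)
  then have "csmooth U (\<lambda>p. (\<lambda>(t, c, h). \<Phi> (c, h) t) (s, fst p, (1 / s) *\<^sub>R snd p))"
    by (rule csmooth_comp[OF _ f(6)]) (use s in \<open>simp add: U_def\<close>)
  then have e: "csmooth U (\<lambda>p. \<Phi> (fst p, (1 / s) *\<^sub>R snd p) s)" by simp
  have eq: "\<Phi> (fst p, (1 / s) *\<^sub>R snd p) s = exp_map p" if "p \<in> U" for p
  proof -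
    have "(fst p, snd p) \<in> U" using that by simp
    from geodesic_exp_eq[OF g[OF this]] show ?thesis using s by (simp add: exp_map_def)
  qed
  have "csmooth U exp_map" by (rule csmooth_cong[OF eq, THEN iffD1, OF _ e])
  moreover have "\<exists>J \<gamma>. 1 \<in> J \<and> geodesic_ivp J \<gamma> c h" if "(c, h) \<in> U" for c h
  proof (intro exI conjI)
    show "1 \<in> {t. s * t \<in> {-\<epsilon><..<\<epsilon>}}" using s by simp
  qed (rule g[OF that])
  moreover have "U \<subseteq> phase"
  proof
    fix p assume "p \<in> U"
    then have "(fst p, (1 / s) *\<^sub>R snd p) \<in> phase" using f(4) by (auto simp: U_def)
    then show "p \<in> phase" by (simp add: mem_Times_iff)
  qed
  ultimately have "exp_domain U" unfolding exp_domain_def by blast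
  moreover have "(c\<^sub>0, 0) \<in> U" using f(3) by (simp add: U_def)
  ultimately show ?thesis by blast
qed

text \<open>Homogeneity with r = 0 makes the acceleration vanish, so the constant curve is the
  geodesic.\<close>

lemma exp_map_zero: "c \<in> immersions \<Longrightarrow> exp_map (c, 0) = c"
proof -
  assume c: "c \<in> immersions"
  have "geodesic_rhs c 0 = 0" using grhs_scaleR[of c 0 0] by (simp add: geodesic_rhs_eq[OF c])
  then have "geodesic_ivp UNIV (\<lambda>_. c) c 0"
    unfolding geodesic_ivp_def using c by (intro conjI exI[of _ "\<lambda>_. 0"]) auto
  from geodesic_exp_eq[OF this] show ?thesis by (simp add: exp_map_def)
qed

lemma exp_domainD:
  assumes "exp_domain U"
  shows "p \<in> U \<Longrightarrow> fst p \<in> immersions" "csmooth U exp_map"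
    "(c, h) \<in> U \<Longrightarrow> \<exists>J \<gamma>. 1 \<in> J \<and> geodesic_ivp J \<gamma> c h"
proof -
  have s: "U \<subseteq> phase" and g: "\<forall>(c, h)\<in>U. \<exists>J \<gamma>. 1 \<in> J \<and> geodesic_ivp J \<gamma> c h"
    and e: "csmooth U exp_map"
    using assms unfolding exp_domain_def by blast+
  show "p \<in> U \<Longrightarrow> fst p \<in> immersions" using s by (auto simp: mem_Times_iff)
  show "csmooth U exp_map" by (rule e)
  show "\<exists>J \<gamma>. 1 \<in> J \<and> geodesic_ivp J \<gamma> c h" if "(c, h) \<in> U"
    using bspec[OF g that] by (simp only: prod.case)
qed

text \<open>In the base direction exp is the identity along the zero section; in the fibre direction
  exp_c(t l) is the geodesic with initial velocity l. Linearity adds the two.\<close>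

lemma exp_map_derivative_zero:
  fixes c :: "'n::finite W1inf0"
  assumes U: "exp_domain U" and c: "(c, 0) \<in> U"
  shows "fder exp_map (c, 0) (k, l) = k + l"
proof -
  let ?D = "fder exp_map (c, 0)"
  note cs = exp_domainD(2)[OF U]
  have ci: "c \<in> immersions" using exp_domainD(1)[OF U c] by simp
  have D: "(exp_map has_derivative ?D) (at (c, 0))" by (rule csmooth_has_derivative[OF cs c])
  interpret D: bounded_linear ?D using D by (rule has_derivative_bounded_linear)
  have 1: "?D (k, 0) = k" for k
  proof -
    have "((\<lambda>x. (x, 0)) has_derivative (\<lambda>k. (k, 0))) (at c)"
      by (intro bounded_linear_imp_has_derivative bounded_linear_Pair bounded_linear_ident bounded_linear_zero)
    from diff_chain_at[OF this D] have "((\<lambda>x. exp_map (x, 0)) has_derivative (\<lambda>k. ?D (k, 0))) (at c)" by (simp add: o_def)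
    then have "((\<lambda>x. x) has_derivative (\<lambda>k. ?D (k, 0))) (at c)"
      by (rule has_derivative_transform_within_open[OF _ open_immersions ci]) (rule exp_map_zero)
    from has_derivative_unique[OF this has_derivative_ident] show ?thesis by (rule fun_cong)
  qed
  have 2: "?D (0, l) = l" if l: "(c, l) \<in> U" for l
  proof -
    obtain J \<gamma> where J: "1 \<in> J" "geodesic_ivp J \<gamma> c l" using exp_domainD(3)[OF U l] by blast
    then obtain \<gamma>' where g: "is_interval J" "0 \<in> J" "\<gamma>' 0 = l" "\<And>t. t \<in> J \<Longrightarrow> (\<gamma> has_vector_derivative \<gamma>' t) (at t)"
      unfolding geodesic_ivp_def by blast
    \<comment> \<open>The interval \<open>J\<close> contains 0 and 1, hence {0..1}, but possibly
      nothing beyond that is known for a fixed length; one-sided derivatives at 0 are enough to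
      identify the two.\<close>
    have et: "exp_map (c, t *\<^sub>R l) = \<gamma> t" if t: "t \<in> {0..1}" for t
    proof -
      have "t \<in> J" using mem_is_interval_1_I[OF g(1,2) J(1)] t by simp
      then have "geodesic_exp c (t *\<^sub>R l) = \<gamma> (t * 1)"
        by (intro geodesic_exp_eq[OF geodesic_rescale[OF J(2)]]) simp
      then show ?thesis by (simp add: exp_map_def)
    qed
    have "(\<gamma> has_vector_derivative l) (at 0 within {0..1})"
      using g(4)[OF g(2)] unfolding g(3) by (rule has_vector_derivative_at_within)
    then have a: "((\<lambda>t. exp_map (c, t *\<^sub>R l)) has_vector_derivative l) (at 0 within {0..1})"
      by (rule has_vector_derivative_transform[of 0 "{0..1}", rotated 2]) (simp_all add: et)
    have "((\<lambda>t. (c, t *\<^sub>R l)) has_derivative (\<lambda>t. (0, t *\<^sub>R l))) (at 0)"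
      by (intro has_derivative_Pair has_derivative_const bounded_linear_imp_has_derivative bounded_linear_scaleR_left)
    from diff_chain_at[OF this, of exp_map ?D] D
    have "((\<lambda>t. exp_map (c, t *\<^sub>R l)) has_derivative (\<lambda>t. ?D (0, t *\<^sub>R l))) (at 0)" by (simp add: o_def)
    moreover have "?D (0, t *\<^sub>R l) = t *\<^sub>R ?D (0, l)" for t using D.scaleR[of t "(0, l)"] by simp
    ultimately have b: "((\<lambda>t. exp_map (c, t *\<^sub>R l)) has_vector_derivative ?D (0, l)) (at 0 within {0..1})"
      by (simp add: has_vector_derivative_def has_derivative_at_withinI)
    have "at (0::real) within {0..1} \<noteq> bot" by (simp add: at_within_Icc_at_right)
    from vector_derivative_unique_within[OF this b a] show ?thesis .
  qed
  \<comment> \<open>A short multiple of an arbitrary \<open>l\<close> lies in \<open>U\<close>, and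
    linearity removes the factor e / 2.\<close>
  have 3: "?D (0, l) = l" for l
  proof -
    have "open ((\<lambda>r::real. (c, r *\<^sub>R l)) -` U)"
      by (rule open_vimage[OF csmooth_open[OF cs]]) (intro continuous_intros)
    moreover have "(0::real) \<in> (\<lambda>r. (c, r *\<^sub>R l)) -` U" using c by simp
    ultimately obtain e :: real where e: "e > 0" "ball 0 e \<subseteq> (\<lambda>r. (c, r *\<^sub>R l)) -` U"
      using open_contains_ball by blast
    have "e / 2 \<in> ball 0 e" using e(1) by simp
    then have "(c, (e / 2) *\<^sub>R l) \<in> U" using e(2) by blast
    from 2[OF this] have "?D (0, (e / 2) *\<^sub>R l) = (e / 2) *\<^sub>R l" .
    moreover have "?D (0, (e / 2) *\<^sub>R l) = (e / 2) *\<^sub>R ?D (0, l)" using D.scaleR[of "e / 2" "(0, l)"] by simp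
    ultimately have "(e / 2) *\<^sub>R ?D (0, l) = (e / 2) *\<^sub>R l" by (simp only:)
    then show ?thesis by (subst (asm) scaleR_cancel_left) (use e(1) in auto)
  qed
  show ?thesis using D.add[of "(k, 0)" "(0, l)"] by (simp add: 1 3)
qed

definition exp_graph :: "'n::finite W1inf0 \<times> 'n W1inf0 \<Rightarrow> 'n W1inf0 \<times> 'n W1inf0" where
  "exp_graph p = (fst p, exp_map p)"

lemma exp_graph_local_inverse:
  fixes c :: "'n::finite W1inf0"
  assumes U: "exp_domain U" and c: "(c, 0) \<in> U"
  obtains V where "open V" "(c, 0) \<in> V" "V \<subseteq> U" "open (exp_graph ` V)" "inj_on exp_graph V"
    "csmooth (exp_graph ` V) (inv_into V exp_graph)"
proof -
  note cs = exp_domainD(2)[OF U]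
  have F: "csmooth U exp_graph" unfolding exp_graph_def[abs_def]
    by (intro csmooth_Pair cs csmooth_linear csmooth_open[OF cs] bounded_linear_fst)
  have "(exp_graph has_derivative (\<lambda>h. (fst h, fder exp_map (c, 0) h))) (at (c, 0))"
    unfolding exp_graph_def[abs_def]
    by (intro has_derivative_Pair csmooth_has_derivative[OF cs c] bounded_linear_imp_has_derivative bounded_linear_fst)
  then have "fder exp_graph (c, 0) = (\<lambda>h. (fst h, fder exp_map (c, 0) h))" by (rule frechet_derivative_at[symmetric])
  then have D: "fder exp_graph (c, 0) h = (fst h, fst h + snd h)" for h
    using exp_map_derivative_zero[OF U c, of "fst h" "snd h"] by simp
  have "bounded_linear (\<lambda>h::'n W1inf0 \<times> 'n W1inf0. (fst h, snd h - fst h))"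
    by (intro bounded_linear_Pair bounded_linear_fst bounded_linear_sub bounded_linear_snd)
  from csmooth_inverse[OF F c this] show thesis using that by (auto simp: D)
qed

subsection \<open>The exponential map as a local diffeomorphism\<close>

lemma exp_graph_fst: "fst (exp_graph p) = fst p"
  by (simp add: exp_graph_def)

text \<open>Since \<open>(c, h) \<mapsto> (c, exp\<^sub>c h)\<close> preserves the first component, a union of boxes on which it is
  injective is again a set of injectivity: two boxes over a common base point are nested in the
  fibre.\<close>

lemma exp_graph_diffeomorphism:
  fixes U :: "('n::finite W1inf0 \<times> 'n W1inf0) set"
  assumes U: "exp_domain U" and zero: "immersions \<times> {0} \<subseteq> U"
  shows "\<exists>V W. V \<subseteq> U \<and> immersions \<times> {0} \<subseteq> V \<and> W \<subseteq> immersions \<times> immersions \<and>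
    (\<forall>c\<in>immersions. (c, c) \<in> W) \<and> diffeomorphism V W exp_graph"
proof -
  \<comment> \<open>\<open>q\<close> pairs a domain of local invertibility with a radius. Base and
    fibre ball share the radius, so over a common base point the fibres are ordered by the
    radii.\<close>
  define good where "good c q \<longleftrightarrow> fst q \<subseteq> U \<and> open (exp_graph ` fst q) \<and> inj_on exp_graph (fst q) \<and>
      csmooth (exp_graph ` fst q) (inv_into (fst q) exp_graph) \<and> snd q > 0 \<and>
      ball c (snd q) \<times> ball 0 (snd q) \<subseteq> fst q" for c and q :: "('n W1inf0 \<times> 'n W1inf0) set \<times> real"
  have "\<exists>q. good c q" if c: "c \<in> immersions" for c
  proof -
    have "(c, 0) \<in> U" using zero c by blast
    then obtain V where V: "open V" "(c, 0) \<in> V" "V \<subseteq> U" "open (exp_graph ` V)" "inj_on exp_graph V"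
      "csmooth (exp_graph ` V) (inv_into V exp_graph)"
      by (rule exp_graph_local_inverse[OF U])
    obtain A B where AB: "open A" "open B" "(c, 0) \<in> A \<times> B" "A \<times> B \<subseteq> V"
      by (rule open_prod_elim[OF V(1,2)])
    have cA: "c \<in> A" "0 \<in> B" using AB(3) by simp_all
    obtain a where a: "a > 0" "ball c a \<subseteq> A" using AB(1) cA(1) open_contains_ball by blast
    obtain b where b: "b > 0" "ball 0 b \<subseteq> B" using AB(2) cA(2) open_contains_ball by blast
    have "ball c (min a b) \<subseteq> ball c a" "ball (0 :: 'n W1inf0) (min a b) \<subseteq> ball 0 b" by (simp_all add: subset_ball)
    then have "ball c (min a b) \<times> ball 0 (min a b) \<subseteq> V" using a(2) b(2) AB(4) by blast
    then have "good c (V, min a b)" using V a(1) b(1) by (simp add: good_def)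
    then show ?thesis by blast
  qed
  then have "\<forall>c\<in>immersions. \<exists>q. good c q" by blast
  then obtain q where "\<forall>c\<in>immersions. good c (q c)" by (rule bchoice[THEN exE])
  then have q: "good c (q c)" if "c \<in> immersions" for c using that by (rule bspec)
  define VV where "VV c = fst (q c)" for c
  define r where "r c = snd (q c)" for c
  have V: "VV c \<subseteq> U" "open (exp_graph ` VV c)" "inj_on exp_graph (VV c)"
    "csmooth (exp_graph ` VV c) (inv_into (VV c) exp_graph)" "r c > 0" "ball c (r c) \<times> ball 0 (r c) \<subseteq> VV c"
    if "c \<in> immersions" for c
    using q[OF that] unfolding good_def VV_def r_def by blast+
  define box where "box c = ball c (r c) \<times> ball (0 :: 'n W1inf0) (r c)" for c
  have box: "open (box c)" for c unfolding box_def by (intro open_Times open_ball)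
  have boxV: "box c \<subseteq> VV c" if "c \<in> immersions" for c using V(6)[OF that] by (simp add: box_def)
  define VU where "VU = (\<Union>c\<in>immersions. box c)"
  have oV: "open VU" unfolding VU_def using box by blast
  have VUU: "VU \<subseteq> U" unfolding VU_def using boxV V(1) by blast
  have nested: "p \<in> box a" if "p \<in> box b" "fst p = fst q" "q \<in> box a" "r b \<le> r a" for p q a b
    using that by (auto simp: box_def mem_Times_iff)
  have inj: "inj_on exp_graph VU"
  proof (rule inj_onI)
    fix p q assume "p \<in> VU" "q \<in> VU" and eq: "exp_graph p = exp_graph q"
    then obtain a b where ab: "a \<in> immersions" "p \<in> box a" "b \<in> immersions" "q \<in> box b" unfolding VU_def by blast
    have f: "fst p = fst q" using eq exp_graph_fst by metis
    have "\<exists>d\<in>immersions. p \<in> box d \<and> q \<in> box d"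
    proof (cases "r b \<le> r a")
      case True
      have "q \<in> box a" by (rule nested[OF ab(4) f[symmetric] ab(2) True])
      with ab show ?thesis by blast
    next
      case False
      have "p \<in> box b" by (rule nested[OF ab(2) f ab(4)]) (use False in simp)
      with ab show ?thesis by blast
    qed
    then obtain d where d: "d \<in> immersions" "p \<in> VV d" "q \<in> VV d" using boxV by blast
    show "p = q" by (rule inj_onD[OF V(3)[OF d(1)] eq d(2,3)])
  qed
  define W where "W = exp_graph ` VU"
  have inv: "inv_into VU exp_graph (exp_graph p) = p" if "p \<in> VU" for p by (rule inv_into_f_f[OF inj that])
  have loc: "open (exp_graph ` box c) \<and> csmooth (exp_graph ` box c) (inv_into VU exp_graph)" if c: "c \<in> immersions" for c
  proof -
    let ?g = "inv_into (VV c) exp_graph"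
    have g: "?g (exp_graph p) = p" if "p \<in> VV c" for p by (rule inv_into_f_f[OF V(3)[OF c] that])
    have "exp_graph ` box c = exp_graph ` VV c \<inter> ?g -` box c"
    proof (intro equalityI subsetI)
      fix y assume "y \<in> exp_graph ` box c"
      then obtain p where p: "p \<in> box c" "y = exp_graph p" by blast
      then have "p \<in> VV c" using boxV[OF c] by blast
      with p show "y \<in> exp_graph ` VV c \<inter> ?g -` box c" by (simp add: g)
    next
      fix y assume y: "y \<in> exp_graph ` VV c \<inter> ?g -` box c"
      then obtain p where p: "p \<in> VV c" "y = exp_graph p" by blast
      with y have "p \<in> box c" by (simp add: g)
      with p(2) show "y \<in> exp_graph ` box c" by blast
    qed
    then have o: "open (exp_graph ` box c)"
      using continuous_open_preimage[OF csmooth_continuous_on[OF V(4)[OF c]] V(2)[OF c] box] by simp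
    have cg: "csmooth (exp_graph ` box c) ?g"
      by (rule csmooth_subset[OF V(4)[OF c] image_mono[OF boxV[OF c]] o])
    \<comment> \<open>The point lies in \<open>VV c\<close> and in \<open>VU\<close>, and the map is
      injective on both, so the two inverses return the same preimage.\<close>
    have eq: "?g y = inv_into VU exp_graph y" if y: "y \<in> exp_graph ` box c" for y
    proof -
      obtain p where p: "p \<in> box c" "y = exp_graph p" using y by blast
      have "p \<in> VU" "p \<in> VV c" using p(1) c boxV[OF c] unfolding VU_def by blast+
      then show ?thesis using p(2) g inv by simp
    qed
    have "csmooth (exp_graph ` box c) (inv_into VU exp_graph)"
      by (rule csmooth_cong[OF eq, THEN iffD1, OF _ cg])
    with o show ?thesis by blast
  qed
  have cW: "csmooth W (inv_into VU exp_graph)"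
  proof (rule csmooth_local)
    fix y assume "y \<in> W"
    then obtain c p where c: "c \<in> immersions" "p \<in> box c" "y = exp_graph p" unfolding W_def VU_def by blast
    then show "\<exists>T. y \<in> T \<and> T \<subseteq> W \<and> csmooth T (inv_into VU exp_graph)"
      using loc[OF c(1)] by (intro exI[of _ "exp_graph ` box c"]) (auto simp: W_def VU_def)
  qed
  have cF: "csmooth VU exp_graph"
  proof -
    have "csmooth U exp_graph" unfolding exp_graph_def[abs_def]
      by (intro csmooth_Pair csmooth_linear csmooth_open[OF exp_domainD(2)[OF U]] bounded_linear_fst exp_domainD(2)[OF U])
    then show ?thesis by (rule csmooth_subset[OF _ VUU oV])
  qed
  have "diffeomorphism VU W exp_graph"
    unfolding diffeomorphism_def
  proof (intro conjI)
    show "bij_betw exp_graph VU W" using inj by (simp add: bij_betw_def W_def)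
  qed (use oV csmooth_open[OF cW] csmooth_imp_smooth_on[OF cF] csmooth_imp_smooth_on[OF cW] in blast)+
  moreover have z: "immersions \<times> {0} \<subseteq> VU"
  proof (rule subsetI)
    fix p :: "'n W1inf0 \<times> 'n W1inf0" assume "p \<in> immersions \<times> {0}"
    then obtain c where c: "p = (c, 0)" "c \<in> immersions" by blast
    then have "p \<in> box c" using V(5)[OF c(2)] by (simp add: box_def)
    then show "p \<in> VU" using c(2) unfolding VU_def by blast
  qed
  moreover have "W \<subseteq> immersions \<times> immersions"
  proof (rule subsetI)
    fix y assume "y \<in> W"
    then obtain p where p: "p \<in> U" "y = exp_graph p" unfolding W_def using VUU by blast
    have "(fst p, snd p) \<in> U" using p(1) by simp
    then obtain J \<gamma> where J: "1 \<in> J" "geodesic_ivp J \<gamma> (fst p) (snd p)" using exp_domainD(3)[OF U] by blast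
    have "exp_map p = \<gamma> 1" using geodesic_exp_eq[OF J(2,1)] by (simp add: exp_map_def)
    moreover have "\<gamma> 1 \<in> immersions" using J unfolding geodesic_ivp_def by blast
    ultimately show "y \<in> immersions \<times> immersions"
      using exp_domainD(1)[OF U p(1)] by (simp add: p(2) exp_graph_def)
  qed
  moreover have "(c, c) \<in> W" if "c \<in> immersions" for c
  proof -
    have "(c, 0) \<in> VU" using z that by blast
    then have "exp_graph (c, 0) \<in> W" unfolding W_def by (rule imageI)
    then show ?thesis using exp_map_zero[OF that] by (simp add: exp_graph_def)
  qed
  ultimately show ?thesis using VUU by blast
qed

theorem theorem2p9:
  assumes "CARD('n::finite) \<ge> 2"
  shows
    "(\<forall>c\<^sub>0\<in>immersions :: 'n W1inf0 set. \<forall>h\<^sub>0. \<exists>\<epsilon>>0. \<exists>N. \<exists>\<Phi> :: 'n W1inf0 \<times> 'n W1inf0 \<Rightarrow> real \<Rightarrow> 'n W1inf0.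
        open N \<and> (c\<^sub>0, h\<^sub>0) \<in> N \<and> N \<subseteq> immersions \<times> UNIV \<and>
        (\<forall>(c, h)\<in>N. geodesic_ivp {-\<epsilon><..<\<epsilon>} (\<Phi> (c, h)) c h) \<and>
        smooth_on ({-\<epsilon><..<\<epsilon>} \<times> N) (\<lambda>(t, c, h). \<Phi> (c, h) t)) \<and>
     (\<forall>J \<gamma>\<^sub>1 \<gamma>\<^sub>2. \<forall>c h :: 'n W1inf0.
        geodesic_ivp J \<gamma>\<^sub>1 c h \<and> geodesic_ivp J \<gamma>\<^sub>2 c h \<longrightarrow> (\<forall>t\<in>J. \<gamma>\<^sub>1 t = \<gamma>\<^sub>2 t)) \<and>
     (\<exists>U :: ('n W1inf0 \<times> 'n W1inf0) set.
        open U \<and> immersions \<times> {0} \<subseteq> U \<and> U \<subseteq> immersions \<times> UNIV \<and>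
        (\<forall>(c, h)\<in>U. \<exists>J \<gamma>. 1 \<in> J \<and> geodesic_ivp J \<gamma> c h) \<and>
        smooth_on U (\<lambda>(c, h). geodesic_exp c h) \<and>
        (\<exists>V W. V \<subseteq> U \<and> immersions \<times> {0} \<subseteq> V \<and>
           W \<subseteq> immersions \<times> immersions \<and> (\<forall>c\<in>immersions. (c, c) \<in> W) \<and>
           diffeomorphism V W (\<lambda>(c, h). (c, geodesic_exp c h))))"
proof (intro conjI)
  show "\<forall>c\<^sub>0\<in>immersions :: 'n W1inf0 set. \<forall>h\<^sub>0. \<exists>\<epsilon>>0. \<exists>N. \<exists>\<Phi> :: 'n W1inf0 \<times> 'n W1inf0 \<Rightarrow> real \<Rightarrow> 'n W1inf0.
        open N \<and> (c\<^sub>0, h\<^sub>0) \<in> N \<and> N \<subseteq> immersions \<times> UNIV \<and>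
        (\<forall>(c, h)\<in>N. geodesic_ivp {-\<epsilon><..<\<epsilon>} (\<Phi> (c, h)) c h) \<and>
        smooth_on ({-\<epsilon><..<\<epsilon>} \<times> N) (\<lambda>(t, c, h). \<Phi> (c, h) t)"
  proof (intro ballI allI)
    fix c\<^sub>0 h\<^sub>0 :: "'n W1inf0" assume "c\<^sub>0 \<in> immersions"
    then show "\<exists>\<epsilon>>0. \<exists>N. \<exists>\<Phi> :: 'n W1inf0 \<times> 'n W1inf0 \<Rightarrow> real \<Rightarrow> 'n W1inf0.
        open N \<and> (c\<^sub>0, h\<^sub>0) \<in> N \<and> N \<subseteq> immersions \<times> UNIV \<and>
        (\<forall>(c, h)\<in>N. geodesic_ivp {-\<epsilon><..<\<epsilon>} (\<Phi> (c, h)) c h) \<and>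
        smooth_on ({-\<epsilon><..<\<epsilon>} \<times> N) (\<lambda>(t, c, h). \<Phi> (c, h) t)"
    proof (rule geodesic_flow[of c\<^sub>0 h\<^sub>0])
      fix \<epsilon> N and \<Phi> :: "'n W1inf0 \<times> 'n W1inf0 \<Rightarrow> real \<Rightarrow> 'n W1inf0"
      assume f: "\<epsilon> > 0" "open N" "(c\<^sub>0, h\<^sub>0) \<in> N" "N \<subseteq> phase"
        "\<And>c h :: 'n W1inf0. (c, h) \<in> N \<Longrightarrow> geodesic_ivp {-\<epsilon><..<\<epsilon>} (\<Phi> (c, h)) c h"
        "csmooth ({-\<epsilon><..<\<epsilon>} \<times> N) (\<lambda>(t, c, h). \<Phi> (c, h) t)"
      have "\<forall>(c, h)\<in>N. geodesic_ivp {-\<epsilon><..<\<epsilon>} (\<Phi> (c, h)) c h"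
        by (rule ballI, rule case_prodI2) (simp add: f(5))
      then show ?thesis
        using f(1-4) csmooth_imp_smooth_on[OF f(6)]
        by (intro exI[of _ \<epsilon>] exI[of _ N] exI[of _ \<Phi>] conjI)
    qed
  qed
  show "\<forall>J \<gamma>\<^sub>1 \<gamma>\<^sub>2. \<forall>c h :: 'n W1inf0.
        geodesic_ivp J \<gamma>\<^sub>1 c h \<and> geodesic_ivp J \<gamma>\<^sub>2 c h \<longrightarrow> (\<forall>t\<in>J. \<gamma>\<^sub>1 t = \<gamma>\<^sub>2 t)"
  proof (intro allI impI ballI)
    fix J \<gamma>\<^sub>1 \<gamma>\<^sub>2 t and c h :: "'n W1inf0"
    assume "geodesic_ivp J \<gamma>\<^sub>1 c h \<and> geodesic_ivp J \<gamma>\<^sub>2 c h" "t \<in> J"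
    then show "\<gamma>\<^sub>1 t = \<gamma>\<^sub>2 t" by (elim conjE) (rule geodesic_unique)
  qed
  \<comment> \<open>The largest domain: the union inherits all properties, and it contains the zero
    section because every point of it has such a neighborhood.\<close>
  define U :: "('n W1inf0 \<times> 'n W1inf0) set" where "U = \<Union>{U. exp_domain U}"
  have cU: "csmooth U exp_map"
  proof (rule csmooth_local)
    fix p assume "p \<in> U"
    then obtain U' where U': "p \<in> U'" "exp_domain U'" unfolding U_def by blast
    moreover have "U' \<subseteq> U" using U'(2) unfolding U_def by blast
    ultimately show "\<exists>T. p \<in> T \<and> T \<subseteq> U \<and> csmooth T exp_map" using exp_domainD(2)[OF U'(2)] by blast
  qed
  have U: "exp_domain U"
    unfolding exp_domain_def
  proof (intro conjI cU)
    show "U \<subseteq> phase" unfolding U_def exp_domain_def by blast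
    show "\<forall>(c, h)\<in>U. \<exists>J \<gamma>. 1 \<in> J \<and> geodesic_ivp J \<gamma> c h"
    proof (rule ballI, rule case_prodI2)
      fix p and c h :: "'n W1inf0" assume p: "p \<in> U" "p = (c, h)"
      then obtain U' where "(c, h) \<in> U'" "exp_domain U'" unfolding U_def by blast
      then show "\<exists>J \<gamma>. 1 \<in> J \<and> geodesic_ivp J \<gamma> c h" using exp_domainD(3) by blast
    qed
  qed
  have zero: "immersions \<times> {0} \<subseteq> U"
  proof
    fix p :: "'n W1inf0 \<times> 'n W1inf0" assume "p \<in> immersions \<times> {0}"
    then obtain c where "p = (c, 0)" "c \<in> immersions" by blast
    then show "p \<in> U" using exp_domain_near_zero[of c] unfolding U_def by blast
  qed
  have e: "(\<lambda>(c, h). geodesic_exp c h) = (exp_map :: 'n W1inf0 \<times> 'n W1inf0 \<Rightarrow> _)"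
    "(\<lambda>(c, h). (c, geodesic_exp c h)) = (exp_graph :: 'n W1inf0 \<times> 'n W1inf0 \<Rightarrow> _)"
    by (auto simp: exp_map_def exp_graph_def)
  show "\<exists>U :: ('n W1inf0 \<times> 'n W1inf0) set.
        open U \<and> immersions \<times> {0} \<subseteq> U \<and> U \<subseteq> immersions \<times> UNIV \<and>
        (\<forall>(c, h)\<in>U. \<exists>J \<gamma>. 1 \<in> J \<and> geodesic_ivp J \<gamma> c h) \<and>
        smooth_on U (\<lambda>(c, h). geodesic_exp c h) \<and>
        (\<exists>V W. V \<subseteq> U \<and> immersions \<times> {0} \<subseteq> V \<and>
           W \<subseteq> immersions \<times> immersions \<and> (\<forall>c\<in>immersions. (c, c) \<in> W) \<and>
           diffeomorphism V W (\<lambda>(c, h). (c, geodesic_exp c h)))"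
    unfolding e
  proof (rule exI[of _ U], intro conjI)
    show "open U" by (rule csmooth_open[OF cU])
    show "smooth_on U exp_map" by (rule csmooth_imp_smooth_on[OF cU])
    show "U \<subseteq> phase" using U unfolding exp_domain_def by (elim conjE)
    show "\<forall>(c, h)\<in>U. \<exists>J \<gamma>. 1 \<in> J \<and> geodesic_ivp J \<gamma> c h"
      using U unfolding exp_domain_def by (elim conjE)
  qed (rule zero exp_graph_diffeomorphism[OF U zero])+
qed

end
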